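(* Let $T$ be a Calderón--Zygmund operator on $\mathbb{R}^n$, let $\Phi=\{\phi_\alpha\}_{\alpha\in\mathcal{I}}$ be a family of real-valued measurable functions indexed by an arbitrary set $\mathcal{I}$, and let $T^\Phi$ be the associated maximally modulated Calderón--Zygmund operator $T^{\Phi}f(x)=\sup_{\alpha\in\mathcal{I}}|T(e^{2\pi i\phi_\alpha}f)(x)|$. Assume that for some $r_0>1$ the operator $T^\Phi$ satisfies the a priori weak-type unweighted inequalities $$\|T^{\Phi}f\|_{L^{r,\infty}(\mathbb{R}^n)}\lesssim\psi(r)\|f\|_{L^r(\mathbb{R}^n)},\qquad 1<r\le r_0,$$ where $\psi(r)$ is a function that captures the dependence of the operator norm on $r$. Let $1<p<\infty$, $\frac1p+\frac1{p'}=1$, and suppose that $A$ is a doubling Young function satisfying $$\int_c^\infty\Big(\frac{t}{A(t)}\Big)^{p'-1}\frac{dt}{t}<\infty\quad\text{for some }c>0.$$ Then there is a constant $C<\infty$, independent of $f$ and $w$, such that for any weight $w$ $$\int_{\mathbb{R}^n}|T^{\Phi}f(x)|^p\,w(x)\,dx\le C\int_{\mathbb{R}^n}|f(x)|^p\,M_Aw(x)\,dx .$$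
   Context: A weight is a non-negative locally integrable function. $X\lesssim Y$ means $X\le cY$ for a constant $c$ that is, in particular, independent of the function $f$. A Young function is a continuous, convex, increasing function $A:[0,\infty)\to[0,\infty)$ with $A(0)=0$ and $A(t)\to\infty$ as $t\to\infty$; it is doubling if there is a positive constant $C'$ with $A(2t)\le C'A(t)$ for $t>0$. For a cube $Q\subset\mathbb{R}^n$, the Luxemburg norm is $\|f\|_{A,Q}=\inf\{\lambda>0:\frac1{|Q|}\int_QA(|f(y)|/\lambda)\,dy\le1\}$, and $M_Af(x)=\sup_{Q\ni x}\|f\|_{A,Q}$ for locally integrable $f$, the supremum being over all cubes $Q$ in $\mathbb{R}^n$ containing $x$. A Calderón--Zygmund operator $T$ on $\mathbb{R}^n$ is an $L^2$-bounded linear operator represented as $Tf(x)=\int_{\mathbb{R}^n}K(x,y)f(y)\,dy$ for $x\notin\operatorname{supp}f$, where the kernel $K$ satisfies, for some constant $c_K$: (i) $|K(x,y)|\le c_K|x-y|^{-n}$ for all $x\ne y$; (ii) $|K(x,y)-K(x',y)|+|K(y,x)-K(y,x')|\le c_K\frac{|x-x'|^\delta}{|x-y|^{n+\delta}}$ for some $0<\delta\le1$ when $|x-x'|<|x-y|/2$. *)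

theory Defs
  imports "HOL-Analysis.Analysis"
begin

section \<open>Lebesgue and weak Lebesgue spaces\<close>

text \<open>Only used with exponents \<open>r > 0\<close>, so that \<open>0\<close> and \<open>\<infinity>\<close> are mapped to themselves.\<close>

definition epowr :: "ennreal \<Rightarrow> real \<Rightarrow> ennreal" where
  "epowr x r = (if x = top then top else ennreal (enn2real x powr r))"

definition Lp_norm :: "real \<Rightarrow> (real^'n \<Rightarrow> complex) \<Rightarrow> ennreal" where
  "Lp_norm r f = epowr (\<integral>\<^sup>+x. ennreal (cmod (f x) powr r) \<partial>lebesgue) (1 / r)"

definition Lp_space :: "real \<Rightarrow> (real^'n \<Rightarrow> complex) set" where
  "Lp_space r = {f. f \<in> borel_measurable lebesgue \<and> Lp_norm r f < top}"

definition weak_Lp_norm :: "real \<Rightarrow> (real^'n \<Rightarrow> ennreal) \<Rightarrow> ennreal" where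
  "weak_Lp_norm r g =
     (SUP t\<in>{0<..}. ennreal t * epowr (emeasure lebesgue {x. g x > ennreal t}) (1 / r))"

section \<open>Calderon--Zygmund operators\<close>

text \<open>With \<open>n = CARD('n)\<close>; the condition \<open>norm (x - x') < norm (x - y) / 2\<close> forces \<open>x \<noteq> y\<close>.\<close>

definition CZ_kernel :: "(real^'n \<Rightarrow> real^'n \<Rightarrow> complex) \<Rightarrow> bool" where
  "CZ_kernel K \<longleftrightarrow> (\<exists>c \<delta>::real. 0 < \<delta> \<and> \<delta> \<le> 1 \<and>
     (\<forall>x y. x \<noteq> y \<longrightarrow> cmod (K x y) \<le> c / norm (x - y) ^ CARD('n)) \<and>
     (\<forall>x x' y. norm (x - x') < norm (x - y) / 2 \<longrightarrow>
        cmod (K x y - K x' y) + cmod (K y x - K y x')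
          \<le> c * (norm (x - x') powr \<delta> / norm (x - y) powr (real CARD('n) + \<delta>))))"

text \<open>
  The functions to which an operator may be applied: a linear space of measurable functions that
  contains \<open>L\<^sup>2\<close> and is closed under multiplication by bounded measurable functions (so that
  modulations \<open>e\<^sup>2\<^sup>\<pi>\<^sup>i\<^sup>\<phi> f\<close> stay in it). \<open>L\<^sup>2\<close> itself is the smallest such space; a larger
  space accommodates operators already extended beyond \<open>L\<^sup>2\<close>.
\<close>

definition operator_domain :: "(real^'n \<Rightarrow> complex) set \<Rightarrow> bool" where
  "operator_domain D \<longleftrightarrow>
     Lp_space 2 \<subseteq> D \<and> D \<subseteq> borel_measurable lebesgue \<and>
     (\<forall>f\<in>D. \<forall>g\<in>D. (\<lambda>x. f x + g x) \<in> D) \<and>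
     (\<forall>f\<in>D. \<forall>b. b \<in> borel_measurable lebesgue \<and> bounded (range b) \<longrightarrow> (\<lambda>x. b x * f x) \<in> D)"

text \<open>
  \<open>T f\<close> is an honest function and not a class modulo null sets: linearity and the kernel
  representation hold at every point (resp. at every point off the support). This is what makes
  the pointwise supremum over a possibly uncountable family of modulations meaningful.
\<close>

definition CZ_operator ::
  "(real^'n \<Rightarrow> complex) set \<Rightarrow> ((real^'n \<Rightarrow> complex) \<Rightarrow> real^'n \<Rightarrow> complex) \<Rightarrow> bool" where
  "CZ_operator D T \<longleftrightarrow>
     operator_domain D \<and>
     (\<forall>f\<in>D. \<forall>g\<in>D. \<forall>x. T (\<lambda>y. f y + g y) x = T f x + T g x) \<and>
     (\<forall>f\<in>D. \<forall>c x. T (\<lambda>y. c * f y) x = c * T f x) \<and>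
     (\<exists>B::real. \<forall>f\<in>Lp_space 2. T f \<in> Lp_space 2 \<and> Lp_norm 2 (T f) \<le> ennreal B * Lp_norm 2 f) \<and>
     (\<exists>K. CZ_kernel K \<and>
        (\<forall>f\<in>D. \<forall>x. x \<notin> closure {y. f y \<noteq> 0} \<longrightarrow>
           integrable lebesgue (\<lambda>y. K x y * f y) \<and>
           T f x = (\<integral>y. K x y * f y \<partial>lebesgue)))"

definition max_modulated ::
  "((real^'n \<Rightarrow> complex) \<Rightarrow> real^'n \<Rightarrow> complex) \<Rightarrow> 'i set \<Rightarrow> ('i \<Rightarrow> real^'n \<Rightarrow> real) \<Rightarrow>
   (real^'n \<Rightarrow> complex) \<Rightarrow> real^'n \<Rightarrow> ennreal" where
  "max_modulated T I \<phi> f x =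
     (SUP \<alpha>\<in>I. ennreal (cmod (T (\<lambda>y. exp (2 * of_real pi * \<i> * of_real (\<phi> \<alpha> y)) * f y) x)))"

text \<open>
  \<open>S f\<close> being measurable is part of the assertion that it lies in weak \<open>L\<^sup>r\<close>. The estimate
  is only required of those \<open>f \<in> L\<^sup>r\<close> to which the operator applies.
\<close>

definition weak_type_on ::
  "(real^'n \<Rightarrow> complex) set \<Rightarrow> ((real^'n \<Rightarrow> complex) \<Rightarrow> real^'n \<Rightarrow> ennreal) \<Rightarrow> real \<Rightarrow> real \<Rightarrow> bool"
where
  "weak_type_on D S r N \<longleftrightarrow>
     (\<forall>f \<in> D \<inter> Lp_space r. S f \<in> borel_measurable lebesgue \<and>
        weak_Lp_norm r (S f) \<le> ennreal N * Lp_norm r f)"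

section \<open>Weights, Young functions and Orlicz maximal operators\<close>

definition weight :: "(real^'n \<Rightarrow> real) \<Rightarrow> bool" where
  "weight w \<longleftrightarrow> (\<forall>x. 0 \<le> w x) \<and> (\<forall>K. compact K \<longrightarrow> set_integrable lebesgue K w)"

definition young_function :: "(real \<Rightarrow> real) \<Rightarrow> bool" where
  "young_function A \<longleftrightarrow>
     continuous_on {0..} A \<and> convex_on {0..} A \<and> mono_on {0..} A \<and> A 0 = 0 \<and>
     filterlim A at_top at_top"

definition doubling :: "(real \<Rightarrow> real) \<Rightarrow> bool" where
  "doubling A \<longleftrightarrow> (\<exists>C>0. \<forall>t>0. A (2 * t) \<le> C * A t)"

text \<open>Cubes are non-degenerate, closed, and have sides parallel to the axes.\<close>

definition cubes :: "(real^'n) set set" where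
  "cubes = {cbox a (\<chi> i. a $ i + l) | a l. l > 0}"

definition luxemburg_norm :: "(real \<Rightarrow> real) \<Rightarrow> (real^'n) set \<Rightarrow> (real^'n \<Rightarrow> real) \<Rightarrow> ennreal" where
  "luxemburg_norm A Q f =
     Inf {ennreal s | s. s > 0 \<and>
       (\<integral>\<^sup>+y\<in>Q. ennreal (A (\<bar>f y\<bar> / s)) \<partial>lebesgue) / emeasure lebesgue Q \<le> 1}"

definition orlicz_maximal :: "(real \<Rightarrow> real) \<Rightarrow> (real^'n \<Rightarrow> real) \<Rightarrow> real^'n \<Rightarrow> ennreal" where
  "orlicz_maximal A f x = (SUP Q\<in>{Q \<in> cubes. x \<in> Q}. luxemburg_norm A Q f)"

end

(*
  For a cube Q let lambda Q be a fixed dilate and a_Q the L^r average of f over lambda Q, where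
  1 < r < p, r <= r_0. The weak (r,r) bound and the smoothness of the kernel show that, outside
  disjoint dyadic subcubes P of Q of total measure at most |Q|/2, T^Phi(f 1_{lambda Q}) is at most
  C a_Q, while on each P it is at most C a_Q + T^Phi(f 1_{lambda P}). Iterating, T^Phi f is dominated
  by a sparse sum of a_Q 1_Q. Dualising that sum against S^(p-1) w, the Luxemburg norm of w over
  lambda Q is absorbed into f, and what is left is controlled by two Carleson embeddings, one for
  L^r averages and one for the Young conjugate of A(t^p); the integral condition on A is exactly
  the B_{p'} condition for that conjugate function.
*)
theory Submission
  imports Defs
begin

text \<open>The duality is with the sparse sum itself: if Y is its weighted p-th power integral and
  X the right-hand side, the two embeddings give Y <= C X + Y/2, and Y has to be finite before it
  can be absorbed. This dictates the reductions: finite families of cubes, then monotone convergence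
  on a fixed starting cube, then starting cubes growing to the whole space, where the part of f
  outside a large dilate is pointwise negligible by the kernel representation. One exponent r is
  fixed, and r < p is strict because the embedding for L^r averages at exponent p diverges at r = p.
  The supremum may run over an uncountable set, so measurability of T^Phi f is never derived; it
  comes only from the weak-type hypothesis, applied to truncations with finite L^r norm. For the
  same reason M_A w is replaced by finite maxima of Luxemburg norms wherever a measurable function
  is required. The modulations do no harm because they are unimodular functions of y, so absolute
  estimates of kernel differences do not see them.\<close>

section \<open>Dyadic cubes and their dilates\<close>

text \<open>
  A pair \<open>(k, m)\<close> encodes the half-open cube of generation \<open>k\<close> and integer position \<open>m\<close> in the
  dyadic grid obtained by repeatedly halving the cube \<open>(0, 0)\<close>, whose sides are \<open>[-L, L)\<close>.
\<close>

definition side :: "real \<Rightarrow> nat \<Rightarrow> real" where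
  "side L k = 2 * L / 2 ^ k"

definition corner :: "real \<Rightarrow> nat \<Rightarrow> int^'n \<Rightarrow> real^'n" where
  "corner L k m = (\<chi> i. side L k * of_int (m $ i) - L)"

definition dcube :: "real \<Rightarrow> nat \<times> (int^'n) \<Rightarrow> (real^'n) set" where
  "dcube L q = {x. \<forall>i. corner L (fst q) (snd q) $ i \<le> x $ i \<and>
                       x $ i < corner L (fst q) (snd q) $ i + side L (fst q)}"

text \<open>
  The dilate of a cube of side \<open>s\<close> adds \<open>margin * s\<close> on each side; the value \<open>2 n + 1\<close> makes the
  kernel regularity condition available for two points of the cube and one outside the dilate.
\<close>

definition margin :: "'n itself \<Rightarrow> real" where
  "margin _ = 2 * real CARD('n) + 1"

definition dil :: "real \<Rightarrow> nat \<times> (int^'n) \<Rightarrow> (real^'n) set" where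
  "dil L q = cbox (\<chi> i. corner L (fst q) (snd q) $ i - margin TYPE('n) * side L (fst q))
                  (\<chi> i. corner L (fst q) (snd q) $ i + (1 + margin TYPE('n)) * side L (fst q))"

definition vol :: "real \<Rightarrow> nat \<times> (int^'n) \<Rightarrow> real" where
  "vol L q = side L (fst q) ^ CARD('n)"

definition dil_ratio :: "'n itself \<Rightarrow> real" where
  "dil_ratio _ = (1 + 2 * margin TYPE('n)) ^ CARD('n)"

text \<open>Cubes are mostly handled as \<open>(k, index L k x)\<close> for a point \<open>x\<close>
  in them: lowering \<open>k\<close> alone then runs through the ancestors. Positions may be
  negative, since the grid fills the whole space.\<close>

definition index :: "real \<Rightarrow> nat \<Rightarrow> real^'n \<Rightarrow> int^'n" where
  "index L k x = (\<chi> i. \<lfloor>(x $ i + L) / side L k\<rfloor>)"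

text \<open>Integer division rounds towards minus infinity, so for \<open>j \<le> fst q\<close> this
  is the dyadic ancestor of generation \<open>j\<close> at negative positions as well.\<close>

definition anc :: "nat \<Rightarrow> nat \<times> (int^'n) \<Rightarrow> nat \<times> (int^'n)" where
  "anc j q = (j, \<chi> i. snd q $ i div 2 ^ (fst q - j))"

lemma side_pos: "L > 0 \<Longrightarrow> side L k > 0"
  by (simp add: side_def)

lemma side_le: "L > 0 \<Longrightarrow> side L k \<le> 2 * L"
  by (simp add: side_def field_simps)

lemma side_mono: "L > 0 \<Longrightarrow> j \<le> k \<Longrightarrow> side L k = side L j / 2 ^ (k - j)"
  by (simp add: side_def power_add[symmetric] field_simps)

lemma vol_pos: "L > 0 \<Longrightarrow> vol L q > 0"
  by (simp add: vol_def side_pos)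

lemma margin_ge: "margin TYPE('n::finite) \<ge> 3"
  using zero_less_card_finite[where 'a='n] by (simp add: margin_def del: zero_less_card_finite)

lemma dil_ratio_ge: "dil_ratio TYPE('n::finite) \<ge> 1"
  using margin_ge[where 'n='n] by (simp add: dil_ratio_def)

lemma prod_Basis_vec:
  fixes g :: "real^'n \<Rightarrow> real"
  shows "prod g Basis = (\<Prod>i\<in>UNIV. g (axis i 1))"
proof -
  have eq: "(Basis :: (real^'n) set) = (\<lambda>i. axis i 1) ` UNIV"
    by (auto simp: Basis_vec_def)
  have inj: "inj (\<lambda>i. axis i (1::real) :: real^'n)"
    by (auto simp: inj_on_def axis_eq_axis)
  show ?thesis
    unfolding eq by (simp add: prod.reindex[OF inj])
qed

lemma emeasure_cube:
  fixes a :: "real^'n"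
  assumes "l \<ge> 0"
  shows "emeasure lebesgue (cbox a (\<chi> i. a $ i + l)) = ennreal (l ^ CARD('n))"
    and "emeasure lebesgue (box a (\<chi> i. a $ i + l)) = ennreal (l ^ CARD('n))"
proof -
  have 1: "\<forall>b\<in>Basis. a \<bullet> b \<le> (\<chi> i. a $ i + l) \<bullet> b"
    using assms by (auto simp: Basis_vec_def inner_axis)
  have 2: "(\<Prod>b\<in>Basis. ((\<chi> i. a $ i + l) - a) \<bullet> b) = l ^ CARD('n)"
    by (simp add: prod_Basis_vec inner_axis)
  show "emeasure lebesgue (cbox a (\<chi> i. a $ i + l)) = ennreal (l ^ CARD('n))"
    and "emeasure lebesgue (box a (\<chi> i. a $ i + l)) = ennreal (l ^ CARD('n))"
    using 1 2 by (simp_all add: emeasure_lborel_cbox_eq emeasure_lborel_box_eq)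
qed

lemma sets_dcube [measurable]: "dcube L q \<in> sets lebesgue"
proof -
  have "dcube L q = (\<Inter>i\<in>UNIV. {x. corner L (fst q) (snd q) $ i \<le> x $ i} \<inter> {x. x $ i < corner L (fst q) (snd q) $ i + side L (fst q)})"
    by (auto simp: dcube_def)
  also have "\<dots> \<in> sets borel"
    by (intro sets.finite_INT sets.Int borel_closed borel_open closed_Collect_le open_Collect_less continuous_intros) simp_all
  finally show ?thesis by simp
qed

lemma emeasure_dcube:
  assumes "L > 0"
  shows "emeasure lebesgue (dcube L q) = ennreal (vol L q)"
proof (rule antisym)
  let ?a = "corner L (fst q) (snd q)" and ?l = "side L (fst q)"
  have l: "?l \<ge> 0" using side_pos[OF assms] less_imp_le by blast
  have "dcube L q \<subseteq> cbox ?a (\<chi> i. ?a $ i + ?l)"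
    by (auto simp: dcube_def mem_box_cart less_imp_le)
  then have "emeasure lebesgue (dcube L q) \<le> emeasure lebesgue (cbox ?a (\<chi> i. ?a $ i + ?l))"
    by (intro emeasure_mono) auto
  then show "emeasure lebesgue (dcube L q) \<le> ennreal (vol L q)"
    by (simp only: emeasure_cube[OF l] vol_def)
  have "box ?a (\<chi> i. ?a $ i + ?l) \<subseteq> dcube L q"
    by (auto simp: dcube_def mem_box_cart less_imp_le)
  then have "emeasure lebesgue (box ?a (\<chi> i. ?a $ i + ?l)) \<le> emeasure lebesgue (dcube L q)"
    by (intro emeasure_mono) auto
  then show "ennreal (vol L q) \<le> emeasure lebesgue (dcube L q)"
    by (simp only: emeasure_cube[OF l] vol_def)
qed

lemma dil_eq:
  fixes q :: "nat \<times> (int^'n)"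
  shows "dil L q = cbox (\<chi> i. corner L (fst q) (snd q) $ i - margin TYPE('n) * side L (fst q))
     (\<chi> i. (\<chi> i. corner L (fst q) (snd q) $ i - margin TYPE('n) * side L (fst q)) $ i
           + (1 + 2 * margin TYPE('n)) * side L (fst q))"
  by (simp add: dil_def algebra_simps)

lemma dil_in_cubes:
  fixes q :: "nat \<times> (int^'n)"
  assumes "L > 0" shows "dil L q \<in> cubes"
proof -
  have "(1 + 2 * margin TYPE('n)) * side L (fst q) > 0"
    using assms margin_ge[where 'n='n] by (simp add: side_pos)
  then show ?thesis
    unfolding cubes_def dil_eq by blast
qed

lemma sets_dil [measurable]: "dil L q \<in> sets lebesgue"
  by (simp add: dil_def)

lemma emeasure_dil:
  fixes q :: "nat \<times> (int^'n)"
  assumes "L > 0"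
  shows "emeasure lebesgue (dil L q) = ennreal (dil_ratio TYPE('n) * vol L q)"
proof -
  have "(1 + 2 * margin TYPE('n)) * side L (fst q) \<ge> 0"
    using assms margin_ge[where 'n='n] by (simp add: side_pos less_imp_le)
  from emeasure_cube(1)[where 'n='n, OF this] show ?thesis
    unfolding dil_eq dil_ratio_def vol_def power_mult_distrib by blast
qed

lemma dcube_subset_dil:
  fixes q :: "nat \<times> (int^'n)"
  assumes "L > 0" shows "dcube L q \<subseteq> dil L q"
proof -
  have "margin TYPE('n) * side L (fst q) \<ge> 0"
    using assms margin_ge[where 'n='n] by (simp add: side_pos less_imp_le)
  then have "a - margin TYPE('n) * side L (fst q) \<le> z" "z \<le> a + (1 + margin TYPE('n)) * side L (fst q)"
    if "a \<le> z" "z < a + side L (fst q)" for a z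
    using that by (simp_all add: distrib_right)
  then show ?thesis
    by (simp add: dcube_def dil_def mem_box_cart subset_iff)
qed

lemma norm_diff_dcube:
  fixes x y :: "real^'n"
  assumes "L > 0" "x \<in> dcube L q" "y \<in> dcube L q"
  shows "norm (x - y) \<le> real CARD('n) * side L (fst q)"
proof -
  have "norm (x - y) \<le> (\<Sum>i\<in>UNIV. \<bar>(x - y) $ i\<bar>)"
    by (rule norm_le_l1_cart)
  also have "\<dots> \<le> (\<Sum>i\<in>(UNIV::'n set). side L (fst q))"
  proof (rule sum_mono)
    fix i
    have "corner L (fst q) (snd q) $ i \<le> x $ i \<and> x $ i < corner L (fst q) (snd q) $ i + side L (fst q)"
      "corner L (fst q) (snd q) $ i \<le> y $ i \<and> y $ i < corner L (fst q) (snd q) $ i + side L (fst q)"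
      using assms by (auto simp: dcube_def)
    then show "\<bar>(x - y) $ i\<bar> \<le> side L (fst q)" unfolding vector_minus_component by linarith
  qed
  finally show ?thesis by simp
qed

lemma norm_diff_outside_dil:
  fixes x y :: "real^'n"
  assumes "L > 0" "x \<in> dcube L q" "y \<notin> dil L q"
  shows "margin TYPE('n) * side L (fst q) \<le> norm (x - y)"
proof -
  let ?M = "margin TYPE('n) * side L (fst q)"
  have *: "corner L (fst q) (snd q) $ i \<le> x $ i \<and> x $ i < corner L (fst q) (snd q) $ i + side L (fst q)" for i
    using assms by (auto simp: dcube_def)
  from assms(3) obtain i where "y $ i < corner L (fst q) (snd q) $ i - ?M \<or>
     y $ i > corner L (fst q) (snd q) $ i + side L (fst q) + ?M"
    by (auto simp: dil_def mem_box_cart algebra_simps not_le)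
  with *[of i] have "?M \<le> \<bar>(x - y) $ i\<bar>" by auto
  also have "\<dots> \<le> norm (x - y)" by (rule component_le_norm_cart)
  finally show ?thesis .
qed

lemma norm_diff_less_half:
  fixes x x' y :: "real^'n"
  assumes "L > 0" "x \<in> dcube L q" "x' \<in> dcube L q" "y \<notin> dil L q"
  shows "norm (x - x') < norm (x - y) / 2"
proof -
  have "2 * real CARD('n) * side L (fst q) < margin TYPE('n) * side L (fst q)"
    using side_pos[OF assms(1)] by (simp add: margin_def)
  with norm_diff_dcube[OF assms(1-3)] norm_diff_outside_dil[OF assms(1,2,4)] show ?thesis
    by linarith
qed

text \<open>Serves the kernel representation, which is available only off the closed support: if a
  function vanishes on \<open>dil L q\<close>, its closed support misses the interior of
  \<open>dil L q\<close>.\<close>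

lemma dcube_interior_dil:
  fixes q :: "nat \<times> (int^'n)"
  assumes "L > 0" "x \<in> dcube L q" shows "x \<in> interior (dil L q)"
proof (rule interiorI[OF open_ball])
  have "margin TYPE('n) * side L (fst q) > 0"
    using assms margin_ge[where 'n='n] by (simp add: side_pos)
  then show "x \<in> ball x (margin TYPE('n) * side L (fst q))" by simp
  show "ball x (margin TYPE('n) * side L (fst q)) \<subseteq> dil L q"
    using norm_diff_outside_dil[OF assms] by (force simp: dist_norm)
qed

lemma mem_dcube_iff:
  assumes "L > 0"
  shows "x \<in> dcube L (k, m) \<longleftrightarrow> m = index L k x"
proof -
  have s: "side L k > 0" by (rule side_pos[OF assms])
  have "(side L k * of_int (m $ i) - L \<le> x $ i \<and> x $ i < side L k * of_int (m $ i) - L + side L k)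
      \<longleftrightarrow> \<lfloor>(x $ i + L) / side L k\<rfloor> = m $ i" for i
    using s by (auto simp: floor_eq_iff pos_le_divide_eq pos_divide_less_eq algebra_simps)
  then show ?thesis
    by (auto simp: dcube_def corner_def index_def vec_eq_iff)
qed

lemma index_mem: "L > 0 \<Longrightarrow> x \<in> dcube L (k, index L k x)"
  by (simp add: mem_dcube_iff)

text \<open>Rounding down at the fine scale and again after division by a power of two is the same
  as rounding down once at the coarse scale. This nesting of floors is the nesting of the
  grid.\<close>

lemma anc_index:
  assumes "L > 0" "j \<le> k"
  shows "anc j (k, index L k x) = (j, index L j x)"
proof -
  have "\<lfloor>(x $ i + L) / side L k\<rfloor> div 2 ^ (k - j) = \<lfloor>(x $ i + L) / side L j\<rfloor>" for i
  proof -
    have "\<lfloor>(x $ i + L) / side L k\<rfloor> div 2 ^ (k - j) = \<lfloor>(x $ i + L) / side L k / real_of_int (2 ^ (k-j))\<rfloor>"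
      by (subst floor_divide_real_eq_div) auto
    also have "(x $ i + L) / side L k / real_of_int (2 ^ (k-j)) = (x $ i + L) / side L j"
      using side_pos[OF assms(1), of j] by (simp add: side_mono[OF assms])
    finally show ?thesis .
  qed
  then show ?thesis
    by (simp add: anc_def index_def vec_eq_iff)
qed

lemma index_coarser:
  assumes "L > 0" "j \<le> k" "index L k x = index L k y"
  shows "index L j x = index L j y"
  using anc_index[OF assms(1,2), of x] anc_index[OF assms(1,2), of y] assms(3) by simp

lemma index_dcube0:
  assumes "L > 0"
  shows "dcube L (0, 0) = {x. \<forall>i. - L \<le> x $ i \<and> x $ i < L}"
  by (auto simp: dcube_def corner_def side_def)

text \<open>A descendant lies in its ancestor and has the smaller margin. The resulting decreasing
  chain of dilates is what the tail estimate cuts into shells.\<close>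

lemma dil_anc_subset:
  fixes x :: "real^'n"
  assumes "L > 0" "j \<le> k"
  shows "dil L (k, index L k x) \<subseteq> dil L (j, index L j x)"
proof
  fix y assume y: "y \<in> dil L (k, index L k x)"
  let ?c = "margin TYPE('n)"
  have c: "?c \<ge> 0" using margin_ge[where 'n='n] by simp
  have "side L k \<le> side L j"
    using side_pos[OF assms(1), of j] by (simp add: side_mono[OF assms] field_simps)
  then have M: "?c * side L k \<le> ?c * side L j" using c by (rule mult_left_mono)
  have sub: "corner L j (index L j x) $ i \<le> corner L k (index L k x) $ i \<and>
     corner L k (index L k x) $ i + side L k \<le> corner L j (index L j x) $ i + side L j" for i
  proof -
    let ?m = "index L k x $ i" and ?d = "2 ^ (k - j) :: int"
    have m': "index L j x $ i = ?m div ?d"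
      using anc_index[OF assms, of x] by (auto simp: anc_def vec_eq_iff)
    have sj: "side L j = side L k * real_of_int ?d"
      by (simp add: side_mono[OF assms])
    \<comment> \<open>\<open>?m\<close> is bracketed by consecutive multiples of \<open>?d\<close>;
      the upper bracket is taken at \<open>?m + 1\<close>, which is the right end of the half-open
      fine cube.\<close>
    have "0 \<le> ?m mod ?d" "?m mod ?d < ?d" by simp_all
    then have "?m div ?d * ?d \<le> ?m" "?m + 1 \<le> (?m div ?d + 1) * ?d"
      using div_mult_mod_eq[of ?m ?d] unfolding distrib_right mult_1 by linarith+
    then have "real_of_int (?m div ?d * ?d) \<le> real_of_int ?m"
      "real_of_int (?m + 1) \<le> real_of_int ((?m div ?d + 1) * ?d)"
      by (simp_all only: of_int_le_iff)
    then have "side L k * real_of_int (?m div ?d * ?d) \<le> side L k * real_of_int ?m"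
      "side L k * real_of_int (?m + 1) \<le> side L k * real_of_int ((?m div ?d + 1) * ?d)"
      using side_pos[OF assms(1), of k] by (auto intro!: mult_left_mono)
    then show ?thesis
      by (simp add: corner_def m' sj algebra_simps)
  qed
  show "y \<in> dil L (j, index L j x)"
    unfolding dil_def mem_box_cart
  proof (intro allI conjI)
    fix i
    have "corner L k (index L k x) $ i - ?c * side L k \<le> y $ i"
      "y $ i \<le> corner L k (index L k x) $ i + (1 + ?c) * side L k"
      using y by (simp_all add: dil_def mem_box_cart)
    moreover have "b - t * c \<le> z \<and> z \<le> b + (1 + t) * c"
      if "a - t * d \<le> z" "z \<le> a + (1 + t) * d" "b \<le> a" "a + d \<le> b + c" "t * d \<le> t * c"
      for a b c d t z :: real
      using that by (simp add: distrib_right)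
    ultimately have "corner L j (index L j x) $ i - ?c * side L j \<le> y $ i"
      "y $ i \<le> corner L j (index L j x) $ i + (1 + ?c) * side L j"
      using sub[of i] M by blast+
    then show "(\<chi> i. corner L (fst (j, index L j x)) (snd (j, index L j x)) $ i - ?c * side L (fst (j, index L j x))) $ i \<le> y $ i"
      "y $ i \<le> (\<chi> i. corner L (fst (j, index L j x)) (snd (j, index L j x)) $ i + (1 + ?c) * side L (fst (j, index L j x))) $ i"
      by simp_all
  qed
qed

lemma dcube_mono:
  assumes "L > 0" "j \<le> k"
  shows "dcube L (k, index L k x) \<subseteq> dcube L (j, index L j x)"
  unfolding subset_iff mem_dcube_iff[OF assms(1)] by (metis index_coarser[OF assms])

lemma vol_anc:
  fixes m :: "int^'n" and m' :: "int^'n"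
  assumes "L > 0" "j \<le> k"
  shows "vol L (j, m) = 2 ^ ((k - j) * CARD('n)) * vol L (k, m')"
  by (simp add: vol_def side_mono[OF assms] power_divide power_mult)

section \<open>A Vitali-type covering estimate and Carleson embedding\<close>

text \<open>Volume of the fivefold enlargement of a ball containing \<open>dil L q\<close>, per unit
  of \<open>vol L q\<close>; the radius is \<open>n * (1 + margin)\<close> sides, from the l^1 bound
  on the Euclidean norm.\<close>

definition Vitali_const :: "'n itself \<Rightarrow> real" where
  "Vitali_const _ = unit_ball_vol (real CARD('n)) * (5 * (real CARD('n) * (1 + margin TYPE('n)))) ^ CARD('n)"

lemma Vitali_const_pos: "Vitali_const TYPE('n::finite) > 0"
  using margin_ge[where 'n='n] by (simp add: Vitali_const_def)

lemma dil_subset_cball: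
  fixes q :: "nat \<times> (int^'n)"
  assumes "L > 0"
  shows "dil L q \<subseteq> cball (corner L (fst q) (snd q)) (real CARD('n) * (1 + margin TYPE('n)) * side L (fst q))"
proof
  fix y assume y: "y \<in> dil L q"
  let ?a = "corner L (fst q) (snd q)" and ?s = "side L (fst q)" and ?c = "margin TYPE('n)"
  have s: "?s > 0" by (rule side_pos[OF assms])
  have "norm (y - ?a) \<le> (\<Sum>i\<in>UNIV. \<bar>(y - ?a) $ i\<bar>)"
    by (rule norm_le_l1_cart)
  also have "\<dots> \<le> (\<Sum>i\<in>(UNIV::'n set). (1 + ?c) * ?s)"
  proof (rule sum_mono)
    fix i
    have "?a $ i - ?c * ?s \<le> y $ i" "y $ i \<le> ?a $ i + (1 + ?c) * ?s"
      using y by (auto simp: dil_def mem_box_cart)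
    then show "\<bar>(y - ?a) $ i\<bar> \<le> (1 + ?c) * ?s" using s by (auto simp: algebra_simps)
  qed
  finally show "y \<in> cball ?a (real CARD('n) * (1 + ?c) * ?s)"
    by (simp add: dist_norm norm_minus_commute mult.assoc)
qed

lemma emeasure_UN_le_count_space:
  assumes "countable I" "\<And>i. i \<in> I \<Longrightarrow> X i \<in> sets M"
  shows "emeasure M (\<Union>i\<in>I. X i) \<le> (\<integral>\<^sup>+i. emeasure M (X i) \<partial>count_space I)"
proof -
  have "emeasure M (\<Union>i\<in>I. X i) = (\<integral>\<^sup>+x. indicator (\<Union>i\<in>I. X i) x \<partial>M)"
    using assms by (intro nn_integral_indicator[symmetric] sets.countable_UN') auto
  also have "\<dots> \<le> (\<integral>\<^sup>+x. \<integral>\<^sup>+i. indicator (X i) x \<partial>count_space I \<partial>M)"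
  proof (rule nn_integral_mono)
    fix x
    show "indicator (\<Union>i\<in>I. X i) x \<le> (\<integral>\<^sup>+i. indicator (X i) x \<partial>count_space I)"
    proof (cases "x \<in> (\<Union>i\<in>I. X i)")
      case True
      then obtain i where i: "i \<in> I" "x \<in> X i" by auto
      then have "(1::ennreal) = indicator (X i) x" by simp
      also have "\<dots> \<le> (\<integral>\<^sup>+i. indicator (X i) x \<partial>count_space I)"
        using i(1) by (rule nn_integral_ge_point)
      finally show ?thesis using True by simp
    qed simp
  qed
  also have "\<dots> = (\<integral>\<^sup>+i. \<integral>\<^sup>+x. indicator (X i) x \<partial>M \<partial>count_space I)"
    using assms by (intro nn_integral_count_space_nn_integral) auto
  also have "\<dots> = (\<integral>\<^sup>+i. emeasure M (X i) \<partial>count_space I)"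
    using assms by (intro nn_integral_cong) (auto intro!: nn_integral_indicator)
  finally show ?thesis .
qed

text \<open>The weak-type argument for maximal functions. Vitali selects disjoint balls around
  dilates whose fivefold enlargements cover everything, and the lower bound on each selected dilate
  is paid out of disjoint pieces of the integral of \<open>g\<close>. It bounds the level sets of
  the Carleson embedding as well as both stopping conditions.\<close>

lemma Vitali_dil:
  fixes G :: "(nat \<times> (int^'n)) set" and g :: "real^'n \<Rightarrow> ennreal"
  assumes L: "L > 0" and g [measurable]: "g \<in> borel_measurable lebesgue"
    and G: "\<And>q. q \<in> G \<Longrightarrow> ennreal (vol L q) \<le> (\<integral>\<^sup>+x\<in>dil L q. g x \<partial>lebesgue)"
  shows "emeasure lebesgue (\<Union>q\<in>G. dcube L q) \<le> ennreal (Vitali_const TYPE('n)) * (\<integral>\<^sup>+x. g x \<partial>lebesgue)"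
proof -
  define R where "R = real CARD('n) * (1 + margin TYPE('n))"
  have R: "R > 0" using margin_ge[where 'n='n] by (simp add: R_def)
  define a where "a q = corner L (fst q) (snd q)" for q :: "nat \<times> (int^'n)"
  define \<rho> where "\<rho> q = R * side L (fst q)" for q :: "nat \<times> (int^'n)"
  have sub: "dil L q \<subseteq> cball (a q) (\<rho> q)" for q
    using dil_subset_cball[OF L, of q] by (simp add: a_def \<rho>_def R_def)
  have "(\<Union>q\<in>G. dcube L q) \<subseteq> (\<Union>q\<in>G. cball (a q) (\<rho> q))"
    using sub dcube_subset_dil[OF L] by blast
  \<comment> \<open>Sides never exceed \<open>2 * L\<close>; the covering lemma asks for bounded
    radii.\<close>
  moreover have "\<And>q. q \<in> G \<Longrightarrow> 0 < \<rho> q \<and> \<rho> q \<le> R * (2 * L)"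
    using R side_pos[OF L] side_le[OF L] by (auto simp: \<rho>_def intro!: mult_left_mono)
  ultimately obtain C where C: "countable C" "C \<subseteq> G"
     "pairwise (\<lambda>i j. disjnt (cball (a i) (\<rho> i)) (cball (a j) (\<rho> j))) C"
     "(\<Union>q\<in>G. dcube L q) \<subseteq> (\<Union>i\<in>C. cball (a i) (5 * \<rho> i))"
    by (rule Vitali_covering_lemma_cballs)
  have "emeasure lebesgue (\<Union>q\<in>G. dcube L q) \<le> emeasure lebesgue (\<Union>i\<in>C. cball (a i) (5 * \<rho> i))"
    using C by (intro emeasure_mono sets.countable_UN') auto
  also have "\<dots> \<le> (\<integral>\<^sup>+i. emeasure lebesgue (cball (a i) (5 * \<rho> i)) \<partial>count_space C)"
    using C by (intro emeasure_UN_le_count_space) auto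
  also have "\<dots> \<le> (\<integral>\<^sup>+i. ennreal (Vitali_const TYPE('n)) * (\<integral>\<^sup>+x. g x * indicator (dil L i) x \<partial>lebesgue) \<partial>count_space C)"
  proof (rule nn_integral_mono)
    fix i assume "i \<in> space (count_space C)"
    then have i: "i \<in> G" using C by auto
    have "\<rho> i > 0" using R side_pos[OF L] by (simp add: \<rho>_def)
    then have "emeasure lebesgue (cball (a i) (5 * \<rho> i)) = ennreal (unit_ball_vol (real CARD('n)) * (5 * \<rho> i) ^ CARD('n))"
      by (subst emeasure_completion) (simp_all add: emeasure_cball)
    also have "unit_ball_vol (real CARD('n)) * (5 * \<rho> i) ^ CARD('n) = Vitali_const TYPE('n) * vol L i"
      unfolding Vitali_const_def \<rho>_def R_def vol_def by (simp only: power_mult_distrib mult.assoc)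
    also have "ennreal (Vitali_const TYPE('n) * vol L i) = ennreal (Vitali_const TYPE('n)) * ennreal (vol L i)"
      using Vitali_const_pos[where 'n='n] vol_pos[OF L, of i] by (intro ennreal_mult) auto
    also have "\<dots> \<le> ennreal (Vitali_const TYPE('n)) * (\<integral>\<^sup>+x. g x * indicator (dil L i) x \<partial>lebesgue)"
      by (intro mult_left_mono G i) simp
    finally show "emeasure lebesgue (cball (a i) (5 * \<rho> i)) \<le> \<dots>" .
  qed
  also have "\<dots> = ennreal (Vitali_const TYPE('n)) * (\<integral>\<^sup>+i. (\<integral>\<^sup>+x. g x * indicator (dil L i) x \<partial>lebesgue) \<partial>count_space C)"
    by (rule nn_integral_cmult) simp
  also have "\<dots> \<le> ennreal (Vitali_const TYPE('n)) * (\<integral>\<^sup>+x. g x \<partial>lebesgue)"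
  proof (rule mult_left_mono)
    have "(\<integral>\<^sup>+i. (\<integral>\<^sup>+x. g x * indicator (dil L i) x \<partial>lebesgue) \<partial>count_space C)
       = (\<integral>\<^sup>+x. (\<integral>\<^sup>+i. g x * indicator (dil L i) x \<partial>count_space C) \<partial>lebesgue)"
      using C by (intro nn_integral_count_space_nn_integral[symmetric]) auto
    also have "\<dots> \<le> (\<integral>\<^sup>+x. g x \<partial>lebesgue)"
    proof (rule nn_integral_mono)
      fix x
      show "(\<integral>\<^sup>+i. g x * indicator (dil L i) x \<partial>count_space C) \<le> g x"
      proof (cases "\<exists>j\<in>C. x \<in> dil L j")
        case False
        then have "(\<integral>\<^sup>+i. g x * indicator (dil L i) x \<partial>count_space C) = (\<integral>\<^sup>+i. 0 \<partial>count_space C)"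
          by (intro nn_integral_cong) (auto simp: indicator_def)
        then show ?thesis by simp
      next
        case True
        then obtain j where j: "j \<in> C" "x \<in> dil L j" by auto
        \<comment> \<open>The selected dilates lie in disjoint balls, so at most one term of the sum
          over \<open>C\<close> is nonzero at \<open>x\<close>.\<close>
        have "(\<integral>\<^sup>+i. g x * indicator (dil L i) x \<partial>count_space C) = (\<integral>\<^sup>+i. g x * indicator {j} i \<partial>count_space C)"
        proof (rule nn_integral_cong)
          fix i assume "i \<in> space (count_space C)"
          then have i: "i \<in> C" by simp
          have "x \<notin> dil L i" if "i \<noteq> j"
            using C(3) i j that sub unfolding pairwise_def disjnt_def by blast
          then show "g x * indicator (dil L i) x = g x * indicator {j} i"
            using j by (auto simp: indicator_def)
        qed
        also have "\<dots> = g x"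
          using j by (subst nn_integral_cmult_indicator) auto
        finally show ?thesis by simp
      qed
    qed
    finally show "(\<integral>\<^sup>+i. (\<integral>\<^sup>+x. g x * indicator (dil L i) x \<partial>lebesgue) \<partial>count_space C) \<le> (\<integral>\<^sup>+x. g x \<partial>lebesgue)" .
  qed simp
  finally show ?thesis .
qed

section \<open>Layer-cake formulas and an abstract Carleson embedding\<close>

lemma sigma_finite_lebesgue: "sigma_finite_measure (lebesgue :: 'a::euclidean_space measure)"
proof
  obtain F :: "nat \<Rightarrow> 'a set" where F: "range F \<subseteq> sets lborel" "\<Union> (range F) = space lborel"
    "\<And>i. emeasure lborel (F i) \<noteq> \<infinity>"
    by (rule lborel.sigma_finite) blast
  have [measurable]: "F i \<in> sets lborel" for i using F by auto
  have "emeasure lebesgue (F i) \<noteq> \<infinity>" for i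
    using F(1) F(3)[of i] by (subst emeasure_completion) auto
  then show "\<exists>A::'a set set. countable A \<and> A \<subseteq> sets lebesgue \<and> \<Union> A = space lebesgue \<and> (\<forall>a\<in>A. emeasure lebesgue a \<noteq> \<infinity>)"
    using F by (intro exI[of _ "range F"]) auto
qed

lemma lebesgue_lborel_swap:
  fixes h :: "'a::euclidean_space \<Rightarrow> real \<Rightarrow> ennreal"
  assumes "(\<lambda>(x, t). h x t) \<in> borel_measurable (lebesgue \<Otimes>\<^sub>M lborel)"
  shows "(\<integral>\<^sup>+t. \<integral>\<^sup>+x. h x t \<partial>lebesgue \<partial>lborel) = (\<integral>\<^sup>+x. \<integral>\<^sup>+t. h x t \<partial>lborel \<partial>lebesgue)"
proof -
  interpret pair_sigma_finite "lebesgue :: 'a measure" "lborel :: real measure"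
    unfolding pair_sigma_finite_def using sigma_finite_lebesgue sigma_finite_lborel by blast
  show ?thesis
    using assms by (rule Fubini')
qed

lemma nn_integral_powr_0:
  fixes a b :: real
  assumes "a > -1" "b \<ge> 0"
  shows "(\<integral>\<^sup>+t\<in>{0<..<b}. ennreal (t powr a) \<partial>lborel) = ennreal (b powr (a + 1) / (a + 1))"
proof -
  have "((\<lambda>t. t powr a) has_integral b powr (a + 1) / (a + 1)) {0..b}"
    using assms by (intro has_integral_powr_from_0) auto
  then have "((\<lambda>t. t powr a) has_integral b powr (a + 1) / (a + 1)) {0<..<b}"
    by (simp add: has_integral_Icc_iff_Ioo)
  then show ?thesis
    by (intro nn_integral_has_integral_lebesgue') auto
qed

text \<open>Layer cake for \<open>\<beta> powr a\<close> with the level slowed down by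
  \<open>K\<close>: only levels \<open>t\<close> a factor \<open>K\<close> below
  \<open>\<beta>\<close> occur, which leaves room to absorb constants at each level.\<close>

lemma nn_integral_powr_times_indicator:
  fixes a \<beta> K :: real
  assumes "a > 0" "\<beta> \<ge> 0" "K > 0"
  shows "ennreal (\<beta> powr a) = ennreal (K powr a * a) * (\<integral>\<^sup>+t. ennreal (t powr (a - 1)) * indicator {t. 0 < t \<and> K * t < \<beta>} t \<partial>lborel)"
proof -
  have "{t. 0 < t \<and> K * t < \<beta>} = {0<..<\<beta> / K}"
    using assms by (auto simp: field_simps)
  then have "(\<integral>\<^sup>+t. ennreal (t powr (a - 1)) * indicator {t. 0 < t \<and> K * t < \<beta>} t \<partial>lborel) = ennreal ((\<beta> / K) powr a / a)"
    using nn_integral_powr_0[of "a - 1" "\<beta> / K"] assms by simp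
  also have "ennreal (K powr a * a) * \<dots> = ennreal (K powr a * a * ((\<beta> / K) powr a / a))"
    using assms by (intro ennreal_mult[symmetric]) auto
  also have "K powr a * a * ((\<beta> / K) powr a / a) = \<beta> powr a"
    using assms by (simp add: powr_divide)
  finally show ?thesis by simp
qed

text \<open>At level \<open>t\<close> the cubes with \<open>\<beta> q > K * t\<close> have a union
  controlled by \<open>Vitali_dil\<close> with density \<open>\<Theta> (u x) t\<close>. Integrating
  over \<open>t\<close> and exchanging the integrals leaves, at each \<open>x\<close>, the
  one-dimensional integral bounded by \<open>J\<close>. Here \<open>\<Theta> z t\<close> stands for
  the contribution of a value \<open>z\<close> above level \<open>t\<close>; keeping it abstract
  lets one proof serve power averages and Orlicz averages alike.\<close>

lemma Carleson_embedding:
  fixes G :: "(nat \<times> (int^'n)) set" and E :: "nat \<times> (int^'n) \<Rightarrow> (real^'n) set"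
    and \<Theta> :: "real \<Rightarrow> real \<Rightarrow> ennreal" and u :: "real^'n \<Rightarrow> real"
  assumes L: "L > 0" and G: "finite G"
    and E [measurable]: "\<And>q. q \<in> G \<Longrightarrow> E q \<in> sets lebesgue"
    and Esub: "\<And>q. q \<in> G \<Longrightarrow> E q \<subseteq> dcube L q" and Edisj: "disjoint_family_on E G"
    and \<beta>: "\<And>q. q \<in> G \<Longrightarrow> \<beta> q \<ge> 0" and s: "s > 0" and K: "K > 0"
    and u [measurable]: "u \<in> borel_measurable lebesgue" and u0: "\<And>x. u x \<ge> 0"
    and \<Theta>: "case_prod \<Theta> \<in> borel_measurable (borel \<Otimes>\<^sub>M borel)"
    and key: "\<And>q t. q \<in> G \<Longrightarrow> t > 0 \<Longrightarrow> K * t < \<beta> q \<Longrightarrow>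
      ennreal (vol L q) \<le> (\<integral>\<^sup>+x\<in>dil L q. \<Theta> (u x) t \<partial>lebesgue)"
    and J: "\<And>z. z \<ge> 0 \<Longrightarrow> (\<integral>\<^sup>+t\<in>{0<..}. ennreal (t powr (s - 1)) * \<Theta> z t \<partial>lborel) \<le> ennreal J * ennreal (z powr s)"
  shows "(\<Sum>q\<in>G. ennreal (\<beta> q powr s) * emeasure lebesgue (E q))
    \<le> ennreal (K powr s * s) * (ennreal (Vitali_const TYPE('n)) * (ennreal J * (\<integral>\<^sup>+x. ennreal (u x powr s) \<partial>lebesgue)))"
proof -
  let ?c = "ennreal (K powr s * s)" and ?V = "ennreal (Vitali_const TYPE('n))"
  have [measurable]: "(\<lambda>x. \<Theta> (u x) t) \<in> borel_measurable lebesgue" for t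
  proof -
    have "(\<lambda>x. (u x, t)) \<in> lebesgue \<rightarrow>\<^sub>M borel \<Otimes>\<^sub>M borel" by measurable
    from measurable_compose[OF this \<Theta>] show ?thesis by simp
  qed
  have joint [measurable]: "(\<lambda>(x, t). \<Theta> (u x) t) \<in> borel_measurable (lebesgue \<Otimes>\<^sub>M lborel)"
  proof -
    have "(\<lambda>(x, t). (u x, t)) \<in> lebesgue \<Otimes>\<^sub>M lborel \<rightarrow>\<^sub>M borel \<Otimes>\<^sub>M borel" by measurable
    from measurable_compose[OF this \<Theta>] show ?thesis by (simp add: case_prod_unfold)
  qed
  have [measurable]: "(\<lambda>t. \<integral>\<^sup>+x. \<Theta> (u x) t \<partial>lebesgue) \<in> borel_measurable lborel"
  proof -
    interpret sigma_finite_measure "lebesgue :: (real^'n) measure" by (rule sigma_finite_lebesgue)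
    have "(\<lambda>(t, x). \<Theta> (u x) t) \<in> borel_measurable (lborel \<Otimes>\<^sub>M lebesgue)"
      using measurable_compose[OF measurable_pair_swap' joint] by (simp add: case_prod_unfold)
    then show ?thesis by (rule borel_measurable_nn_integral)
  qed
  define h where "h q t = ennreal (t powr (s - 1)) * indicator {t. 0 < t \<and> K * t < \<beta> q} t * emeasure lebesgue (E q)" for q t
  have h_meas [measurable]: "h q \<in> borel_measurable lborel" for q unfolding h_def by measurable
  have "(\<Sum>q\<in>G. ennreal (\<beta> q powr s) * emeasure lebesgue (E q)) = (\<Sum>q\<in>G. ?c * (\<integral>\<^sup>+t. h q t \<partial>lborel))"
  proof (rule sum.cong[OF refl])
    fix q assume q: "q \<in> G"
    have "ennreal (\<beta> q powr s) = ?c * (\<integral>\<^sup>+t. ennreal (t powr (s - 1)) * indicator {t. 0 < t \<and> K * t < \<beta> q} t \<partial>lborel)"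
      by (rule nn_integral_powr_times_indicator) (use s K \<beta> q in auto)
    then show "ennreal (\<beta> q powr s) * emeasure lebesgue (E q) = ?c * (\<integral>\<^sup>+t. h q t \<partial>lborel)"
      unfolding h_def by (subst nn_integral_multc) (auto simp: mult.assoc)
  qed
  also have "\<dots> = ?c * (\<integral>\<^sup>+t. (\<Sum>q\<in>G. h q t) \<partial>lborel)"
    by (subst nn_integral_sum) (auto simp: sum_distrib_left)
  also have "(\<integral>\<^sup>+t. (\<Sum>q\<in>G. h q t) \<partial>lborel)
      \<le> (\<integral>\<^sup>+t\<in>{0<..}. ennreal (t powr (s - 1)) * (?V * (\<integral>\<^sup>+x. \<Theta> (u x) t \<partial>lebesgue)) \<partial>lborel)"
  proof (rule nn_integral_mono)
    fix t :: real
    show "(\<Sum>q\<in>G. h q t) \<le> ennreal (t powr (s - 1)) * (?V * (\<integral>\<^sup>+x. \<Theta> (u x) t \<partial>lebesgue)) * indicator {0<..} t"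
    proof (cases "t > 0")
      case True
      define H where "H = {q\<in>G. K * t < \<beta> q}"
      have H: "finite H" "H \<subseteq> G" using G by (auto simp: H_def)
      have "(\<Sum>q\<in>G. h q t) = (\<Sum>q\<in>H. h q t)"
        using G by (intro sum.mono_neutral_right) (auto simp: H_def h_def)
      also have "\<dots> = ennreal (t powr (s - 1)) * (\<Sum>q\<in>H. emeasure lebesgue (E q))"
        unfolding sum_distrib_left using True by (intro sum.cong) (auto simp: H_def h_def)
      \<comment> \<open>Disjointness of the sets \<open>E q\<close> replaces a sum over overlapping
        cubes by the measure of their union, the quantity that the covering estimate bounds.\<close>
      also have "(\<Sum>q\<in>H. emeasure lebesgue (E q)) = emeasure lebesgue (\<Union>q\<in>H. E q)"
        using H E by (intro sum_emeasure disjoint_family_on_mono[OF _ Edisj]) auto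
      also have "\<dots> \<le> emeasure lebesgue (\<Union>q\<in>H. dcube L q)"
      proof (rule emeasure_mono)
        show "(\<Union>q\<in>H. E q) \<subseteq> (\<Union>q\<in>H. dcube L q)" using H Esub by blast
      qed (use H in auto)
      also have "\<dots> \<le> ?V * (\<integral>\<^sup>+x. \<Theta> (u x) t \<partial>lebesgue)"
        using key True by (intro Vitali_dil L) (auto simp: H_def)
      finally show ?thesis using True by (simp add: mult_left_mono)
    qed (simp add: h_def)
  qed
  also have "\<dots> = (\<integral>\<^sup>+t. ?V * (\<integral>\<^sup>+x. (ennreal (t powr (s - 1)) * \<Theta> (u x) t) * indicator {0<..} t \<partial>lebesgue) \<partial>lborel)"
    by (intro nn_integral_cong) (auto simp: nn_integral_cmult mult.left_commute split: split_indicator)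
  also have "\<dots> = ?V * (\<integral>\<^sup>+t. (\<integral>\<^sup>+x. (ennreal (t powr (s - 1)) * \<Theta> (u x) t) * indicator {0<..} t \<partial>lebesgue) \<partial>lborel)"
  proof (rule nn_integral_cmult)
    have "(\<lambda>t. (ennreal (t powr (s - 1)) * (\<integral>\<^sup>+x. \<Theta> (u x) t \<partial>lebesgue)) * indicator {0<..} t) \<in> borel_measurable lborel"
      by measurable
    then show "(\<lambda>t. (\<integral>\<^sup>+x. (ennreal (t powr (s - 1)) * \<Theta> (u x) t) * indicator {0<..} t \<partial>lebesgue)) \<in> borel_measurable lborel"
      by (simp add: nn_integral_cmult nn_integral_multc)
  qed
  also have "(\<integral>\<^sup>+t. (\<integral>\<^sup>+x. (ennreal (t powr (s - 1)) * \<Theta> (u x) t) * indicator {0<..} t \<partial>lebesgue) \<partial>lborel)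
      = (\<integral>\<^sup>+x. (\<integral>\<^sup>+t\<in>{0<..}. ennreal (t powr (s - 1)) * \<Theta> (u x) t \<partial>lborel) \<partial>lebesgue)"
    by (rule lebesgue_lborel_swap) measurable
  also have "\<dots> \<le> (\<integral>\<^sup>+x. ennreal J * ennreal (u x powr s) \<partial>lebesgue)"
    by (intro nn_integral_mono J u0)
  also have "\<dots> = ennreal J * (\<integral>\<^sup>+x. ennreal (u x powr s) \<partial>lebesgue)"
    by (rule nn_integral_cmult) measurable
  finally show ?thesis by (simp add: mult_left_mono)
qed

text \<open>The density for L^r averages: only values above the level count, since those below it
  are absorbed by the volume of the cube. Cutting at \<open>z > t\<close> makes the integral against
  \<open>t powr (s - 1)\<close> run over \<open>t < z\<close>, where it converges exactly for
  \<open>r < s\<close>.\<close>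

definition Theta1 :: "real \<Rightarrow> real \<Rightarrow> real \<Rightarrow> ennreal" where
  "Theta1 r z t = ennreal ((z / t) powr r) * indicator {t<..} z"

lemma Theta1_measurable: "case_prod (Theta1 r) \<in> borel_measurable (borel \<Otimes>\<^sub>M borel)"
proof -
  have eq: "case_prod (Theta1 r) = (\<lambda>x. ennreal ((fst x / snd x) powr r) * indicator {x. snd x < fst x} x)"
    by (auto simp: Theta1_def fun_eq_iff indicator_def)
  show ?thesis unfolding eq by measurable
qed

lemma Theta1_integral:
  assumes "0 < r" "r < s" "z \<ge> 0"
  shows "(\<integral>\<^sup>+t\<in>{0<..}. ennreal (t powr (s - 1)) * Theta1 r z t \<partial>lborel) \<le> ennreal (1 / (s - r)) * ennreal (z powr s)"
proof -
  have "(\<integral>\<^sup>+t\<in>{0<..}. ennreal (t powr (s - 1)) * Theta1 r z t \<partial>lborel)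
     = (\<integral>\<^sup>+t. ennreal (z powr r) * (ennreal (t powr (s - 1 - r)) * indicator {0<..<z} t) \<partial>lborel)"
  proof (rule nn_integral_cong)
    fix t :: real
    show "ennreal (t powr (s - 1)) * Theta1 r z t * indicator {0<..} t
      = ennreal (z powr r) * (ennreal (t powr (s - 1 - r)) * indicator {0<..<z} t)"
    proof (cases "0 < t \<and> t < z")
      case True
      then have "t powr (s - 1) * (z / t) powr r = z powr r * t powr (s - 1 - r)"
        by (simp add: powr_divide powr_diff)
      with True show ?thesis
        by (simp add: Theta1_def ennreal_mult[symmetric])
    qed (auto simp: Theta1_def indicator_def)
  qed
  also have "\<dots> = ennreal (z powr r) * ennreal (z powr (s - r) / (s - r))"
    using assms nn_integral_powr_0[of "s - 1 - r" z] by (subst nn_integral_cmult) auto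
  also have "\<dots> = ennreal (z powr r * (z powr (s - r) / (s - r)))"
    using assms by (intro ennreal_mult[symmetric]) auto
  also have "z powr r * (z powr (s - r) / (s - r)) = 1 / (s - r) * z powr s"
    using assms by (simp add: powr_add[symmetric])
  also have "ennreal (1 / (s - r) * z powr s) = ennreal (1 / (s - r)) * ennreal (z powr s)"
    using assms by (intro ennreal_mult) auto
  finally show ?thesis by simp
qed

section \<open>The Orlicz bump estimate\<close>

lemma young_nonneg: "young_function A \<Longrightarrow> t \<ge> 0 \<Longrightarrow> A t \<ge> 0"
  unfolding young_function_def mono_on_def by force

lemma young_scale:
  assumes "young_function A" "0 \<le> t" "0 \<le> c" "c \<le> 1"
  shows "A (c * t) \<le> c * A t"
proof -
  have "convex_on {0..} A" "A 0 = 0" using assms by (auto simp: young_function_def)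
  from convex_onD[OF this(1), of c 0 t] this(2) assms show ?thesis by simp
qed

text \<open>A zero at \<open>t\<close> would propagate by doubling to every
  \<open>2 ^ k * t\<close>, against \<open>A\<close> tending to infinity. Positivity permits
  division by \<open>A\<close> and later turns a vanishing Luxemburg norm into a vanishing
  weight.\<close>

lemma young_pos:
  assumes A: "young_function A" "doubling A" and t: "t > 0"
  shows "A t > 0"
proof (rule ccontr)
  assume "\<not> A t > 0"
  then have 0: "A t = 0" using young_nonneg[OF A(1), of t] t by simp
  obtain C where C: "C > 0" "\<And>t. t > 0 \<Longrightarrow> A (2 * t) \<le> C * A t"
    using A(2) by (auto simp: doubling_def)
  have z: "A (2 ^ k * t) = 0" for k :: nat
  proof (induction k)
    case (Suc k)
    have "A (2 * (2 ^ k * t)) \<le> C * A (2 ^ k * t)" using t by (intro C) simp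
    then show ?case using Suc young_nonneg[OF A(1), of "2 ^ Suc k * t"] t by (simp add: mult_ac)
  qed (simp add: 0)
  have "eventually (\<lambda>x. A x > 0) at_top"
    using A(1) by (auto simp: young_function_def filterlim_at_top_dense)
  then obtain N where N: "\<And>x. x \<ge> N \<Longrightarrow> A x > 0" by (auto simp: eventually_at_top_linorder)
  obtain k :: nat where "N / t < 2 ^ k" using real_arch_pow[of 2 "N / t"] by auto
  then have "N \<le> 2 ^ k * t" using t by (simp add: field_simps)
  then show False using N[of "2 ^ k * t"] z[of k] by simp
qed

text \<open>\<open>A\<close> is controlled only on the half-line, whence the clipping
  \<open>max 0 t\<close>, which reappears in \<open>Theta2\<close>.\<close>

lemma young_measurable:
  assumes "young_function A"
  shows "(\<lambda>t. A (max 0 t)) \<in> borel_measurable borel"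
proof -
  have "continuous_on UNIV (\<lambda>t. A (max 0 t))"
    using assms unfolding young_function_def
    by (intro continuous_on_compose2[of "{0..}" A UNIV "\<lambda>t. max 0 t"] continuous_intros) auto
  then show ?thesis by (rule borel_measurable_continuous_onI)
qed

lemma young_measurable':
  assumes "young_function A" "f \<in> borel_measurable M" "\<And>x. f x \<ge> 0"
  shows "(\<lambda>x. A (f x)) \<in> borel_measurable M"
proof -
  have "(\<lambda>x. A (max 0 (f x))) \<in> borel_measurable M"
    using measurable_compose[OF assms(2) young_measurable[OF assms(1)]] .
  then show ?thesis using assms(3) by (simp add: max_def)
qed

text \<open>
  Up to a constant this is \<open>B (z / t)\<close>, where \<open>B\<close> is the Young conjugate of \<open>v \<mapsto> A (v powr p)\<close>. It is
  written as a layer-cake integral in \<open>\<tau> = v powr p\<close>, so that Tonelli turns its integral against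
  \<open>t powr (p' - 1)\<close> into the integral of the hypothesis without a change of variables.
\<close>

definition Theta2 :: "(real \<Rightarrow> real) \<Rightarrow> real \<Rightarrow> real \<Rightarrow> real \<Rightarrow> real \<Rightarrow> ennreal" where
  "Theta2 A p c z t = ennreal (z / t) * (ennreal (c powr (1 / p)) * indicator {t<..} z
     + (\<integral>\<^sup>+\<tau>\<in>{c..}. ennreal (\<tau> powr (1 / p - 1) / p)
          * indicator {\<tau>. t * A (max 0 \<tau>) < z * \<tau> powr (1 / p)} \<tau> \<partial>lborel))"

lemma Theta2_measurable:
  assumes "young_function A"
  shows "case_prod (Theta2 A p c) \<in> borel_measurable (borel \<Otimes>\<^sub>M borel)"
proof -
  note [measurable] = young_measurable[OF assms]
  have [measurable]: "(\<lambda>(x, \<tau>). ennreal (\<tau> powr (1 / p - 1) / p)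
          * indicator {\<tau>. snd x * A (max 0 \<tau>) < fst x * \<tau> powr (1 / p)} \<tau> * indicator {c..} \<tau>)
     \<in> borel_measurable ((borel \<Otimes>\<^sub>M borel) \<Otimes>\<^sub>M (lborel :: real measure))"
  proof -
    have "(\<lambda>(x, \<tau>). ennreal (\<tau> powr (1 / p - 1) / p)
          * indicator {\<tau>. snd x * A (max 0 \<tau>) < fst x * \<tau> powr (1 / p)} \<tau> * indicator {c..} \<tau>)
      = (\<lambda>y::(real \<times> real) \<times> real. ennreal (snd y powr (1 / p - 1) / p)
          * indicator {y. snd (fst y) * A (max 0 (snd y)) < fst (fst y) * (snd y) powr (1 / p)} y * indicator {c..} (snd y))"
      by (auto simp: fun_eq_iff indicator_def)
    moreover have "\<dots> \<in> borel_measurable ((borel \<Otimes>\<^sub>M borel) \<Otimes>\<^sub>M (lborel :: real measure))"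
      by measurable
    ultimately show ?thesis by simp
  qed
  have [measurable]: "(\<lambda>x. \<integral>\<^sup>+\<tau>\<in>{c..}. ennreal (\<tau> powr (1 / p - 1) / p)
          * indicator {\<tau>. snd x * A (max 0 \<tau>) < fst x * \<tau> powr (1 / p)} \<tau> \<partial>lborel)
     \<in> borel_measurable (borel \<Otimes>\<^sub>M borel)"
    by (rule lborel.borel_measurable_nn_integral) measurable
  have eq: "case_prod (Theta2 A p c) = (\<lambda>x. ennreal (fst x / snd x) * (ennreal (c powr (1 / p)) * indicator {x. snd x < fst x} x
     + (\<integral>\<^sup>+\<tau>\<in>{c..}. ennreal (\<tau> powr (1 / p - 1) / p)
          * indicator {\<tau>. snd x * A (max 0 \<tau>) < fst x * \<tau> powr (1 / p)} \<tau> \<partial>lborel)))"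
    by (auto simp: Theta2_def fun_eq_iff indicator_def)
  show ?thesis unfolding eq by measurable
qed

text \<open>After Tonelli the level \<open>t\<close> is integrated first. For fixed
  \<open>\<tau>\<close> it runs over an interval starting at 0, and the resulting power of the
  endpoint is, up to a constant, \<open>z powr p'\<close> times the integrand of the hypothesis on
  \<open>A\<close>.\<close>

lemma Theta2_integral:
  assumes A: "young_function A" "doubling A" and p: "1 < p" "1 / p + 1 / p' = 1" and c: "c > 0"
    and I: "(\<integral>\<^sup>+t\<in>{c..}. ennreal ((t / A t) powr (p' - 1) / t) \<partial>lborel) = ennreal I" "I \<ge> 0"
    and z: "z \<ge> 0"
  shows "(\<integral>\<^sup>+t\<in>{0<..}. ennreal (t powr (p' - 1)) * Theta2 A p c z t \<partial>lborel)
    \<le> ennreal ((c powr (1 / p) + I / p) / (p' - 1)) * ennreal (z powr p')"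
proof (cases "z = 0")
  case True
  then show ?thesis by (simp add: Theta2_def)
next
  case False
  with z have z: "z > 0" by simp
  have p': "p' > 1"
  proof -
    have "1 / p < 1" using p by simp
    then have "1 / p' > 0" using p by linarith
    then have "p' > 0" by simp
    moreover have "1 / p > 0" using p by simp
    then have "1 / p' < 1" using p by linarith
    ultimately show ?thesis by (simp add: field_simps)
  qed
  note [measurable] = young_measurable[OF A(1)]
  define v0 where "v0 = c powr (1 / p)"
  have v0: "v0 \<ge> 0" by (simp add: v0_def)
  define k where "k \<tau> = ennreal (\<tau> powr (1 / p - 1) / p)" for \<tau> :: real
  have [measurable]: "k \<in> borel_measurable borel" unfolding k_def by measurable
  define P where "P \<tau> t \<longleftrightarrow> t * A (max 0 \<tau>) < z * \<tau> powr (1 / p)" for \<tau> t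
  let ?g = "\<lambda>t \<tau>. k \<tau> * indicator {\<tau>. P \<tau> t} \<tau> * indicator {c..} \<tau>"
  have gm [measurable]: "(\<lambda>(t, \<tau>). ?g t \<tau>) \<in> borel_measurable (lborel \<Otimes>\<^sub>M lborel)"
  proof -
    have "(\<lambda>(t, \<tau>). ?g t \<tau>) = (\<lambda>y. k (snd y) * indicator {y. fst y * A (max 0 (snd y)) < z * (snd y) powr (1 / p)} y * indicator {c..} (snd y))"
      by (auto simp: fun_eq_iff indicator_def P_def)
    moreover have "\<dots> \<in> borel_measurable (lborel \<Otimes>\<^sub>M lborel)" by measurable
    ultimately show ?thesis by simp
  qed
  let ?w = "\<lambda>t::real. ennreal (t powr (p' - 1)) * ennreal (z / t) * indicator {0<..} t"
  have "(\<integral>\<^sup>+t\<in>{0<..}. ennreal (t powr (p' - 1)) * Theta2 A p c z t \<partial>lborel)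
    = (\<integral>\<^sup>+t. ?w t * (ennreal v0 * indicator {..<z} t) + ?w t * (\<integral>\<^sup>+\<tau>. ?g t \<tau> \<partial>lborel) \<partial>lborel)"
    by (intro nn_integral_cong) (auto simp: Theta2_def k_def v0_def P_def distrib_left mult_ac split: split_indicator)
  also have "\<dots> = (\<integral>\<^sup>+t. ?w t * (ennreal v0 * indicator {..<z} t) \<partial>lborel) + (\<integral>\<^sup>+t. ?w t * (\<integral>\<^sup>+\<tau>. ?g t \<tau> \<partial>lborel) \<partial>lborel)"
    by (rule nn_integral_add) measurable
  also have "(\<integral>\<^sup>+t. ?w t * (\<integral>\<^sup>+\<tau>. ?g t \<tau> \<partial>lborel) \<partial>lborel) = (\<integral>\<^sup>+t. (\<integral>\<^sup>+\<tau>. ?w t * ?g t \<tau> \<partial>lborel) \<partial>lborel)"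
    by (intro nn_integral_cong nn_integral_cmult[symmetric]) measurable
  also have "\<dots> = (\<integral>\<^sup>+\<tau>. (\<integral>\<^sup>+t. ?w t * ?g t \<tau> \<partial>lborel) \<partial>lborel)"
    by (rule lborel_pair.Fubini') measurable
  also have "\<dots> = (\<integral>\<^sup>+\<tau>. ennreal (z powr p' / ((p' - 1) * p)) * (ennreal ((\<tau> / A \<tau>) powr (p' - 1) / \<tau>) * indicator {c..} \<tau>) \<partial>lborel)"
  proof (rule nn_integral_cong)
    fix \<tau> :: real
    show "(\<integral>\<^sup>+t. ?w t * ?g t \<tau> \<partial>lborel) = ennreal (z powr p' / ((p' - 1) * p)) * (ennreal ((\<tau> / A \<tau>) powr (p' - 1) / \<tau>) * indicator {c..} \<tau>)"
    proof (cases "\<tau> \<ge> c")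
      case True
      then have \<tau>: "\<tau> > 0" using c by simp
      have A\<tau>: "A \<tau> > 0" by (rule young_pos[OF A \<tau>])
      let ?b = "z * \<tau> powr (1 / p) / A \<tau>"
      have b: "?b > 0" using z \<tau> A\<tau> by simp
      \<comment> \<open>Positivity of \<open>A \<tau>\<close> turns the condition
        \<open>P \<tau> t\<close> into \<open>t < ?b\<close>.\<close>
      have "(\<integral>\<^sup>+t. ?w t * ?g t \<tau> \<partial>lborel) = (\<integral>\<^sup>+t. (ennreal z * k \<tau>) * (ennreal (t powr (p' - 2)) * indicator {0<..<?b} t) \<partial>lborel)"
      proof (rule nn_integral_cong)
        fix t :: real
        have P: "P \<tau> t \<longleftrightarrow> t < ?b" using A\<tau> \<tau> by (simp add: P_def field_simps max_def)
        have "t powr (p' - 1) * (z / t) = z * t powr (p' - 2)" if "t > 0"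
        proof -
          have "t powr (p' - 1) = t powr (p' - 2 + 1)" by simp
          also have "\<dots> = t powr (p' - 2) * t" using that by (subst powr_add) simp
          finally show ?thesis using that by simp
        qed
        then have "?w t = ennreal z * ennreal (t powr (p' - 2)) * indicator {0<..} t"
          using z by (auto simp: ennreal_mult[symmetric] split: split_indicator)
        then show "?w t * ?g t \<tau> = (ennreal z * k \<tau>) * (ennreal (t powr (p' - 2)) * indicator {0<..<?b} t)"
          using True P by (auto simp: mult_ac split: split_indicator)
      qed
      also have "\<dots> = ennreal z * k \<tau> * ennreal (?b powr (p' - 1) / (p' - 1))"
        using nn_integral_powr_0[of "p' - 2" ?b] p' b by (subst nn_integral_cmult) auto
      also have "\<dots> = ennreal (z * (\<tau> powr (1 / p - 1) / p) * (?b powr (p' - 1) / (p' - 1)))"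
        using z p p' by (simp add: k_def ennreal_mult[symmetric])
      also have "z * (\<tau> powr (1 / p - 1) / p) * (?b powr (p' - 1) / (p' - 1))
          = z powr p' / ((p' - 1) * p) * ((\<tau> / A \<tau>) powr (p' - 1) / \<tau>)"
      proof -
        \<comment> \<open>Amounts to \<open>p' / p = p' - 1\<close>. It collects all powers of
          \<open>\<tau>\<close> into \<open>\<tau> powr (p' - 1) / \<tau>\<close>.\<close>
        have e: "(1 / p - 1) + 1 / p * (p' - 1) = (p' - 1) + (-1)"
        proof -
          have "1 / p = 1 - 1 / p'" using p by simp
          then have "1 / p * p' = p' - 1" using p' by (simp add: field_simps)
          moreover have "1 / p * (p' - 1) = 1 / p * p' - 1 / p" by (simp only: right_diff_distrib mult_1_right)
          ultimately show ?thesis by linarith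
        qed
        have e1: "?b powr (p' - 1) = z powr (p' - 1) * (\<tau> powr (1 / p * (p' - 1))) / A \<tau> powr (p' - 1)"
          using z \<tau> A\<tau> by (simp add: powr_divide powr_mult powr_powr)
        have e2: "\<tau> powr (1 / p - 1) * \<tau> powr (1 / p * (p' - 1)) = \<tau> powr (p' - 1) / \<tau>"
        proof -
          have "\<tau> powr (1 / p - 1) * \<tau> powr (1 / p * (p' - 1)) = \<tau> powr ((p' - 1) + (-1))"
            by (simp only: powr_add[symmetric] e)
          also have "\<dots> = \<tau> powr (p' - 1) * \<tau> powr (-1)" by (rule powr_add)
          also have "\<tau> powr (-1) = 1 / \<tau>" using \<tau> by (simp add: powr_minus divide_inverse)
          finally show ?thesis by simp
        qed
        have e3: "z * z powr (p' - 1) = z powr p'"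
          using z by (simp add: powr_mult_base)
        have "z * (\<tau> powr (1 / p - 1) / p) * (?b powr (p' - 1) / (p' - 1))
          = (z * z powr (p' - 1)) * (\<tau> powr (1 / p - 1) * \<tau> powr (1 / p * (p' - 1))) / (A \<tau> powr (p' - 1) * ((p' - 1) * p))"
          unfolding e1 by (simp add: mult_ac)
        also have "\<dots> = z powr p' * (\<tau> powr (p' - 1) / \<tau>) / (A \<tau> powr (p' - 1) * ((p' - 1) * p))"
          unfolding e2 e3 ..
        also have "\<dots> = z powr p' / ((p' - 1) * p) * ((\<tau> / A \<tau>) powr (p' - 1) / \<tau>)"
          using A\<tau> \<tau> by (simp add: powr_divide)
        finally show ?thesis .
      qed
      also have "ennreal (z powr p' / ((p' - 1) * p) * ((\<tau> / A \<tau>) powr (p' - 1) / \<tau>))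
          = ennreal (z powr p' / ((p' - 1) * p)) * ennreal ((\<tau> / A \<tau>) powr (p' - 1) / \<tau>)"
        using p p' \<tau> by (intro ennreal_mult) auto
      finally show ?thesis using True by simp
    qed simp
  qed
  also have "\<dots> = ennreal (z powr p' / ((p' - 1) * p)) * (\<integral>\<^sup>+\<tau>\<in>{c..}. ennreal ((\<tau> / A \<tau>) powr (p' - 1) / \<tau>) \<partial>lborel)"
  proof (rule nn_integral_cmult)
    have "(\<lambda>\<tau>. ennreal ((\<tau> / A (max 0 \<tau>)) powr (p' - 1) / \<tau>) * indicator {c..} \<tau>) \<in> borel_measurable lborel"
      by measurable
    moreover have "(\<lambda>\<tau>. ennreal ((\<tau> / A (max 0 \<tau>)) powr (p' - 1) / \<tau>) * indicator {c..} \<tau>) =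
      (\<lambda>\<tau>. ennreal ((\<tau> / A \<tau>) powr (p' - 1) / \<tau>) * indicator {c..} \<tau>)"
      using c by (auto simp: fun_eq_iff max_def split: split_indicator)
    ultimately show "(\<lambda>\<tau>. ennreal ((\<tau> / A \<tau>) powr (p' - 1) / \<tau>) * indicator {c..} \<tau>) \<in> borel_measurable lborel" by simp
  qed
  also have "\<dots> = ennreal (z powr p' / ((p' - 1) * p) * I)"
    unfolding I(1) using p p' I(2) by (intro ennreal_mult[symmetric]) auto
  \<comment> \<open>The boundary term of the layer cake: it accounts for the range of
    \<open>v\<close> below \<open>c powr (1 / p)\<close> and is supported on
    \<open>t < z\<close>.\<close>
  also have "(\<integral>\<^sup>+t. ?w t * (ennreal v0 * indicator {..<z} t) \<partial>lborel) = (\<integral>\<^sup>+t. (ennreal z * ennreal v0) * (ennreal (t powr (p' - 2)) * indicator {0<..<z} t) \<partial>lborel)"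
  proof (rule nn_integral_cong)
    fix t :: real
    have "t powr (p' - 1) * (z / t) = z * t powr (p' - 2)" if "t > 0"
    proof -
      have "t powr (p' - 1) = t powr (p' - 2 + 1)" by simp
      also have "\<dots> = t powr (p' - 2) * t" using that by (subst powr_add) simp
      finally show ?thesis using that by simp
    qed
    then have "?w t = ennreal z * ennreal (t powr (p' - 2)) * indicator {0<..} t"
      using z by (auto simp: ennreal_mult[symmetric] split: split_indicator)
    then show "?w t * (ennreal v0 * indicator {..<z} t) = (ennreal z * ennreal v0) * (ennreal (t powr (p' - 2)) * indicator {0<..<z} t)"
      by (auto simp: mult_ac split: split_indicator)
  qed
  also have "\<dots> = ennreal z * ennreal v0 * ennreal (z powr (p' - 1) / (p' - 1))"
    using nn_integral_powr_0[of "p' - 2" z] p' z by (subst nn_integral_cmult) auto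
  also have "\<dots> = ennreal (z * v0 * (z powr (p' - 1) / (p' - 1)))"
    using z v0 p' by (simp add: ennreal_mult[symmetric])
  also have "z * v0 * (z powr (p' - 1) / (p' - 1)) = z powr p' * v0 / (p' - 1)"
    using powr_mult_base[of z "p' - 1"] z by (simp add: field_simps)
  also have "ennreal (z powr p' * v0 / (p' - 1)) + ennreal (z powr p' / ((p' - 1) * p) * I)
     = ennreal (z powr p' * v0 / (p' - 1) + z powr p' / ((p' - 1) * p) * I)"
    using p p' v0 I(2) by (intro ennreal_plus[symmetric]) auto
  also have "z powr p' * v0 / (p' - 1) + z powr p' / ((p' - 1) * p) * I = (v0 + I / p) / (p' - 1) * z powr p'"
    by (simp add: add_divide_distrib distrib_right distrib_left mult_ac)
  also have "ennreal ((v0 + I / p) / (p' - 1) * z powr p') = ennreal ((v0 + I / p) / (p' - 1)) * ennreal (z powr p')"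
    using p p' v0 I(2) by (intro ennreal_mult) auto
  finally show ?thesis by (simp add: v0_def)
qed

text \<open>Young's inequality for \<open>A (v powr p)\<close> and its conjugate, up to a constant.
  If \<open>A (v powr p)\<close> does not already dominate \<open>z * v / t\<close>, convexity
  propagates the failure to every smaller \<open>\<tau> \<ge> c\<close>, so the layer-cake integral
  in \<open>Theta2\<close> sees the whole range up to \<open>v powr p\<close> and recovers
  \<open>v - c powr (1 / p)\<close>.\<close>

lemma Theta2_Young:
  assumes A: "young_function A" and p: "1 < p" and c: "c > 0"
    and z: "z \<ge> 0" and t: "t > 0" and v: "v \<ge> 0"
  shows "ennreal (z * v / t) \<le> ennreal (A (v powr p)) + ennreal (c powr (1 / p)) + Theta2 A p c z t"
proof -
  define v0 where "v0 = c powr (1 / p)"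
  have v0: "v0 > 0" using c by (simp add: v0_def)
  have zt: "z / t \<ge> 0" using z t by simp
  define H where "H = (\<integral>\<^sup>+\<tau>\<in>{c..}. ennreal (\<tau> powr (1 / p - 1) / p)
          * indicator {\<tau>. t * A (max 0 \<tau>) < z * \<tau> powr (1 / p)} \<tau> \<partial>lborel)"
  have Th: "Theta2 A p c z t = ennreal (z / t) * (ennreal v0 * indicator {t<..} z + H)"
    by (simp add: Theta2_def H_def v0_def)
  have m0: "ennreal (max 0 (v - v0)) = ennreal (v - v0)"
    by (simp add: max_def ennreal_neg)
  \<comment> \<open>It remains to pay for the part \<open>v0\<close> of \<open>v\<close>: if
    \<open>z \<le> t\<close> it costs at most the additive constant \<open>v0\<close>, otherwise the
    indicator term of \<open>Theta2\<close> contains it.\<close>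
  have reduce: "ennreal (z * v / t) \<le> ennreal v0 + Theta2 A p c z t" if Hge: "ennreal (v - v0) \<le> H"
  proof (cases "z \<le> t")
    case True
    then have "z / t \<le> 1" using t by simp
    then have "z / t * v0 \<le> v0" using mult_right_mono[of "z / t" 1 v0] v0 by simp
    moreover have "z / t * (v - v0) \<le> z / t * max 0 (v - v0)"
      using zt by (intro mult_left_mono) auto
    moreover have "z * v / t = z / t * v0 + z / t * (v - v0)"
      by (simp add: algebra_simps diff_divide_distrib)
    ultimately have "z * v / t \<le> v0 + z / t * max 0 (v - v0)" by linarith
    then have "ennreal (z * v / t) \<le> ennreal (v0 + z / t * max 0 (v - v0))" by (rule ennreal_leI)
    also have "\<dots> = ennreal v0 + ennreal (z / t) * ennreal (v - v0)"
      unfolding m0[symmetric] using v0 zt z t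
      by (subst ennreal_mult[symmetric], simp, simp, subst ennreal_plus[symmetric]) auto
    also have "\<dots> \<le> ennreal v0 + ennreal (z / t) * H" by (intro add_left_mono mult_left_mono Hge) simp
    also have "\<dots> \<le> ennreal v0 + Theta2 A p c z t" unfolding Th by (intro add_left_mono mult_left_mono) simp_all
    finally show ?thesis .
  next
    case False
    have "z * v / t \<le> z / t * (v0 + max 0 (v - v0))"
      using mult_left_mono[of v "v0 + max 0 (v - v0)" "z / t"] zt by simp
    then have "ennreal (z * v / t) \<le> ennreal (z / t * (v0 + max 0 (v - v0)))" by (rule ennreal_leI)
    also have "\<dots> = ennreal (z / t) * (ennreal v0 + ennreal (v - v0))"
      unfolding m0[symmetric] using v0 zt
      by (subst ennreal_plus[symmetric], simp, simp, subst ennreal_mult[symmetric]) auto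
    also have "\<dots> \<le> ennreal (z / t) * (ennreal v0 + H)" by (intro add_left_mono mult_left_mono Hge) simp
    also have "\<dots> = Theta2 A p c z t" unfolding Th using False by simp
    finally show ?thesis by (simp add: add_increasing)
  qed
  show ?thesis
  proof (cases "v \<le> v0")
    case True
    then have "ennreal (v - v0) \<le> H" by (simp add: ennreal_neg)
    from reduce[OF this] show ?thesis unfolding v0_def[symmetric] add.assoc by (simp add: add_increasing)
  next
    case False
    then have vv: "v > v0" "v > 0" using v0 by auto
    define \<tau>0 where "\<tau>0 = v powr p"
    have \<tau>0: "\<tau>0 > 0" using vv by (simp add: \<tau>0_def)
    have \<tau>0p: "\<tau>0 powr (1 / p) = v" using vv p by (simp add: \<tau>0_def powr_powr)
    have c\<tau>0: "c < \<tau>0"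
    proof -
      have "v0 powr p < v powr p" using vv v0 p by (intro powr_less_mono2) auto
      then show ?thesis using c p by (simp add: \<tau>0_def v0_def powr_powr)
    qed
    show ?thesis
    proof (cases "A \<tau>0 \<ge> z * v / t")
      case True
      then have "ennreal (z * v / t) \<le> ennreal (A \<tau>0)" by (rule ennreal_leI)
      then show ?thesis unfolding \<tau>0_def add.assoc by (simp add: add_increasing2)
    next
      case False
      \<comment> \<open>Convexity gives \<open>A \<tau> \<le> ?q * A \<tau>0\<close>, and
        \<open>?q \<le> ?q powr (1 / p)\<close> since \<open>?q \<le> 1\<close>; the power
        \<open>1 / p\<close> then converts \<open>v\<close> into
        \<open>\<tau> powr (1 / p)\<close>.\<close>
      have below: "t * A \<tau> < z * \<tau> powr (1 / p)" if \<tau>: "c \<le> \<tau>" "\<tau> \<le> \<tau>0" for \<tau>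
      proof -
        have \<tau>p: "\<tau> > 0" using \<tau> c by simp
        let ?q = "\<tau> / \<tau>0"
        have q: "0 < ?q" "?q \<le> 1" using \<tau>p \<tau>0 \<tau> by auto
        have "A (?q * \<tau>0) \<le> ?q * A \<tau>0" using q \<tau>0 by (intro young_scale[OF A]) auto
        then have "A \<tau> \<le> ?q * A \<tau>0" using \<tau>0 by simp
        also have "\<dots> \<le> ?q powr (1 / p) * A \<tau>0"
        proof (rule mult_right_mono)
          have "?q powr 1 \<le> ?q powr (1 / p)" using q p by (intro powr_mono') auto
          then show "?q \<le> ?q powr (1 / p)" by (simp only: powr_one[OF less_imp_le[OF q(1)]])
          show "0 \<le> A \<tau>0" using young_nonneg[OF A, of \<tau>0] \<tau>0 by simp
        qed
        also have "\<dots> < ?q powr (1 / p) * (z * v / t)"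
          using False q \<tau>p \<tau>0 by (intro mult_strict_left_mono) auto
        also have "\<dots> = \<tau> powr (1 / p) * z / t"
          using vv \<tau>p \<tau>0 by (simp add: powr_divide \<tau>0p)
        finally show ?thesis using t by (simp add: field_simps)
      qed
      have "ennreal (v - v0) = (\<integral>\<^sup>+\<tau>\<in>{c..\<tau>0}. ennreal (\<tau> powr (1 / p - 1) / p) \<partial>lborel)"
      proof -
        have "((\<lambda>\<tau>. \<tau> powr (1 / p - 1) / p) has_integral (\<tau>0 powr (1 / p) - c powr (1 / p))) {c..\<tau>0}"
        proof (rule fundamental_theorem_of_calculus)
          show "c \<le> \<tau>0" using c\<tau>0 by simp
          fix \<tau> assume \<tau>: "\<tau> \<in> {c..\<tau>0}"
          then have "\<tau> > 0" using c by simp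
          then have "((\<lambda>\<tau>. \<tau> powr (1 / p)) has_real_derivative (1 / p * \<tau> powr (1 / p - 1))) (at \<tau> within {c..\<tau>0})"
            by (rule has_field_derivative_at_within[OF has_real_derivative_powr])
          then show "((\<lambda>\<tau>. \<tau> powr (1 / p)) has_vector_derivative (\<tau> powr (1 / p - 1) / p)) (at \<tau> within {c..\<tau>0})"
            by (simp add: has_real_derivative_iff_has_vector_derivative)
        qed
        then have "(\<integral>\<^sup>+\<tau>\<in>{c..\<tau>0}. ennreal (\<tau> powr (1 / p - 1) / p) \<partial>lborel) = ennreal (\<tau>0 powr (1 / p) - c powr (1 / p))"
          using p by (intro nn_integral_has_integral_lebesgue') auto
        then show ?thesis by (simp add: \<tau>0p v0_def)
      qed
      also have "\<dots> \<le> H"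
        unfolding H_def
      proof (rule nn_integral_mono)
        fix \<tau>
        show "ennreal (\<tau> powr (1 / p - 1) / p) * indicator {c..\<tau>0} \<tau> \<le>
          ennreal (\<tau> powr (1 / p - 1) / p) * indicator {\<tau>. t * A (max 0 \<tau>) < z * \<tau> powr (1 / p)} \<tau> * indicator {c..} \<tau>"
        proof (cases "c \<le> \<tau> \<and> \<tau> \<le> \<tau>0")
          case True
          then have "max 0 \<tau> = \<tau>" "t * A \<tau> < z * \<tau> powr (1 / p)" using c below by auto
          with True show ?thesis by simp
        qed auto
      qed
      finally show ?thesis
        using reduce unfolding v0_def[symmetric] add.assoc by (simp add: add_increasing)
    qed
  qed
qed

section \<open>Duality and absorption for the sparse sum\<close>

lemma conjugate_exponent_gt_1:
  fixes p p' :: real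
  assumes "1 < p" "1 / p + 1 / p' = 1"
  shows "1 < p'" "(p - 1) * p' = p"
proof -
  have "1 / p < 1" using assms by simp
  then have "1 / p' > 0" using assms by linarith
  then have 1: "p' > 0" by simp
  have "1 / p > 0" using assms by simp
  then have "1 / p' < 1" using assms by linarith
  with 1 show "1 < p'" by (simp add: field_simps)
  have "p' + p = p * p'" using assms 1 by (simp add: field_simps)
  then show "(p - 1) * p' = p" by (simp add: algebra_simps)
qed

text \<open>The parameter \<open>\<eta>\<close> puts a small factor on the term that will be
  absorbed. The cases compare \<open>\<alpha>\<close> with \<open>\<eta> * b powr (p' - 1)\<close>;
  in the second one solves for \<open>b\<close>, using that \<open>p - 1\<close> and
  \<open>p' - 1\<close> are reciprocal.\<close>

lemma Young_scaled:
  fixes \<alpha> b \<eta> p p' :: real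
  assumes "1 < p" "1 / p + 1 / p' = 1" "\<alpha> \<ge> 0" "b \<ge> 0" "\<eta> > 0"
  shows "\<alpha> * b \<le> \<eta> powr (1 - p) * \<alpha> powr p + \<eta> * b powr p'"
proof (cases "\<alpha> \<le> \<eta> * b powr (p' - 1)")
  case True
  have p': "p' > 1" by (rule conjugate_exponent_gt_1[OF assms(1,2)])
  have "\<alpha> * b \<le> \<eta> * b powr (p' - 1) * b" using True assms by (intro mult_right_mono) auto
  also have "\<dots> = \<eta> * (b * b powr (p' - 1))" by simp
  also have "b * b powr (p' - 1) = b powr p'"
    using powr_mult_base[of b "p' - 1"] assms by simp
  finally show ?thesis by (simp add: add_increasing)
next
  case False
  have p': "p' > 1" "(p - 1) * p' = p" by (rule conjugate_exponent_gt_1[OF assms(1,2)])+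
  have \<alpha>: "\<alpha> > 0" using False assms by (smt (verit) mult_nonneg_nonneg powr_ge_zero)
  have "(p' - 1) * (p - 1) = 1" using p' by (simp add: algebra_simps)
  then have "b = (b powr (p' - 1)) powr (p - 1)" using assms by (cases "b = 0") (simp_all add: powr_powr)
  also have "\<dots> \<le> (\<alpha> / \<eta>) powr (p - 1)"
    using False assms by (intro powr_mono2) (auto simp: field_simps)
  finally have "\<alpha> * b \<le> \<alpha> * (\<alpha> / \<eta>) powr (p - 1)" using \<alpha> by simp
  also have "\<alpha> * (\<alpha> / \<eta>) powr (p - 1) = (\<alpha> * \<alpha> powr (p - 1)) / \<eta> powr (p - 1)"
    using \<alpha> assms by (simp add: powr_divide)
  also have "\<alpha> * \<alpha> powr (p - 1) = \<alpha> powr p"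
    using \<alpha> powr_mult_base[of \<alpha> "p - 1"] by simp
  also have "\<alpha> powr p / \<eta> powr (p - 1) = \<eta> powr (1 - p) * \<alpha> powr p"
    using powr_minus[of \<eta> "p - 1"] by (simp add: field_simps)
  finally show ?thesis using assms by (simp add: add_increasing2)
qed

lemma nn_integral_dil_le:
  fixes X :: "real^'n \<Rightarrow> ennreal" and q :: "nat \<times> (int^'n)"
  assumes "L > 0" "\<And>x. x \<in> dil L q \<Longrightarrow> X x \<le> ennreal c * (ennreal d + Y x)" "c \<ge> 0" "d \<ge> 0"
    "Y \<in> borel_measurable lebesgue"
  shows "(\<integral>\<^sup>+x\<in>dil L q. X x \<partial>lebesgue) \<le> ennreal c * (ennreal (d * (dil_ratio TYPE('n) * vol L q)) + (\<integral>\<^sup>+x\<in>dil L q. Y x \<partial>lebesgue))"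
proof -
  note [measurable] = assms(5)
  have "(\<integral>\<^sup>+x\<in>dil L q. X x \<partial>lebesgue) \<le> (\<integral>\<^sup>+x. ennreal c * (ennreal d * indicator (dil L q) x + Y x * indicator (dil L q) x) \<partial>lebesgue)"
    using assms(2) by (intro nn_integral_mono) (auto simp: indicator_def)
  also have "\<dots> = ennreal c * (ennreal d * emeasure lebesgue (dil L q) + (\<integral>\<^sup>+x\<in>dil L q. Y x \<partial>lebesgue))"
  proof -
    have "(\<integral>\<^sup>+x. (ennreal d * indicator (dil L q) x + Y x * indicator (dil L q) x) \<partial>lebesgue)
      = (\<integral>\<^sup>+x. ennreal d * indicator (dil L q) x \<partial>lebesgue) + (\<integral>\<^sup>+x\<in>dil L q. Y x \<partial>lebesgue)"
      by (rule nn_integral_add) measurable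
    also have "(\<integral>\<^sup>+x. ennreal d * indicator (dil L q) x \<partial>lebesgue) = ennreal d * emeasure lebesgue (dil L q)"
      by (rule nn_integral_cmult_indicator) measurable
    finally have eq: "(\<integral>\<^sup>+x. (ennreal d * indicator (dil L q) x + Y x * indicator (dil L q) x) \<partial>lebesgue)
      = ennreal d * emeasure lebesgue (dil L q) + (\<integral>\<^sup>+x\<in>dil L q. Y x \<partial>lebesgue)" .
    show ?thesis unfolding eq[symmetric] by (rule nn_integral_cmult) measurable
  qed
  also have "ennreal d * emeasure lebesgue (dil L q) = ennreal (d * (dil_ratio TYPE('n) * vol L q))"
    unfolding emeasure_dil[OF assms(1)] using assms(4) dil_ratio_ge[where 'n='n] vol_pos[OF assms(1), of q]
    by (intro ennreal_mult[symmetric]) auto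
  finally show ?thesis .
qed

text \<open>The constant \<open>d\<close> accounts for at most \<open>c * d * v\<close> of the
  left-hand side. An average \<open>x\<close> of at least \<open>c * (d + 1)\<close> leaves another
  \<open>c * v\<close>, which \<open>T\<close> has to supply.\<close>

lemma absorb_volume:
  fixes T :: ennreal
  assumes "ennreal (x * v) \<le> ennreal c * (ennreal (d * v) + T)" "c * (d + 1) \<le> x" "c > 0" "d \<ge> 0" "v > 0"
  shows "ennreal v \<le> T"
proof (cases T)
  case (real t)
  have "ennreal (c * ((d + 1) * v)) \<le> ennreal (x * v)"
    using assms mult_right_mono[OF assms(2), of v] by (intro ennreal_leI) (simp add: mult_ac)
  also have "\<dots> \<le> ennreal (c * (d * v + t))"
    using assms(1) real assms by (simp add: ennreal_plus[symmetric] ennreal_mult)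
  finally have "c * ((d + 1) * v) \<le> c * (d * v + t)" using assms real by (subst (asm) ennreal_le_iff) auto
  then have "v \<le> t" using assms by (simp add: algebra_simps)
  then show ?thesis using real by simp
qed simp

lemma ennreal_mult3:
  "x \<ge> 0 \<Longrightarrow> y \<ge> 0 \<Longrightarrow> z \<ge> 0 \<Longrightarrow> ennreal (x * (y * z)) * X = ennreal x * (ennreal y * (ennreal z * X))"
  by (simp add: ennreal_mult mult.assoc)

text \<open>The factor \<open>s q powr (1 / p)\<close> is moved from the weight to the coefficient
  \<open>a q\<close>. Near \<open>q\<close> it is dominated by \<open>W powr (1 / p)\<close>, so the
  new coefficients are L^r averages of \<open>g * W powr (1 / p)\<close>; dividing the weight by
  \<open>s q\<close> makes its \<open>A\<close>-average at most 1, which is what the conjugate bump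
  requires. The constant is fixed before the grid, the family and the functions.\<close>

lemma orlicz_bump:
  fixes A :: "real \<Rightarrow> real"
  assumes A: "young_function A" "doubling A" and p: "1 < p" "1 / p + 1 / p' = 1"
    and r: "0 < r" "r < p"
    and I: "\<exists>c>0. (\<integral>\<^sup>+t\<in>{c..}. ennreal ((t / A t) powr (p' - 1) / t) \<partial>lborel) < \<infinity>"
  obtains C where "C > 0" "\<And>L (G :: (nat \<times> (int^'n)) set) E a s g w W.
    L > 0 \<Longrightarrow> finite G \<Longrightarrow> (\<And>q. q \<in> G \<Longrightarrow> E q \<in> sets lebesgue \<and> E q \<subseteq> dcube L q
       \<and> ennreal (vol L q) \<le> 2 * emeasure lebesgue (E q)) \<Longrightarrow> disjoint_family_on E G \<Longrightarrow>
    g \<in> borel_measurable lebesgue \<Longrightarrow> w \<in> borel_measurable lebesgue \<Longrightarrow> W \<in> borel_measurable lebesgue \<Longrightarrow>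
    (\<And>x. g x \<ge> 0 \<and> w x \<ge> 0 \<and> W x \<ge> 0) \<Longrightarrow>
    (\<And>q. q \<in> G \<Longrightarrow> a q > 0 \<and> ennreal (a q powr r * vol L q) = (\<integral>\<^sup>+x\<in>dil L q. ennreal (g x powr r) \<partial>lebesgue)) \<Longrightarrow>
    (\<And>q. q \<in> G \<Longrightarrow> s q > 0 \<and> (\<integral>\<^sup>+x\<in>dil L q. ennreal (A (w x / s q)) \<partial>lebesgue) \<le> emeasure lebesgue (dil L q)) \<Longrightarrow>
    (\<And>q x. q \<in> G \<Longrightarrow> x \<in> dil L q \<Longrightarrow> s q \<le> 2 * W x) \<Longrightarrow>
    (\<integral>\<^sup>+x. ennreal ((\<Sum>q\<in>G. a q * indicator (dcube L q) x) powr p * w x) \<partial>lebesgue) < \<infinity> \<Longrightarrow>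
    (\<integral>\<^sup>+x. ennreal ((\<Sum>q\<in>G. a q * indicator (dcube L q) x) powr p * w x) \<partial>lebesgue)
      \<le> ennreal C * (\<integral>\<^sup>+x. ennreal (g x powr p * W x) \<partial>lebesgue)"
proof -
  obtain c where c: "c > 0" "(\<integral>\<^sup>+t\<in>{c..}. ennreal ((t / A t) powr (p' - 1) / t) \<partial>lborel) < \<infinity>"
    using I by auto
  define J where "J = enn2real (\<integral>\<^sup>+t\<in>{c..}. ennreal ((t / A t) powr (p' - 1) / t) \<partial>lborel)"
  have J: "(\<integral>\<^sup>+t\<in>{c..}. ennreal ((t / A t) powr (p' - 1) / t) \<partial>lborel) = ennreal J" "J \<ge> 0"
    using c(2) by (auto simp: J_def)
  have p': "p' > 1" "(p - 1) * p' = p" by (rule conjugate_exponent_gt_1[OF p])+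
  define v0 where "v0 = c powr (1 / p)"
  have v0: "v0 > 0" using c by (simp add: v0_def)
  define \<Lambda> where "\<Lambda> = dil_ratio TYPE('n)"
  have \<Lambda>: "\<Lambda> \<ge> 1" using dil_ratio_ge[where 'n='n] by (simp add: \<Lambda>_def)
  define V where "V = Vitali_const TYPE('n)"
  have V: "V > 0" using Vitali_const_pos[where 'n='n] by (simp add: V_def)
  \<comment> \<open>\<open>K1\<close> and \<open>K2\<close> are the thresholds of
    \<open>absorb_volume\<close>. For \<open>K1\<close> the constant is \<open>\<Lambda>\<close> and
    the factor \<open>2 powr (r / p)\<close> stems from \<open>s q \<le> 2 * W x\<close>; for
    \<open>K2\<close> the constant is \<open>\<Lambda>\<close> from the normalised
    \<open>A\<close>-average plus \<open>v0 * \<Lambda>\<close> from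
    \<open>Theta2_Young\<close>.\<close>
  define K1 where "K1 = (2 powr (r / p) * (\<Lambda> + 1)) powr (1 / r)"
  define K2 where "K2 = \<Lambda> + v0 * \<Lambda> + 1"
  have K: "K1 > 0" "K2 > 0" using \<Lambda> v0 by (simp_all add: K1_def K2_def add_pos_pos)
  have K1r: "K1 powr r = 2 powr (r / p) * (\<Lambda> + 1)" using r \<Lambda> by (simp add: K1_def powr_powr)
  define J2 where "J2 = (c powr (1 / p) + J / p) / (p' - 1)"
  have J2: "J2 \<ge> 0" using J p p' by (simp add: J2_def)
  define C1 where "C1 = K1 powr p * p * (V * (1 / (p - r)))"
  have C1: "C1 > 0" using K V p r by (simp add: C1_def)
  define C2 where "C2 = K2 powr p' * p' * (V * J2)"
  have C2: "C2 \<ge> 0" using K V p' J2 by (simp add: C2_def)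
  \<comment> \<open>Small enough that the returning term \<open>2 * \<eta> * C2 * Y\<close> is at
    most half of \<open>Y\<close>; the 2 comes from sparseness. The summand 1 covers
    \<open>C2 = 0\<close>.\<close>
  define \<eta> where "\<eta> = 1 / (4 * C2 + 1)"
  have \<eta>: "\<eta> > 0" "2 * \<eta> * C2 \<le> 1 / 2" using C2 by (simp_all add: \<eta>_def field_simps)
  define C where "C = 4 * \<eta> powr (1 - p) * C1"
  have C: "C > 0" using \<eta> C1 by (simp add: C_def)
  show ?thesis
  proof (rule that[OF C])
    fix L :: real and G :: "(nat \<times> (int^'n)) set" and E :: "nat \<times> (int^'n) \<Rightarrow> (real^'n) set"
      and a s :: "nat \<times> (int^'n) \<Rightarrow> real" and g w W :: "real^'n \<Rightarrow> real"
    assume L: "L > 0" and G: "finite G"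
      and E: "\<And>q. q \<in> G \<Longrightarrow> E q \<in> sets lebesgue \<and> E q \<subseteq> dcube L q \<and> ennreal (vol L q) \<le> 2 * emeasure lebesgue (E q)"
      and Edisj: "disjoint_family_on E G"
      and g [measurable]: "g \<in> borel_measurable lebesgue" and w [measurable]: "w \<in> borel_measurable lebesgue"
      and W [measurable]: "W \<in> borel_measurable lebesgue"
      and nn: "\<And>x. g x \<ge> 0 \<and> w x \<ge> 0 \<and> W x \<ge> 0"
      and a: "\<And>q. q \<in> G \<Longrightarrow> a q > 0 \<and> ennreal (a q powr r * vol L q) = (\<integral>\<^sup>+x\<in>dil L q. ennreal (g x powr r) \<partial>lebesgue)"
      and s: "\<And>q. q \<in> G \<Longrightarrow> s q > 0 \<and> (\<integral>\<^sup>+x\<in>dil L q. ennreal (A (w x / s q)) \<partial>lebesgue) \<le> emeasure lebesgue (dil L q)"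
      and sW: "\<And>q x. q \<in> G \<Longrightarrow> x \<in> dil L q \<Longrightarrow> s q \<le> 2 * W x"
    define S where "S x = (\<Sum>q\<in>G. a q * indicator (dcube L q) x)" for x
    have S0: "S x \<ge> 0" for x unfolding S_def by (intro sum_nonneg mult_nonneg_nonneg) (auto simp: less_imp_le a)
    have [measurable]: "S \<in> borel_measurable lebesgue" unfolding S_def by measurable
    define Y where "Y = (\<integral>\<^sup>+x. ennreal (S x powr p * w x) \<partial>lebesgue)"
    assume "(\<integral>\<^sup>+x. ennreal ((\<Sum>q\<in>G. a q * indicator (dcube L q) x) powr p * w x) \<partial>lebesgue) < \<infinity>"
    then have Yfin: "Y < \<infinity>" by (simp add: Y_def S_def)
    \<comment> \<open>The dual function: its \<open>p'\<close>-th power is the integrand of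
      \<open>Y\<close>, so the second embedding returns \<open>Y\<close> itself.\<close>
    define u where "u x = S x powr (p - 1) * w x powr (1 / p')" for x
    have [measurable]: "u \<in> borel_measurable lebesgue" unfolding u_def by measurable
    have u0: "u x \<ge> 0" for x by (simp add: u_def)
    have up: "u x powr p' = S x powr p * w x" for x
      using p' S0 nn by (simp add: u_def powr_mult powr_powr)
    define F where "F x = g x * W x powr (1 / p)" for x
    have [measurable]: "F \<in> borel_measurable lebesgue" unfolding F_def by measurable
    have F0: "F x \<ge> 0" for x using nn by (simp add: F_def)
    have Fp: "F x powr p = g x powr p * W x" for x
      using p nn by (simp add: F_def powr_mult powr_powr)
    define v where "v q x = (w x / s q) powr (1 / p)" for q x
    have [measurable]: "v q \<in> borel_measurable lebesgue" for q unfolding v_def by measurable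
    define \<alpha> where "\<alpha> q = a q * s q powr (1 / p)" for q
    have \<alpha>0: "\<alpha> q \<ge> 0" if "q \<in> G" for q using a[OF that] by (simp add: \<alpha>_def)
    define B where "B q = (\<integral>\<^sup>+x\<in>dcube L q. ennreal (u x * v q x) \<partial>lebesgue)" for q
    \<comment> \<open>One of the \<open>p\<close> factors of \<open>S\<close> is expanded into the
      sum over cubes, and \<open>s q powr (1 / p)\<close> is inserted and divided out cube by
      cube.\<close>
    have split: "S x powr p * w x = (\<Sum>q\<in>G. \<alpha> q * (u x * v q x) * indicator (dcube L q) x)" for x
    proof -
      have "S x powr p = S x * S x powr (p - 1)"
        using S0 powr_mult_base[of "S x" "p - 1"] by simp
      then have "S x powr p * w x = S x * (S x powr (p - 1) * w x)"
        by (simp only: mult.assoc)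
      also have "\<dots> = (\<Sum>q\<in>G. a q * indicator (dcube L q) x * (S x powr (p - 1) * w x))"
        by (subst (1) S_def) (rule sum_distrib_right)
      also have "\<dots> = (\<Sum>q\<in>G. \<alpha> q * (u x * v q x) * indicator (dcube L q) x)"
      proof (rule sum.cong[OF refl])
        fix q assume q: "q \<in> G"
        have "s q powr (1 / p) * v q x = w x powr (1 / p)"
          using s[OF q] nn[of x] unfolding v_def by (simp add: powr_divide)
        moreover have "w x powr (1 / p') * w x powr (1 / p) = w x"
          using p nn[of x] unfolding powr_add[symmetric] by (simp add: add.commute)
        moreover have "\<alpha> q * (u x * v q x) = a q * (S x powr (p - 1) * (w x powr (1 / p') * (s q powr (1 / p) * v q x)))"
          by (simp add: \<alpha>_def u_def mult_ac)
        ultimately have "\<alpha> q * (u x * v q x) = a q * (S x powr (p - 1) * w x)"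
          by simp
        then show "a q * indicator (dcube L q) x * (S x powr (p - 1) * w x) = \<alpha> q * (u x * v q x) * indicator (dcube L q) x"
          by (simp add: mult_ac)
      qed
      finally show ?thesis .
    qed
    have Y1: "Y = (\<Sum>q\<in>G. ennreal (\<alpha> q) * B q)"
    proof -
      have "Y = (\<integral>\<^sup>+x. (\<Sum>q\<in>G. ennreal (\<alpha> q) * (ennreal (u x * v q x) * indicator (dcube L q) x)) \<partial>lebesgue)"
        unfolding Y_def split
      proof (rule nn_integral_cong)
        fix x
        have "ennreal (\<Sum>q\<in>G. \<alpha> q * (u x * v q x) * indicator (dcube L q) x) = (\<Sum>q\<in>G. ennreal (\<alpha> q * (u x * v q x) * indicator (dcube L q) x))"
          using \<alpha>0 u0 by (intro sum_ennreal[symmetric]) (auto simp: v_def)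
        also have "\<dots> = (\<Sum>q\<in>G. ennreal (\<alpha> q) * (ennreal (u x * v q x) * indicator (dcube L q) x))"
          using \<alpha>0 by (intro sum.cong) (auto simp: ennreal_mult' indicator_def)
        finally show "ennreal (\<Sum>q\<in>G. \<alpha> q * (u x * v q x) * indicator (dcube L q) x) = (\<Sum>q\<in>G. ennreal (\<alpha> q) * (ennreal (u x * v q x) * indicator (dcube L q) x))" .
      qed
      also have "\<dots> = (\<Sum>q\<in>G. ennreal (\<alpha> q) * B q)"
        unfolding B_def by (subst nn_integral_sum) (auto simp: nn_integral_cmult)
      finally show ?thesis .
    qed
    define b where "b q = enn2real (B q) / vol L q" for q
    have b0: "b q \<ge> 0" for q using vol_pos[OF L, of q] by (simp add: b_def)
    \<comment> \<open>Passing to the real number \<open>b q\<close> loses nothing: \<open>Y\<close>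
      is finite and every \<open>\<alpha> q\<close> is positive, so no \<open>B q\<close> is
      infinite.\<close>
    have bB: "B q = ennreal (b q * vol L q)" if q: "q \<in> G" for q
    proof -
      have "ennreal (\<alpha> q) * B q \<le> Y" unfolding Y1 using G q by (intro member_le_sum) auto
      then have "ennreal (\<alpha> q) * B q < \<infinity>" using Yfin by (simp add: less_top order.strict_trans1)
      moreover have "\<alpha> q > 0" using a[OF q] s[OF q] by (simp add: \<alpha>_def)
      ultimately have "B q < \<infinity>" by (auto simp: ennreal_mult_less_top less_top)
      then show ?thesis using vol_pos[OF L, of q] by (simp add: b_def)
    qed
    have CE1: "(\<Sum>q\<in>G. ennreal (\<alpha> q powr p) * emeasure lebesgue (E q)) \<le> ennreal C1 * (\<integral>\<^sup>+x. ennreal (g x powr p * W x) \<partial>lebesgue)"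
    proof -
      have "(\<Sum>q\<in>G. ennreal (\<alpha> q powr p) * emeasure lebesgue (E q)) \<le>
        ennreal (K1 powr p * p) * (ennreal (Vitali_const TYPE('n)) * (ennreal (1 / (p - r)) * (\<integral>\<^sup>+x. ennreal (F x powr p) \<partial>lebesgue)))"
      proof (rule Carleson_embedding[where \<Theta> = "Theta1 r", OF L G])
        show "case_prod (Theta1 r) \<in> borel_measurable (borel \<Otimes>\<^sub>M borel)" by (rule Theta1_measurable)
        fix q t assume q: "q \<in> G" and t: "t > (0::real)" and Kt: "K1 * t < \<alpha> q"
        have [measurable]: "(\<lambda>x. Theta1 r (F x) t) \<in> borel_measurable lebesgue"
          unfolding Theta1_def by measurable
        have "ennreal (\<alpha> q powr r * vol L q) = ennreal (s q powr (r / p)) * (\<integral>\<^sup>+x\<in>dil L q. ennreal (g x powr r) \<partial>lebesgue)"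
          using a[OF q] s[OF q] vol_pos[OF L, of q]
          by (simp add: \<alpha>_def powr_mult powr_powr ennreal_mult mult_ac flip: a[OF q, THEN conjunct2])
        also have "\<dots> = (\<integral>\<^sup>+x\<in>dil L q. ennreal (s q powr (r / p) * g x powr r) \<partial>lebesgue)"
          by (subst nn_integral_cmult[symmetric]) (auto intro!: nn_integral_cong simp: ennreal_mult mult_ac)
        also have "\<dots> \<le> ennreal (2 powr (r / p) * t powr r) * (ennreal (1 * (dil_ratio TYPE('n) * vol L q)) + (\<integral>\<^sup>+x\<in>dil L q. Theta1 r (F x) t \<partial>lebesgue))"
        proof (rule nn_integral_dil_le[OF L])
          fix x assume x: "x \<in> dil L q"
          \<comment> \<open>The number \<open>s q\<close> is replaced by the function
            \<open>W\<close> under the integral; this moves the Luxemburg norm onto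
            \<open>g\<close>.\<close>
          have "s q powr (r / p) \<le> (2 * W x) powr (r / p)"
            using s[OF q] sW[OF q x] r by (intro powr_mono2) auto
          then have "s q powr (r / p) * g x powr r \<le> 2 powr (r / p) * (W x powr (r / p) * g x powr r)"
            using nn[of x] by (simp add: powr_mult mult_right_mono flip: mult.assoc)
          also have "W x powr (r / p) * g x powr r = F x powr r"
            using nn[of x] by (simp add: F_def powr_mult powr_powr mult_ac)
          finally have "ennreal (s q powr (r / p) * g x powr r) \<le> ennreal (2 powr (r / p) * F x powr r)"
            by (rule ennreal_leI)
          also have "\<dots> \<le> ennreal (2 powr (r / p) * t powr r) * (ennreal 1 + Theta1 r (F x) t)"
          proof (cases "F x > t")
            case True
            have "F x powr r \<le> t powr r * (1 + (F x / t) powr r)"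
              using t F0[of x] by (simp add: powr_divide field_simps)
            then have "ennreal (2 powr (r / p) * F x powr r) \<le> ennreal (2 powr (r / p) * (t powr r * (1 + (F x / t) powr r)))"
              by (intro ennreal_leI mult_left_mono) auto
            also have "\<dots> = ennreal (2 powr (r / p) * t powr r) * (ennreal 1 + Theta1 r (F x) t)"
              using True by (simp add: Theta1_def ennreal_mult mult.assoc ennreal_plus)
            finally show ?thesis .
          next
            case False
            then have "F x powr r \<le> t powr r" using F0 r by (intro powr_mono2) auto
            then have "ennreal (2 powr (r / p) * F x powr r) \<le> ennreal (2 powr (r / p) * t powr r)"
              by (intro ennreal_leI mult_left_mono) auto
            then show ?thesis using False by (simp add: Theta1_def)
          qed
          finally show "ennreal (s q powr (r / p) * g x powr r) \<le> ennreal (2 powr (r / p) * t powr r) * (ennreal 1 + Theta1 r (F x) t)" .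
        qed auto
        finally have *: "ennreal (\<alpha> q powr r * vol L q) \<le> ennreal (2 powr (r / p) * t powr r) * (ennreal (\<Lambda> * vol L q) + (\<integral>\<^sup>+x\<in>dil L q. Theta1 r (F x) t \<partial>lebesgue))"
          by (simp add: \<Lambda>_def)
        show "ennreal (vol L q) \<le> (\<integral>\<^sup>+x\<in>dil L q. Theta1 r (F x) t \<partial>lebesgue)"
        proof (rule absorb_volume[OF *])
          have "(K1 * t) powr r \<le> \<alpha> q powr r" using Kt t K r by (intro powr_mono2) auto
          then show "2 powr (r / p) * t powr r * (\<Lambda> + 1) \<le> \<alpha> q powr r"
            using t K by (simp add: powr_mult K1r mult_ac)
        qed (use \<Lambda> t vol_pos[OF L, of q] in auto)
      qed (use E Edisj \<alpha>0 p K F0 Theta1_integral[OF r] in auto)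
      then show ?thesis
        unfolding C1_def Fp V_def[symmetric] using V p r by (subst ennreal_mult3) simp_all
    qed
    have CE2: "(\<Sum>q\<in>G. ennreal (b q powr p') * emeasure lebesgue (E q)) \<le> ennreal C2 * Y"
    proof -
      have "(\<Sum>q\<in>G. ennreal (b q powr p') * emeasure lebesgue (E q)) \<le>
        ennreal (K2 powr p' * p') * (ennreal (Vitali_const TYPE('n)) * (ennreal J2 * (\<integral>\<^sup>+x. ennreal (u x powr p') \<partial>lebesgue)))"
      proof (rule Carleson_embedding[where \<Theta> = "Theta2 A p c", OF L G])
        show "case_prod (Theta2 A p c) \<in> borel_measurable (borel \<Otimes>\<^sub>M borel)" by (rule Theta2_measurable[OF A(1)])
        fix z :: real assume "z \<ge> 0"
        then show "(\<integral>\<^sup>+t\<in>{0<..}. ennreal (t powr (p' - 1)) * Theta2 A p c z t \<partial>lborel) \<le> ennreal J2 * ennreal (z powr p')"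
          unfolding J2_def by (rule Theta2_integral[OF A p c(1) J])
      next
        fix q t assume q: "q \<in> G" and t: "t > (0::real)" and Kt: "K2 * t < b q"
        have [measurable]: "(\<lambda>x. Theta2 A p c (u x) t) \<in> borel_measurable lebesgue"
        proof -
          have "(\<lambda>x. (u x, t)) \<in> lebesgue \<rightarrow>\<^sub>M borel \<Otimes>\<^sub>M borel" by measurable
          from measurable_compose[OF this Theta2_measurable[OF A(1)]] show ?thesis by simp
        qed
        have [measurable]: "(\<lambda>x. A (w x / s q)) \<in> borel_measurable lebesgue"
          using nn s[OF q] by (intro young_measurable'[OF A(1)]) (auto intro: divide_nonneg_pos)
        have "ennreal (b q * vol L q) \<le> (\<integral>\<^sup>+x\<in>dil L q. ennreal (u x * v q x) \<partial>lebesgue)"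
          unfolding bB[OF q, symmetric] B_def using dcube_subset_dil[OF L, of q]
          by (intro nn_integral_mono) (auto simp: indicator_def)
        \<comment> \<open>Young's inequality at level \<open>t\<close>. The choice of
          \<open>s q\<close> bounds the integral of \<open>A (w x / s q)\<close> by the measure of
          the dilate, which joins the constant to be absorbed.\<close>
        also have "\<dots> \<le> ennreal t * (ennreal (v0 * (dil_ratio TYPE('n) * vol L q)) +
            (\<integral>\<^sup>+x\<in>dil L q. (ennreal (A (w x / s q)) + Theta2 A p c (u x) t) \<partial>lebesgue))"
        proof (rule nn_integral_dil_le[OF L])
          fix x assume x: "x \<in> dil L q"
          have "v q x powr p = w x / s q" using p nn[of x] s[OF q] by (simp add: v_def powr_powr)
          then have "ennreal (u x * v q x / t) \<le> ennreal (A (w x / s q)) + ennreal v0 + Theta2 A p c (u x) t"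
            using Theta2_Young[OF A(1) p(1) c(1) u0[of x] t, of "v q x"] by (simp add: v0_def v_def)
          then have "ennreal t * ennreal (u x * v q x / t) \<le> ennreal t * (ennreal v0 + (ennreal (A (w x / s q)) + Theta2 A p c (u x) t))"
            by (intro mult_left_mono) (simp_all add: add_ac)
          moreover have "ennreal t * ennreal (u x * v q x / t) = ennreal (u x * v q x)"
            using t u0[of x] by (subst ennreal_mult[symmetric]) (auto simp: v_def)
          ultimately show "ennreal (u x * v q x) \<le> ennreal t * (ennreal v0 + (ennreal (A (w x / s q)) + Theta2 A p c (u x) t))"
            by simp
        qed (use t v0 in auto)
        also have "(\<integral>\<^sup>+x\<in>dil L q. (ennreal (A (w x / s q)) + Theta2 A p c (u x) t) \<partial>lebesgue)
           = (\<integral>\<^sup>+x\<in>dil L q. ennreal (A (w x / s q)) \<partial>lebesgue) + (\<integral>\<^sup>+x\<in>dil L q. Theta2 A p c (u x) t \<partial>lebesgue)"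
          by (subst nn_integral_add[symmetric]) (auto simp: distrib_right)
        also have "\<dots> \<le> ennreal (\<Lambda> * vol L q) + (\<integral>\<^sup>+x\<in>dil L q. Theta2 A p c (u x) t \<partial>lebesgue)"
          using s[OF q] by (intro add_right_mono) (simp add: emeasure_dil[OF L] \<Lambda>_def)
        also have "ennreal (v0 * (dil_ratio TYPE('n) * vol L q)) + (ennreal (\<Lambda> * vol L q) + (\<integral>\<^sup>+x\<in>dil L q. Theta2 A p c (u x) t \<partial>lebesgue))
            = ennreal ((\<Lambda> + v0 * \<Lambda>) * vol L q) + (\<integral>\<^sup>+x\<in>dil L q. Theta2 A p c (u x) t \<partial>lebesgue)"
          using v0 \<Lambda> vol_pos[OF L, of q] by (simp add: \<Lambda>_def[symmetric] ennreal_plus[symmetric] add.assoc[symmetric] algebra_simps del: ennreal_plus)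
        finally have *: "ennreal (b q * vol L q) \<le> ennreal t * (ennreal ((\<Lambda> + v0 * \<Lambda>) * vol L q) + (\<integral>\<^sup>+x\<in>dil L q. Theta2 A p c (u x) t \<partial>lebesgue))"
          by (simp add: mult_left_mono)
        show "ennreal (vol L q) \<le> (\<integral>\<^sup>+x\<in>dil L q. Theta2 A p c (u x) t \<partial>lebesgue)"
        proof (rule absorb_volume[OF *])
          show "t * (\<Lambda> + v0 * \<Lambda> + 1) \<le> b q" using Kt by (simp add: K2_def mult.commute less_imp_le)
        qed (use \<Lambda> t v0 vol_pos[OF L, of q] in auto)
      qed (use E Edisj b0 p' K u0 in auto)
      then show ?thesis
        unfolding C2_def up Y_def V_def[symmetric] using V p' J2 by (subst ennreal_mult3) simp_all
    qed
    let ?X = "\<integral>\<^sup>+x. ennreal (g x powr p * W x) \<partial>lebesgue"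
    have "Y = (\<Sum>q\<in>G. ennreal (\<alpha> q * b q) * ennreal (vol L q))"
      unfolding Y1
    proof (rule sum.cong[OF refl])
      fix q assume q: "q \<in> G"
      have "ennreal (\<alpha> q) * B q = ennreal (\<alpha> q) * (ennreal (b q) * ennreal (vol L q))"
        unfolding bB[OF q] using b0 vol_pos[OF L, of q] by (subst ennreal_mult) auto
      also have "\<dots> = ennreal (\<alpha> q * b q) * ennreal (vol L q)"
        using b0 \<alpha>0[OF q] by (simp add: ennreal_mult mult.assoc)
      finally show "ennreal (\<alpha> q) * B q = ennreal (\<alpha> q * b q) * ennreal (vol L q)" .
    qed
    \<comment> \<open>Sparseness trades \<open>vol L q\<close> for twice the measure of
      \<open>E q\<close>, the form in which both embeddings apply.\<close>
    also have "\<dots> \<le> (\<Sum>q\<in>G. ennreal (\<eta> powr (1 - p) * \<alpha> q powr p + \<eta> * b q powr p') * (2 * emeasure lebesgue (E q)))"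
      using \<eta> \<alpha>0 b0
      by (intro sum_mono mult_mono ennreal_leI Young_scaled[OF p] E[THEN conjunct2, THEN conjunct2]) auto
    also have "\<dots> = ennreal (2 * \<eta> powr (1 - p)) * (\<Sum>q\<in>G. ennreal (\<alpha> q powr p) * emeasure lebesgue (E q))
        + ennreal (2 * \<eta>) * (\<Sum>q\<in>G. ennreal (b q powr p') * emeasure lebesgue (E q))"
      unfolding sum_distrib_left sum.distrib[symmetric]
      using \<eta> by (intro sum.cong) (auto simp: ennreal_plus ennreal_mult distrib_right distrib_left mult_ac)
    also have "\<dots> \<le> ennreal (2 * \<eta> powr (1 - p)) * (ennreal C1 * ?X) + ennreal (2 * \<eta>) * (ennreal C2 * Y)"
      by (intro add_mono mult_left_mono CE1 CE2) auto
    also have "ennreal (2 * \<eta> powr (1 - p)) * (ennreal C1 * ?X) = ennreal (C / 2) * ?X"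
    proof -
      have "C / 2 = 2 * \<eta> powr (1 - p) * C1" by (simp add: C_def)
      then show ?thesis using C1 by (simp only: mult.assoc[symmetric]) (simp add: ennreal_mult)
    qed
    also have "ennreal (2 * \<eta>) * (ennreal C2 * Y) = ennreal (2 * \<eta> * C2) * Y"
      using C2 \<eta> by (simp add: mult.assoc[symmetric] ennreal_mult[symmetric])
    also have "\<dots> \<le> ennreal (1 / 2) * Y"
      using \<eta> by (intro mult_right_mono ennreal_leI) auto
    finally have fin: "Y \<le> ennreal (C / 2) * ?X + ennreal (1 / 2) * Y" by (simp add: add_left_mono)
    \<comment> \<open>Subtracting half of \<open>Y\<close> is legitimate by \<open>Yfin\<close>. If
      \<open>?X\<close> is infinite there is nothing to prove.\<close>
    have "Y \<le> ennreal C * ?X"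
    proof (cases ?X)
      case (real X)
      obtain y where y: "Y = ennreal y" "y \<ge> 0" using Yfin by (cases Y) auto
      have m: "ennreal (C / 2 * X) = ennreal (C / 2) * ennreal X" "ennreal (1 / 2 * y) = ennreal (1 / 2) * ennreal y"
        using C real y by (intro ennreal_mult; simp)+
      have "ennreal (C / 2 * X + 1 / 2 * y) = ennreal (C / 2 * X) + ennreal (1 / 2 * y)"
        using C real y by (intro ennreal_plus) auto
      with fin have "ennreal y \<le> ennreal (C / 2 * X + 1 / 2 * y)"
        unfolding m real y(1) by (simp only:)
      then have "y \<le> C / 2 * X + 1 / 2 * y" using C real y by (subst (asm) ennreal_le_iff) auto
      then have "y \<le> C * X" by simp
      then show ?thesis using C real y by (simp add: ennreal_mult[symmetric] ennreal_leI)
    next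
      case top
      then show ?thesis using C by (simp add: ennreal_mult_top)
    qed
    then show "(\<integral>\<^sup>+x. ennreal ((\<Sum>q\<in>G. a q * indicator (dcube L q) x) powr p * w x) \<partial>lebesgue) \<le> ennreal C * ?X"
      by (simp add: Y_def S_def)
  qed
qed

section \<open>Luxemburg norms, weights and exhausting cubes\<close>

lemma epowr_ennreal [simp]: "x \<ge> 0 \<Longrightarrow> epowr (ennreal x) p = ennreal (x powr p)"
  by (simp add: epowr_def)

lemma epowr_mono: "p > 0 \<Longrightarrow> x \<le> y \<Longrightarrow> epowr x p \<le> epowr y p"
  by (cases x; cases y) (auto simp: epowr_def top_unique intro!: ennreal_leI powr_mono2)

lemma epowr_0 [simp]: "epowr 0 p = 0"
  by (simp add: epowr_def)

lemma epowr_cmult: "p > 0 \<Longrightarrow> c > 0 \<Longrightarrow> epowr (ennreal c * x) p = ennreal (c powr p) * epowr x p"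
  by (cases x) (auto simp: epowr_def ennreal_mult_top powr_mult simp flip: ennreal_mult)

lemma epowr_measurable [measurable]: "(\<lambda>x. epowr x p) \<in> borel_measurable borel"
  unfolding epowr_def by measurable

lemma cubesD:
  fixes Q :: "(real^'n) set"
  assumes "Q \<in> cubes"
  shows "Q \<in> sets lebesgue" "compact Q" "0 < emeasure lebesgue Q" "emeasure lebesgue Q < top"
proof -
  obtain a l where Q: "Q = cbox a (\<chi> i. a $ i + l)" "l > 0" using assms by (auto simp: cubes_def)
  then show "Q \<in> sets lebesgue" "compact Q" by auto
  have "emeasure lebesgue Q = ennreal (l ^ CARD('n))" using emeasure_cube(1)[of l a] Q by simp
  then show "0 < emeasure lebesgue Q" "emeasure lebesgue Q < top" using Q(2) by (simp_all del: emeasure_completion)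
qed

definition bigcube :: "real \<Rightarrow> (real^'n) set" where
  "bigcube R = cbox (\<chi> i. - R) (\<chi> i. R)"

lemma bigcube_cubes: "R > 0 \<Longrightarrow> bigcube R \<in> cubes"
  unfolding cubes_def bigcube_def
  by (intro CollectI exI[of _ "\<chi> i. - R"] exI[of _ "2 * R"]) (simp add: vec_eq_iff)

lemma bounded_subset_bigcube:
  fixes S :: "(real^'n) set"
  assumes "bounded S" obtains R where "R > 0" "\<And>R'. R' \<ge> R \<Longrightarrow> S \<subseteq> bigcube R'"
proof -
  obtain B where B: "B > 0" "\<And>x. x \<in> S \<Longrightarrow> norm x \<le> B" using assms by (auto simp: bounded_pos)
  have "S \<subseteq> bigcube R'" if "R' \<ge> B" for R'
  proof
    fix x assume "x \<in> S"
    then have "norm x \<le> R'" using B that by fastforce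
    then have "\<bar>x $ i\<bar> \<le> R'" for i using component_le_norm_cart[of x i] by linarith
    then show "x \<in> bigcube R'" by (auto simp: bigcube_def mem_box_cart abs_le_iff minus_le_iff)
  qed
  then show ?thesis using that B(1) by blast
qed

lemma ennreal_divide_le_1_iff:
  fixes a b :: ennreal assumes "0 < b" "b < top"
  shows "a / b \<le> 1 \<longleftrightarrow> a \<le> b"
proof
  assume "a / b \<le> 1"
  then have "a / b * b \<le> 1 * b" by (rule mult_right_mono) simp
  moreover have "a / b * b = a" using assms by (simp add: ennreal_divide_times)
  ultimately show "a \<le> b" by simp
next
  assume "a \<le> b"
  then show "a / b \<le> 1" using assms by (intro divide_le_posI_ennreal) auto
qed

text \<open>Working with a strict bound avoids any discussion of whether the infimum is
  attained.\<close>

lemma luxemburg_lessD: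
  assumes Q: "Q \<in> cubes" and w: "\<And>x. w x \<ge> 0" and less: "luxemburg_norm A Q w < ennreal b"
  obtains s where "s > 0" "s < b" "(\<integral>\<^sup>+y\<in>Q. ennreal (A (w y / s)) \<partial>lebesgue) \<le> emeasure lebesgue Q"
proof -
  obtain s where s: "s > 0" "ennreal s < ennreal b"
    "(\<integral>\<^sup>+y\<in>Q. ennreal (A (\<bar>w y\<bar> / s)) \<partial>lebesgue) / emeasure lebesgue Q \<le> 1"
    using less unfolding luxemburg_norm_def Inf_less_iff by auto
  have "s < b" using s by (simp add: ennreal_less_iff)
  moreover have "(\<integral>\<^sup>+y\<in>Q. ennreal (A (w y / s)) \<partial>lebesgue) \<le> emeasure lebesgue Q"
    using s(3) ennreal_divide_le_1_iff[OF cubesD(3,4)[OF Q]] w by simp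
  ultimately show ?thesis using that s(1) by blast
qed

lemma luxemburg_leI:
  assumes Q: "Q \<in> cubes" and w: "\<And>x. w x \<ge> 0" and "s > 0"
    and "(\<integral>\<^sup>+y\<in>Q. ennreal (A (w y / s)) \<partial>lebesgue) \<le> emeasure lebesgue Q"
  shows "luxemburg_norm A Q w \<le> ennreal s"
  unfolding luxemburg_norm_def
  using assms ennreal_divide_le_1_iff[OF cubesD(3,4)[OF Q]] by (intro Inf_lower) auto

text \<open>Norm zero means that arbitrarily small \<open>s\<close> are admissible. Convexity gives
  \<open>A (w) \<le> s * A (w / s)\<close> for \<open>s \<le> 1\<close>, so the integral of
  \<open>A (w)\<close> over \<open>Q\<close> is below every multiple of the measure of
  \<open>Q\<close>, and \<open>A\<close> vanishes only at 0.\<close>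

lemma luxemburg_zero:
  assumes A: "young_function A" "doubling A" and Q: "Q \<in> cubes" and w: "\<And>x. w x \<ge> 0"
    and wm [measurable]: "w \<in> borel_measurable lebesgue" and 0: "luxemburg_norm A Q w = 0"
  shows "AE x in lebesgue. x \<in> Q \<longrightarrow> w x = 0"
proof -
  have [measurable]: "Q \<in> sets lebesgue" by (rule cubesD[OF Q])
  have [measurable]: "(\<lambda>x. A (w x)) \<in> borel_measurable lebesgue" by (rule young_measurable'[OF A(1) wm w])
  let ?I = "\<integral>\<^sup>+y\<in>Q. ennreal (A (w y)) \<partial>lebesgue"
  obtain m where m: "emeasure lebesgue Q = ennreal m" "m \<ge> 0"
    using cubesD(4)[OF Q] by (cases "emeasure lebesgue Q") auto
  have le: "?I \<le> ennreal (b * m)" if b: "0 < b" "b \<le> 1" for b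
  proof -
    have "luxemburg_norm A Q w < ennreal b" using 0 b by simp
    then obtain s where s: "s > 0" "s < b" "(\<integral>\<^sup>+y\<in>Q. ennreal (A (w y / s)) \<partial>lebesgue) \<le> emeasure lebesgue Q"
      using luxemburg_lessD[where w=w, OF Q w] by blast
    have [measurable]: "(\<lambda>x. A (w x / s)) \<in> borel_measurable lebesgue"
      using w s by (intro young_measurable'[OF A(1)]) auto
    have "?I \<le> (\<integral>\<^sup>+y. ennreal s * (ennreal (A (w y / s)) * indicator Q y) \<partial>lebesgue)"
    proof (rule nn_integral_mono)
      fix y
      have "A (s * (w y / s)) \<le> s * A (w y / s)" using s b w by (intro young_scale[OF A(1)]) auto
      then have "ennreal (A (w y)) \<le> ennreal s * ennreal (A (w y / s))"
        using s by (simp add: ennreal_leI flip: ennreal_mult')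
      then show "ennreal (A (w y)) * indicator Q y \<le> ennreal s * (ennreal (A (w y / s)) * indicator Q y)"
        by (auto simp: indicator_def)
    qed
    also have "\<dots> = ennreal s * (\<integral>\<^sup>+y\<in>Q. ennreal (A (w y / s)) \<partial>lebesgue)"
      by (rule nn_integral_cmult) measurable
    also have "\<dots> \<le> ennreal b * ennreal m" using s m by (intro mult_mono ennreal_leI) auto
    also have "\<dots> = ennreal (b * m)" using b m by (simp add: ennreal_mult)
    finally show ?thesis .
  qed
  have "?I = 0"
  proof (rule ccontr)
    assume "?I \<noteq> 0"
    obtain v where v: "?I = ennreal v" "v \<ge> 0" using le[of 1] by (cases ?I) (auto simp: top_unique)
    with \<open>?I \<noteq> 0\<close> have v0: "v > 0" by auto
    \<comment> \<open>Chosen so that \<open>b * m\<close> is at most \<open>v / 2\<close>, which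
      contradicts \<open>v \<le> b * m\<close>.\<close>
    define b where "b = min 1 (v / (2 * (m + 1)))"
    have b: "0 < b" "b \<le> 1" using v0 m by (auto simp: b_def)
    have "v \<le> b * m" using le[OF b] v b m by (simp add: ennreal_le_iff)
    also have "\<dots> \<le> v / (2 * (m + 1)) * m" using m by (intro mult_right_mono) (auto simp: b_def)
    also have "\<dots> \<le> v / 2" using v0 m by (simp add: field_simps)
    finally show False using v0 by simp
  qed
  then have "AE x in lebesgue. ennreal (A (w x)) * indicator Q x = 0"
    by (subst (asm) nn_integral_0_iff_AE) auto
  then show ?thesis
  proof eventually_elim
    case (elim x)
    show ?case
    proof
      assume x: "x \<in> Q"
      show "w x = 0"
      proof (rule ccontr)
        assume "w x \<noteq> 0"
        then have "A (w x) > 0" using w[of x] by (intro young_pos[OF A]) simp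
        then show False using elim x by simp
      qed
    qed
  qed
qed

text \<open>Enlarging an admissible \<open>s\<close> by \<open>c \<ge> 1\<close> gains a factor
  \<open>1 / c\<close> by convexity, enough to compensate the ratio of the measures. In
  contrapositive form, an infinite norm on one cube is infinite on all larger cubes, so the maximal
  function is infinite everywhere.\<close>

lemma luxemburg_finite_mono:
  assumes A: "young_function A" and Q: "Q \<in> cubes" and Q': "Q' \<in> cubes" and sub: "Q \<subseteq> Q'" and w: "\<And>x. w x \<ge> 0"
    and wm [measurable]: "w \<in> borel_measurable lebesgue" and fin: "luxemburg_norm A Q' w < top"
  shows "luxemburg_norm A Q w < top"
proof -
  have [measurable]: "Q \<in> sets lebesgue" "Q' \<in> sets lebesgue" by (rule cubesD[OF Q] cubesD[OF Q'])+
  obtain b where "luxemburg_norm A Q' w < ennreal b"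
  proof (cases "luxemburg_norm A Q' w")
    case (real l)
    then have "luxemburg_norm A Q' w < ennreal (l + 1)" by (simp add: ennreal_less_iff)
    then show ?thesis by (rule that)
  qed (use fin in simp)
  then obtain s where s: "s > 0" "(\<integral>\<^sup>+y\<in>Q'. ennreal (A (w y / s)) \<partial>lebesgue) \<le> emeasure lebesgue Q'"
    using luxemburg_lessD[where w=w, OF Q' w] by blast
  have [measurable]: "(\<lambda>x. A (w x / s)) \<in> borel_measurable lebesgue"
    using w s by (intro young_measurable'[OF A(1)]) auto
  obtain m where m: "emeasure lebesgue Q = ennreal m" "m > 0"
    using cubesD(3,4)[OF Q] by (cases "emeasure lebesgue Q") auto
  obtain m' where m': "emeasure lebesgue Q' = ennreal m'" "m' \<ge> 0"
    using cubesD(4)[OF Q'] by (cases "emeasure lebesgue Q'") auto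
  define c where "c = max 1 (m' / m)"
  have c: "c \<ge> 1" "m' / c \<le> m"
  proof -
    show c1: "c \<ge> 1" by (simp add: c_def)
    have "m' / m \<le> c" by (simp add: c_def)
    then show "m' / c \<le> m" using m c1 by (simp add: field_simps)
  qed
  have "luxemburg_norm A Q w \<le> ennreal (c * s)"
  proof (rule luxemburg_leI[where w=w, OF Q w])
    show "c * s > 0" using c s by simp
    have "(\<integral>\<^sup>+y\<in>Q. ennreal (A (w y / (c * s))) \<partial>lebesgue) \<le> (\<integral>\<^sup>+y. ennreal (1 / c) * (ennreal (A (w y / s)) * indicator Q' y) \<partial>lebesgue)"
    proof (rule nn_integral_mono)
      fix y
      have "A (1 / c * (w y / s)) \<le> 1 / c * A (w y / s)" using s c w by (intro young_scale[OF A(1)]) auto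
      then have "ennreal (A (w y / (c * s))) \<le> ennreal (1 / c * A (w y / s))" by (intro ennreal_leI) simp
      also have "\<dots> = ennreal (1 / c) * ennreal (A (w y / s))" using c by (intro ennreal_mult') auto
      finally show "ennreal (A (w y / (c * s))) * indicator Q y \<le> ennreal (1 / c) * (ennreal (A (w y / s)) * indicator Q' y)"
        using sub by (auto simp: indicator_def)
    qed
    also have "\<dots> = ennreal (1 / c) * (\<integral>\<^sup>+y\<in>Q'. ennreal (A (w y / s)) \<partial>lebesgue)"
      by (rule nn_integral_cmult) measurable
    also have "\<dots> \<le> ennreal (1 / c) * ennreal m'" using s m' by (intro mult_left_mono) auto
    also have "\<dots> = ennreal (m' / c)" using c m' by (simp flip: ennreal_mult)
    also have "\<dots> \<le> emeasure lebesgue Q" unfolding m(1) using c by (intro ennreal_leI)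
    finally show "(\<integral>\<^sup>+y\<in>Q. ennreal (A (w y / (c * s))) \<partial>lebesgue) \<le> emeasure lebesgue Q" .
  qed
  then show ?thesis by (rule order.strict_trans1) simp
qed

text \<open>Local integrability gives measurability on each cube of an exhaustion; at every point
  the truncations are eventually equal to \<open>w\<close>.\<close>

lemma weight_measurable:
  fixes w :: "real^'n \<Rightarrow> real"
  assumes "weight w" shows "w \<in> borel_measurable lebesgue"
proof (rule borel_measurable_LIMSEQ_real)
  let ?u = "\<lambda>m x. indicator (bigcube (real m)) x *\<^sub>R w x"
  show "?u m \<in> borel_measurable lebesgue" for m
    using assms unfolding weight_def set_integrable_def
    by (intro borel_measurable_integrable) (auto simp: bigcube_def)
  fix x :: "real^'n"
  obtain R where R: "\<And>R'. R' \<ge> R \<Longrightarrow> {x} \<subseteq> bigcube R'" by (rule bounded_subset_bigcube[of "{x}"]) auto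
  have "eventually (\<lambda>m. real m \<ge> R) sequentially"
    using filterlim_real_sequentially by (simp add: filterlim_at_top)
  then have "eventually (\<lambda>m. ?u m x = w x) sequentially"
    by eventually_elim (use R in \<open>auto simp: indicator_def\<close>)
  then show "(\<lambda>m. ?u m x) \<longlonglongrightarrow> w x" by (rule tendsto_eventually)
qed

lemma weight_nn_integral_finite:
  assumes "weight w" "compact S"
  shows "(\<integral>\<^sup>+x\<in>S. ennreal (w x) \<partial>lebesgue) < \<infinity>"
proof -
  have "integrable lebesgue (\<lambda>x. indicator S x *\<^sub>R w x)"
    using assms by (simp add: weight_def set_integrable_def)
  then have "(\<integral>\<^sup>+x. ennreal (norm (indicator S x *\<^sub>R w x)) \<partial>lebesgue) < \<infinity>"
    by (simp add: integrable_iff_bounded)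
  also have "(\<integral>\<^sup>+x. ennreal (norm (indicator S x *\<^sub>R w x)) \<partial>lebesgue) = (\<integral>\<^sup>+x\<in>S. ennreal (w x) \<partial>lebesgue)"
    using assms by (intro nn_integral_cong) (auto simp: weight_def indicator_def)
  finally show ?thesis .
qed

lemma compact_dil: "compact (dil L q)"
  by (simp add: dil_def compact_cbox)

lemma dil_0:
  "dil L ((0, 0) :: nat \<times> (int^'n)) = bigcube ((1 + 2 * margin TYPE('n)) * L)"
  by (simp add: dil_def bigcube_def corner_def side_def algebra_simps)

lemma bigcube_mono: "R \<le> R' \<Longrightarrow> bigcube R \<subseteq> bigcube R'"
  by (auto simp: bigcube_def mem_box_cart) (meson order_trans neg_le_iff_le)+

lemma eventually_subset_dil_0:
  fixes S :: "(real^'n) set"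
  assumes "bounded S"
  shows "eventually (\<lambda>m. S \<subseteq> dil (real (Suc m)) ((0, 0) :: nat \<times> (int^'n))) sequentially"
proof -
  obtain R where R: "R > 0" "\<And>R'. R' \<ge> R \<Longrightarrow> S \<subseteq> bigcube R'" by (rule bounded_subset_bigcube[OF assms]) blast
  have "eventually (\<lambda>m. real m \<ge> R) sequentially"
    using filterlim_real_sequentially by (simp add: filterlim_at_top)
  then show ?thesis
  proof eventually_elim
    case (elim m)
    have "R \<le> 1 * real (Suc m)" using elim by simp
    also have "\<dots> \<le> (1 + 2 * margin TYPE('n)) * real (Suc m)"
      using margin_ge[where 'n='n] by (intro mult_right_mono) auto
    finally show ?case unfolding dil_0 by (rule R(2))
  qed
qed

section \<open>Sparse domination of maximally modulated operators\<close>

locale modulated_operator =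
  fixes D :: "(real^'n \<Rightarrow> complex) set"
    and T :: "(real^'n \<Rightarrow> complex) \<Rightarrow> real^'n \<Rightarrow> complex"
    and K :: "real^'n \<Rightarrow> real^'n \<Rightarrow> complex"
    and cK \<delta> r N :: real
    and Ind :: "'i set"
    and \<phi> :: "'i \<Rightarrow> real^'n \<Rightarrow> real"
  assumes domain: "operator_domain D"
    and T_add: "\<And>f g x. f \<in> D \<Longrightarrow> g \<in> D \<Longrightarrow> T (\<lambda>y. f y + g y) x = T f x + T g x"
    and T_scale: "\<And>f c x. f \<in> D \<Longrightarrow> T (\<lambda>y. c * f y) x = c * T f x"
    and T_kernel: "\<And>f x. f \<in> D \<Longrightarrow> x \<notin> closure {y. f y \<noteq> 0} \<Longrightarrow>
           integrable lebesgue (\<lambda>y. K x y * f y) \<and> T f x = (\<integral>y. K x y * f y \<partial>lebesgue)"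
    and cK: "cK \<ge> 0" and \<delta>: "\<delta> > 0"
    and smooth: "\<And>x x' y. norm (x - x') < norm (x - y) / 2 \<Longrightarrow>
           cmod (K x y - K x' y) \<le> cK * (norm (x - x') powr \<delta> / norm (x - y) powr (real CARD('n) + \<delta>))"
    and \<phi>: "\<And>\<alpha>. \<alpha> \<in> Ind \<Longrightarrow> \<phi> \<alpha> \<in> borel_measurable lebesgue"
    and r: "1 < r" and N: "N > 0"
    and weak: "weak_type_on D (max_modulated T Ind \<phi>) r N"
begin

abbreviation M :: "(real^'n \<Rightarrow> complex) \<Rightarrow> real^'n \<Rightarrow> ennreal" where
  "M \<equiv> max_modulated T Ind \<phi>"

definition e :: "'i \<Rightarrow> real^'n \<Rightarrow> complex" where
  "e \<alpha> y = exp (2 * of_real pi * \<i> * of_real (\<phi> \<alpha> y))"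

definition restr :: "(real^'n) set \<Rightarrow> (real^'n \<Rightarrow> complex) \<Rightarrow> real^'n \<Rightarrow> complex" where
  "restr S f = (\<lambda>x. indicator S x * f x)"

section \<open>Modulations, restrictions and sublinearity of the maximal operator\<close>

lemma cmod_e [simp]: "cmod (e \<alpha> y) = 1"
proof -
  have "2 * of_real pi * \<i> * of_real (\<phi> \<alpha> y) = \<i> * of_real (2 * pi * \<phi> \<alpha> y)" by simp
  then show ?thesis unfolding e_def by (simp only: norm_exp_i_times)
qed

lemma M_eq: "M f x = (SUP \<alpha>\<in>Ind. ennreal (cmod (T (\<lambda>y. e \<alpha> y * f y) x)))"
  by (simp add: max_modulated_def e_def)

lemma D_measurable: "f \<in> D \<Longrightarrow> f \<in> borel_measurable lebesgue"
  using domain by (auto simp: operator_domain_def)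

lemma D_mult: "f \<in> D \<Longrightarrow> b \<in> borel_measurable lebesgue \<Longrightarrow> bounded (range b) \<Longrightarrow> (\<lambda>x. b x * f x) \<in> D"
  using domain by (auto simp: operator_domain_def)

lemma D_scale: "f \<in> D \<Longrightarrow> (\<lambda>x. c * f x) \<in> D"
proof -
  have "range (\<lambda>_::real^'n. c) = {c}" by auto
  then show "f \<in> D \<Longrightarrow> (\<lambda>x. c * f x) \<in> D" using D_mult[of f "\<lambda>_. c"] by simp
qed

lemma D_restr: assumes "f \<in> D" "S \<in> sets lebesgue" shows "restr S f \<in> D"
  unfolding restr_def
proof (rule D_mult[OF assms(1)])
  show "(indicator S :: real^'n \<Rightarrow> complex) \<in> borel_measurable lebesgue" using assms by simp
  show "bounded (range (indicator S :: real^'n \<Rightarrow> complex))"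
    by (rule boundedI[of _ 1]) (auto simp: indicator_def)
qed

lemma D_e: assumes "f \<in> D" "\<alpha> \<in> Ind" shows "(\<lambda>y. e \<alpha> y * f y) \<in> D"
proof (rule D_mult[OF assms(1)])
  note [measurable] = \<phi>[OF assms(2)]
  show "e \<alpha> \<in> borel_measurable lebesgue"
  proof -
    have "continuous_on UNIV (\<lambda>t::real. exp (2 * complex_of_real pi * \<i> * complex_of_real t))"
      by (intro continuous_intros)
    from measurable_compose[OF \<phi>[OF assms(2)] borel_measurable_continuous_onI[OF this]]
    show ?thesis by (simp add: e_def[abs_def])
  qed
  show "bounded (range (e \<alpha>))" by (rule boundedI[of _ 1]) auto
qed

text \<open>A unimodular \<open>c\<close> covers sums and differences at once: a restriction of
  \<open>f\<close> is both added back and removed in the stopping argument.\<close>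

lemma M_add_scaled:
  assumes "f \<in> D" "g \<in> D" "cmod c = 1"
  shows "M (\<lambda>y. f y + c * g y) x \<le> M f x + M g x"
  unfolding M_eq[of "\<lambda>y. f y + c * g y"]
proof (rule SUP_least)
  fix \<alpha> assume \<alpha>: "\<alpha> \<in> Ind"
  have "(\<lambda>y. e \<alpha> y * (f y + c * g y)) = (\<lambda>y. e \<alpha> y * f y + c * (e \<alpha> y * g y))"
    by (auto simp: fun_eq_iff algebra_simps)
  then have "T (\<lambda>y. e \<alpha> y * (f y + c * g y)) x = T (\<lambda>y. e \<alpha> y * f y) x + c * T (\<lambda>y. e \<alpha> y * g y) x"
    using T_add[OF D_e[OF assms(1) \<alpha>] D_scale[OF D_e[OF assms(2) \<alpha>]]] T_scale[OF D_e[OF assms(2) \<alpha>]]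
    by simp
  then have "ennreal (cmod (T (\<lambda>y. e \<alpha> y * (f y + c * g y)) x)) \<le> ennreal (cmod (T (\<lambda>y. e \<alpha> y * f y) x) + cmod (T (\<lambda>y. e \<alpha> y * g y) x))"
    using assms(3) norm_triangle_ineq[of "T (\<lambda>y. e \<alpha> y * f y) x" "c * T (\<lambda>y. e \<alpha> y * g y) x"]
    by (intro ennreal_leI) (simp add: norm_mult)
  also have "\<dots> = ennreal (cmod (T (\<lambda>y. e \<alpha> y * f y) x)) + ennreal (cmod (T (\<lambda>y. e \<alpha> y * g y) x))"
    by (simp add: ennreal_plus)
  also have "\<dots> \<le> M f x + M g x"
    unfolding M_eq using \<alpha> by (intro add_mono SUP_upper)
  finally show "ennreal (cmod (T (\<lambda>y. e \<alpha> y * (f y + c * g y)) x)) \<le> M f x + M g x" .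
qed

lemma M_restr_split:
  assumes f: "f \<in> D" and S: "S \<in> sets lebesgue" "S' \<in> sets lebesgue" "S' \<subseteq> S"
  shows "M (restr S f) x \<le> M (restr S' f) x + M (restr (S - S') f) x"
    and "M (restr (S - S') f) x \<le> M (restr S f) x + M (restr S' f) x"
proof -
  have "restr S f = (\<lambda>y. restr S' f y + 1 * restr (S - S') f y)"
    using S by (auto simp: restr_def fun_eq_iff indicator_def)
  then show "M (restr S f) x \<le> M (restr S' f) x + M (restr (S - S') f) x"
    using M_add_scaled[of "restr S' f" "restr (S - S') f" 1 x] D_restr[OF f] S by simp
  have "restr (S - S') f = (\<lambda>y. restr S f y + (-1) * restr S' f y)"
    using S by (auto simp: restr_def fun_eq_iff indicator_def)
  then show "M (restr (S - S') f) x \<le> M (restr S f) x + M (restr S' f) x"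
    using M_add_scaled[of "restr S f" "restr S' f" "-1" x] D_restr[OF f] S by simp
qed

text \<open>For each modulation the two values of \<open>T\<close> differ by an integral against
  \<open>K x y - K x' y\<close>. Since modulations have modulus 1, the bound on it is the same for
  all \<open>\<alpha>\<close> and survives the supremum.\<close>

lemma M_smooth:
  assumes g: "g \<in> D" and L: "L > 0" and x: "x \<in> dcube L q" and x': "x' \<in> dcube L q"
    and g0: "\<And>y. y \<in> dil L q \<Longrightarrow> g y = 0"
  shows "M g x \<le> M g x' + (\<integral>\<^sup>+y. ennreal (cmod (K x y - K x' y) * cmod (g y)) \<partial>lebesgue)"
  unfolding M_eq[of g x]
proof (rule SUP_least)
  fix \<alpha> assume \<alpha>: "\<alpha> \<in> Ind"
  let ?h = "\<lambda>y. e \<alpha> y * g y"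
  have "{y. ?h y \<noteq> 0} \<subseteq> - dil L q" using g0 by auto
  then have "closure {y. ?h y \<noteq> 0} \<subseteq> - interior (dil L q)"
    using closure_mono[of "{y. ?h y \<noteq> 0}" "- dil L q"] by (simp add: closure_complement)
  then have off: "z \<notin> closure {y. ?h y \<noteq> 0}" if "z \<in> dcube L q" for z
    using dcube_interior_dil[OF L that] by auto
  note k = T_kernel[OF D_e[OF g \<alpha>] off[OF x]] and k' = T_kernel[OF D_e[OF g \<alpha>] off[OF x']]
  have int: "integrable lebesgue (\<lambda>y. K x y * ?h y - K x' y * ?h y)"
    using k k' by (intro Bochner_Integration.integrable_diff) auto
  have "T ?h x = T ?h x' + (\<integral>y. K x y * ?h y - K x' y * ?h y \<partial>lebesgue)"
    using k k' by (subst Bochner_Integration.integral_diff) auto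
  then have "ennreal (cmod (T ?h x)) \<le> ennreal (cmod (T ?h x') + cmod (\<integral>y. K x y * ?h y - K x' y * ?h y \<partial>lebesgue))"
    by (intro ennreal_leI) (simp add: norm_triangle_ineq)
  also have "\<dots> = ennreal (cmod (T ?h x')) + ennreal (cmod (\<integral>y. K x y * ?h y - K x' y * ?h y \<partial>lebesgue))"
    by (simp add: ennreal_plus)
  also have "\<dots> \<le> M g x' + (\<integral>\<^sup>+y. ennreal (cmod (K x y - K x' y) * cmod (g y)) \<partial>lebesgue)"
  proof (rule add_mono)
    show "ennreal (cmod (T ?h x')) \<le> M g x'" unfolding M_eq using \<alpha> by (rule SUP_upper)
    have "ennreal (cmod (\<integral>y. K x y * ?h y - K x' y * ?h y \<partial>lebesgue)) \<le> (\<integral>\<^sup>+y. ennreal (cmod (K x y * ?h y - K x' y * ?h y)) \<partial>lebesgue)"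
      by (rule integral_norm_bound_ennreal[OF int])
    also have "\<dots> = (\<integral>\<^sup>+y. ennreal (cmod (K x y - K x' y) * cmod (g y)) \<partial>lebesgue)"
      by (intro nn_integral_cong) (simp add: norm_mult flip: left_diff_distrib)
    finally show "ennreal (cmod (\<integral>y. K x y * ?h y - K x' y * ?h y \<partial>lebesgue)) \<le> \<dots>" .
  qed
  finally show "ennreal (cmod (T ?h x)) \<le> M g x' + (\<integral>\<^sup>+y. ennreal (cmod (K x y - K x' y) * cmod (g y)) \<partial>lebesgue)" .
qed

section \<open>Weak-type level sets and the kernel tail\<close>

lemma weak_type:
  assumes g: "g \<in> D" and X: "(\<integral>\<^sup>+y. ennreal (cmod (g y) powr r) \<partial>lebesgue) = ennreal X" "X \<ge> 0"
  shows "M g \<in> borel_measurable lebesgue"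
    and "t > 0 \<Longrightarrow> emeasure lebesgue {x. M g x > ennreal t} \<le> ennreal ((N / t) powr r * X)"
proof -
  have norm: "Lp_norm r g = ennreal (X powr (1 / r))"
    using X by (simp add: Lp_norm_def epowr_def)
  then have "g \<in> D \<inter> Lp_space r"
    using g D_measurable[OF g] by (simp add: Lp_space_def)
  with weak have *: "M g \<in> borel_measurable lebesgue" "weak_Lp_norm r (M g) \<le> ennreal N * Lp_norm r g"
    by (auto simp: weak_type_on_def)
  then show "M g \<in> borel_measurable lebesgue" by simp
  assume t: "t > 0"
  let ?m = "emeasure lebesgue {x. M g x > ennreal t}"
  have "ennreal t * epowr ?m (1 / r) \<le> weak_Lp_norm r (M g)"
    unfolding weak_Lp_norm_def using t by (intro SUP_upper) auto
  also have "\<dots> \<le> ennreal (N * X powr (1 / r))"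
    using *(2) N unfolding norm by (simp add: ennreal_mult)
  finally have le: "ennreal t * epowr ?m (1 / r) \<le> ennreal (N * X powr (1 / r))" .
  show "?m \<le> ennreal ((N / t) powr r * X)"
  proof (cases ?m)
    case (real m)
    have "ennreal (t * m powr (1 / r)) \<le> ennreal (N * X powr (1 / r))"
      using le real t by (simp add: epowr_def ennreal_mult)
    then have "t * m powr (1 / r) \<le> N * X powr (1 / r)"
      using N by (subst (asm) ennreal_le_iff) auto
    then have "m powr (1 / r) \<le> N / t * X powr (1 / r)"
      using t by (simp add: field_simps)
    then have "(m powr (1 / r)) powr r \<le> (N / t * X powr (1 / r)) powr r"
      using r by (intro powr_mono2) auto
    moreover have "(m powr (1 / r)) powr r = m" using real r by (simp add: powr_powr)
    moreover have "(N / t * X powr (1 / r)) powr r = (N / t) powr r * X"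
      using X r N t by (subst powr_mult) (auto simp: powr_powr)
    ultimately have "m \<le> (N / t) powr r * X" by simp
    then show ?thesis using real by (simp add: ennreal_leI)
  next
    case top
    then have "ennreal t * epowr ?m (1 / r) = top" using t by (simp add: epowr_def ennreal_mult_top)
    with le show ?thesis by (simp add: top_unique)
  qed
qed

text \<open>The last factor sums the geometric series over shells, \<open>2 ^ CARD('n)\<close>
  passes from a shell's inner to its outer cube, the power of \<open>CARD('n)\<close> comes from the
  diameter of a cube, and \<open>dil_ratio + \<kappa>\<close> bounds the mean of \<open>|f|\<close>
  in units of \<open>a\<close>.\<close>

definition Ctail :: "real \<Rightarrow> real" where
  "Ctail \<kappa> = cK * real CARD('n) powr \<delta> * 2 ^ CARD('n) * (dil_ratio TYPE('n) + \<kappa>) * (1 / (1 - 2 powr (- \<delta>)))"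

text \<open>The region between the two dilates is cut into shells by the ancestors of the small
  cube. Relative to the size of a shell, \<open>|x - x'|\<close> decays geometrically with the
  number of generations in between, and the mean of \<open>|f|\<close> on each shell is bounded
  because none of these ancestors has a large average.\<close>

lemma tail_bound:
  assumes L: "L > 0" and k: "k0 \<le> k" and a: "a > 0" and \<kappa>: "\<kappa> \<ge> 0" and f: "f \<in> borel_measurable lebesgue"
    and x: "x \<in> dcube L (k, index L k z)" and x': "x' \<in> dcube L (k, index L k z)"
    and avg: "\<And>j. k0 \<le> j \<Longrightarrow> j < k \<Longrightarrow> (\<integral>\<^sup>+y\<in>dil L (j, index L j z). ennreal (cmod (f y) powr r) \<partial>lebesgue)
       \<le> ennreal (\<kappa> * a powr r * vol L (j, index L j z))"
  shows "(\<integral>\<^sup>+y. ennreal (cmod (K x y - K x' y) * cmod (restr (dil L (k0, index L k0 z) - dil L (k, index L k z)) f y)) \<partial>lebesgue)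
    \<le> ennreal (Ctail \<kappa> * a)"
proof -
  note [measurable] = f
  define Dj where "Dj j = dil L (j, index L j z)" for j
  have Dj_mono: "Dj j \<subseteq> Dj i" if "i \<le> j" for i j
    using dil_anc_subset[OF L that, of z] by (simp add: Dj_def)
  define v where "v j = side L j ^ CARD('n)" for j
  have vpos: "v j > 0" for j using side_pos[OF L, of j] by (simp add: v_def)
  define n where "n = real CARD('n)"
  have n: "n \<ge> 1" using zero_less_card_finite[where 'a='n] by (simp add: n_def del: zero_less_card_finite)
  define \<theta> where "\<theta> = (2::real) powr (- \<delta>)"
  have \<theta>: "0 < \<theta>" "\<theta> < 1" using \<delta> powr_less_mono[of "- \<delta>" 0 2] by (auto simp: \<theta>_def)
  define C where "C = cK * n powr \<delta> * 2 ^ CARD('n)"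
  have C: "C \<ge> 0" using cK by (simp add: C_def)
  define w where "w j = C * \<theta> ^ (k - Suc j) / v j" for j
  have w: "w j \<ge> 0" for j using C \<theta> vpos[of j] by (simp add: w_def)
  \<comment> \<open>The distance to \<open>y\<close> is measured at generation \<open>Suc j\<close>,
    whose dilate \<open>y\<close> has left, while \<open>|x - x'|\<close> is measured at the finest
    generation \<open>k\<close>; the ratio yields the power of \<open>\<theta>\<close>.\<close>
  have kern: "cmod (K x y - K x' y) \<le> w j" if j: "j < k" and y: "y \<notin> Dj (Suc j)" for j y
  proof -
    have jk: "Suc j \<le> k" using j by simp
    have xs: "x \<in> dcube L (Suc j, index L (Suc j) z)" using dcube_mono[OF L jk, of z] x by auto
    have yk: "y \<notin> dil L (k, index L k z)" using Dj_mono[OF jk] y by (auto simp: Dj_def)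
    have "norm (x - x') < norm (x - y) / 2" by (rule norm_diff_less_half[OF L x x' yk])
    from smooth[OF this] have "cmod (K x y - K x' y) \<le> cK * (norm (x - x') powr \<delta> / norm (x - y) powr (n + \<delta>))"
      by (simp add: n_def)
    also have "\<dots> \<le> cK * ((n * side L k) powr \<delta> / side L (Suc j) powr (n + \<delta>))"
    proof (intro mult_left_mono frac_le cK)
      show "norm (x - x') powr \<delta> \<le> (n * side L k) powr \<delta>"
        using norm_diff_dcube[OF L x x'] \<delta> by (intro powr_mono2) (auto simp: n_def)
      have "side L (Suc j) \<le> margin TYPE('n) * side L (Suc j)"
        using side_pos[OF L, of "Suc j"] margin_ge[where 'n='n] by simp
      also have "\<dots> \<le> norm (x - y)"
        using norm_diff_outside_dil[OF L xs] y by (simp add: Dj_def)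
      finally show "side L (Suc j) powr (n + \<delta>) \<le> norm (x - y) powr (n + \<delta>)"
        using \<delta> n side_pos[OF L, of "Suc j"] by (intro powr_mono2) auto
      show "0 < side L (Suc j) powr (n + \<delta>)" using side_pos[OF L, of "Suc j"] by simp
    qed auto
    also have "cK * ((n * side L k) powr \<delta> / side L (Suc j) powr (n + \<delta>)) = w j"
    proof -
      have sj: "side L (Suc j) = side L j / 2" using side_mono[OF L, of j "Suc j"] by simp
      have sk: "side L k = side L (Suc j) / 2 ^ (k - Suc j)" by (rule side_mono[OF L jk])
      have s: "side L (Suc j) > 0" by (rule side_pos[OF L])
      have "(n * side L k) powr \<delta> = n powr \<delta> * (side L (Suc j) powr \<delta> / (2 ^ (k - Suc j)) powr \<delta>)"
        unfolding sk using n s by (subst powr_mult) (auto simp: powr_divide)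
      also have "(2 ^ (k - Suc j)) powr \<delta> = 1 / \<theta> ^ (k - Suc j)"
      proof -
        have "(2 ^ (k - Suc j) :: real) = 2 powr real (k - Suc j)" by (simp add: powr_realpow)
        then have "(2 ^ (k - Suc j)) powr \<delta> = (2::real) powr (real (k - Suc j) * \<delta>)" by (simp only: powr_powr)
        moreover have "\<theta> ^ (k - Suc j) = 2 powr (- (real (k - Suc j) * \<delta>))"
          by (simp add: \<theta>_def powr_power mult.commute)
        ultimately show ?thesis by (simp add: powr_minus divide_inverse)
      qed
      finally have 1: "(n * side L k) powr \<delta> = n powr \<delta> * side L (Suc j) powr \<delta> * \<theta> ^ (k - Suc j)"
        by simp
      have "side L (Suc j) powr (n + \<delta>) = side L (Suc j) powr n * side L (Suc j) powr \<delta>"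
        by (simp add: powr_add)
      also have "side L (Suc j) powr n = v j / 2 ^ CARD('n)"
        using s unfolding n_def by (subst powr_realpow) (auto simp: v_def sj power_divide)
      finally have 2: "side L (Suc j) powr (n + \<delta>) = v j / 2 ^ CARD('n) * side L (Suc j) powr \<delta>" .
      show ?thesis
        unfolding 1 2 w_def C_def using s vpos[of j] by (simp add: field_simps)
    qed
    finally show ?thesis .
  qed
  have int1: "(\<integral>\<^sup>+y\<in>Dj j. ennreal (cmod (f y)) \<partial>lebesgue) \<le> ennreal (a * (dil_ratio TYPE('n) + \<kappa>) * v j)"
    if j: "k0 \<le> j" "j < k" for j
  proof -
    have "(\<integral>\<^sup>+y\<in>Dj j. ennreal (cmod (f y)) \<partial>lebesgue)
      \<le> ennreal a * (ennreal (1 * (dil_ratio TYPE('n) * vol L (j, index L j z))) + (\<integral>\<^sup>+y\<in>Dj j. ennreal (a powr (- r)) * ennreal (cmod (f y) powr r) \<partial>lebesgue))"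
      unfolding Dj_def
    proof (rule nn_integral_dil_le[OF L])
      fix y
      \<comment> \<open>Takes the place of Hoelder's inequality in passing from the L^r average to
        the L^1 average.\<close>
      have "cmod (f y) \<le> a * (1 + a powr (- r) * cmod (f y) powr r)"
      proof (cases "cmod (f y) \<le> a")
        case True
        have "a * 1 \<le> a * (1 + a powr (- r) * cmod (f y) powr r)" using a by (intro mult_left_mono) auto
        then show ?thesis using True by simp
      next
        case False
        then have F: "cmod (f y) > 0" "cmod (f y) / a \<ge> 1" using a by auto
        have "cmod (f y) = a * (cmod (f y) / a) powr 1" using a F by simp
        also have "\<dots> \<le> a * (cmod (f y) / a) powr r"
          using a F r by (intro mult_left_mono powr_mono) auto
        also have "(cmod (f y) / a) powr r = a powr (- r) * cmod (f y) powr r"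
          using a F by (simp add: powr_divide powr_minus_divide)
        also have "a * \<dots> \<le> a * (1 + \<dots>)" using a by (intro mult_left_mono) auto
        finally show ?thesis .
      qed
      then have "ennreal (cmod (f y)) \<le> ennreal (a * (1 + a powr (- r) * cmod (f y) powr r))" by (rule ennreal_leI)
      also have "\<dots> = ennreal a * (ennreal 1 + ennreal (a powr (- r)) * ennreal (cmod (f y) powr r))"
        using a by (simp add: ennreal_mult ennreal_plus)
      finally show "ennreal (cmod (f y)) \<le> ennreal a * (ennreal 1 + ennreal (a powr (- r)) * ennreal (cmod (f y) powr r))" .
    qed (use a in auto)
    also have "(\<integral>\<^sup>+y\<in>Dj j. ennreal (a powr (- r)) * ennreal (cmod (f y) powr r) \<partial>lebesgue)
       = ennreal (a powr (- r)) * (\<integral>\<^sup>+y\<in>Dj j. ennreal (cmod (f y) powr r) \<partial>lebesgue)"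
      unfolding mult.assoc Dj_def by (rule nn_integral_cmult) measurable
    also have "\<dots> \<le> ennreal (a powr (- r)) * ennreal (\<kappa> * a powr r * v j)"
      using avg[OF j] by (intro mult_left_mono) (auto simp: Dj_def vol_def v_def)
    also have "\<dots> = ennreal (\<kappa> * v j)"
      using a \<kappa> vpos[of j] by (subst ennreal_mult[symmetric]) (auto simp: powr_minus)
    also have "ennreal a * (ennreal (1 * (dil_ratio TYPE('n) * vol L (j, index L j z))) + ennreal (\<kappa> * v j))
       = ennreal (a * (dil_ratio TYPE('n) + \<kappa>) * v j)"
      using a \<kappa> vpos[of j] dil_ratio_ge[where 'n='n]
      by (simp add: vol_def v_def[symmetric] ennreal_plus[symmetric] ennreal_mult[symmetric] algebra_simps del: ennreal_plus)
    finally show ?thesis by (simp add: mult_left_mono add_left_mono)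
  qed
  have "(\<integral>\<^sup>+y. ennreal (cmod (K x y - K x' y) * cmod (restr (Dj k0 - Dj k) f y)) \<partial>lebesgue)
    \<le> (\<integral>\<^sup>+y. (\<Sum>j\<in>{k0..<k}. ennreal (w j) * (ennreal (cmod (f y)) * indicator (Dj j) y)) \<partial>lebesgue)"
  proof (rule nn_integral_mono)
    fix y
    show "ennreal (cmod (K x y - K x' y) * cmod (restr (Dj k0 - Dj k) f y))
      \<le> (\<Sum>j\<in>{k0..<k}. ennreal (w j) * (ennreal (cmod (f y)) * indicator (Dj j) y))"
    proof (cases "y \<in> Dj k0 - Dj k")
      case True
      \<comment> \<open>The first ancestor dilate that \<open>y\<close> has left. It is not the one
        of generation \<open>k0\<close>, so a predecessor \<open>i\<close> exists, and
        \<open>y\<close> lies in the shell between \<open>i\<close> and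
        \<open>Suc i\<close>.\<close>
      define j where "j = (LEAST j. j \<ge> k0 \<and> y \<notin> Dj j)"
      have ex: "k \<ge> k0 \<and> y \<notin> Dj k" using True k by simp
      have j: "j \<ge> k0 \<and> y \<notin> Dj j" "j \<le> k"
        unfolding j_def using LeastI[of "\<lambda>j. j \<ge> k0 \<and> y \<notin> Dj j" k, OF ex] Least_le[of "\<lambda>j. j \<ge> k0 \<and> y \<notin> Dj j" k, OF ex]
        by simp_all
      have "j \<noteq> k0" using j True by auto
      then obtain i where i: "j = Suc i" "k0 \<le> i" using j by (cases j) auto
      have "\<not> (i \<ge> k0 \<and> y \<notin> Dj i)" using i not_less_Least[of i "\<lambda>j. j \<ge> k0 \<and> y \<notin> Dj j"] by (simp add: j_def)
      then have yi: "y \<in> Dj i" using i by simp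
      have ik: "i \<in> {k0..<k}" using i j by simp
      have "ennreal (cmod (K x y - K x' y) * cmod (restr (Dj k0 - Dj k) f y)) \<le> ennreal (w i * cmod (f y))"
        using True kern[of i y] i j by (intro ennreal_leI mult_mono) (auto simp: restr_def w)
      also have "\<dots> = ennreal (w i) * (ennreal (cmod (f y)) * indicator (Dj i) y)"
        using yi w by (simp add: ennreal_mult)
      also have "\<dots> \<le> (\<Sum>j\<in>{k0..<k}. ennreal (w j) * (ennreal (cmod (f y)) * indicator (Dj j) y))"
        using ik by (intro member_le_sum) auto
      finally show ?thesis .
    qed (simp add: restr_def)
  qed
  also have "\<dots> = (\<Sum>j\<in>{k0..<k}. ennreal (w j) * (\<integral>\<^sup>+y\<in>Dj j. ennreal (cmod (f y)) \<partial>lebesgue))"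
    unfolding Dj_def by (subst nn_integral_sum) (auto simp: nn_integral_cmult)
  also have "\<dots> \<le> (\<Sum>j\<in>{k0..<k}. ennreal (C * (dil_ratio TYPE('n) + \<kappa>) * a * \<theta> ^ (k - Suc j)))"
  proof (rule sum_mono)
    fix j assume j: "j \<in> {k0..<k}"
    have "ennreal (w j) * (\<integral>\<^sup>+y\<in>Dj j. ennreal (cmod (f y)) \<partial>lebesgue) \<le> ennreal (w j) * ennreal (a * (dil_ratio TYPE('n) + \<kappa>) * v j)"
      using j by (intro mult_left_mono int1) auto
    also have "\<dots> = ennreal (C * (dil_ratio TYPE('n) + \<kappa>) * a * \<theta> ^ (k - Suc j))"
      using w[of j] a \<kappa> vpos[of j] dil_ratio_ge[where 'n='n]
      by (subst ennreal_mult[symmetric]) (auto simp: w_def mult_ac)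
    finally show "ennreal (w j) * (\<integral>\<^sup>+y\<in>Dj j. ennreal (cmod (f y)) \<partial>lebesgue) \<le> \<dots>" .
  qed
  also have "\<dots> = ennreal (C * (dil_ratio TYPE('n) + \<kappa>) * a * (\<Sum>j\<in>{k0..<k}. \<theta> ^ (k - Suc j)))"
    using C a \<kappa> \<theta> dil_ratio_ge[where 'n='n] by (subst sum_ennreal) (auto simp: sum_distrib_left)
  also have "\<dots> \<le> ennreal (C * (dil_ratio TYPE('n) + \<kappa>) * a * (1 / (1 - \<theta>)))"
  proof (intro ennreal_leI mult_left_mono)
    have "(\<Sum>j\<in>{k0..<k}. \<theta> ^ (k - Suc j)) = (\<Sum>i\<in>(\<lambda>j. k - Suc j) ` {k0..<k}. \<theta> ^ i)"
      by (subst sum.reindex) (auto simp: inj_on_def)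
    also have "\<dots> \<le> (\<Sum>i. \<theta> ^ i)"
      using \<theta> by (intro sum_le_suminf summable_geometric) auto
    also have "\<dots> = 1 / (1 - \<theta>)" using \<theta> by (intro suminf_geometric) auto
    finally show "(\<Sum>j\<in>{k0..<k}. \<theta> ^ (k - Suc j)) \<le> 1 / (1 - \<theta>)" .
  qed (use C a \<kappa> dil_ratio_ge[where 'n='n] in auto)
  also have "C * (dil_ratio TYPE('n) + \<kappa>) * a * (1 / (1 - \<theta>)) = Ctail \<kappa> * a"
    by (simp add: Ctail_def C_def n_def \<theta>_def)
  finally show ?thesis by (simp add: Dj_def)
qed

section \<open>Stopping cubes\<close>

definition lavg :: "real \<Rightarrow> (real^'n \<Rightarrow> complex) \<Rightarrow> nat \<times> (int^'n) \<Rightarrow> real" where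
  "lavg L f q = (enn2real (\<integral>\<^sup>+y\<in>dil L q. ennreal (cmod (f y) powr r) \<partial>lebesgue) / vol L q) powr (1 / r)"

lemma lavg_nonneg: "lavg L f q \<ge> 0"
  by (simp add: lavg_def)

text \<open>Finiteness matters because \<open>enn2real\<close> sends an infinite integral to 0. The
  average is normalised by the cube and not by its dilate, in agreement with the hypothesis of
  \<open>orlicz_bump\<close>.\<close>

lemma lavg:
  assumes "L > 0" "(\<integral>\<^sup>+y\<in>dil L q. ennreal (cmod (f y) powr r) \<partial>lebesgue) < \<infinity>"
  shows "ennreal (lavg L f q powr r * vol L q) = (\<integral>\<^sup>+y\<in>dil L q. ennreal (cmod (f y) powr r) \<partial>lebesgue)"
proof -
  have "lavg L f q powr r = enn2real (\<integral>\<^sup>+y\<in>dil L q. ennreal (cmod (f y) powr r) \<partial>lebesgue) / vol L q"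
    using r vol_pos[OF assms(1), of q] by (simp add: lavg_def powr_powr)
  then show ?thesis using vol_pos[OF assms(1), of q] assms(2) by simp
qed

lemma nn_integral_restr:
  "(\<integral>\<^sup>+y. ennreal (cmod (restr S f y) powr r) \<partial>lebesgue) = (\<integral>\<^sup>+y\<in>S. ennreal (cmod (f y) powr r) \<partial>lebesgue)"
  by (intro nn_integral_cong) (auto simp: restr_def indicator_def)

text \<open>With V the Vitali constant: \<open>\<kappa>0\<close> gives V / \<open>\<kappa>0\<close>
  at most 1/4, so cubes with large averages fill at most a quarter of \<open>q\<close>;
  \<open>\<epsilon>0\<close> does the same for cubes meeting the exceptional set, and also keeps the
  density of that set in \<open>q\<close> itself below the stopping threshold. \<open>C1\<close> is
  the level at which the weak bound on \<open>q\<close> leaves measure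
  \<open>\<epsilon>0 / 2\<close> per unit, and \<open>C2\<close> the level at which the weak bound
  on a stopping cube leaves a quarter of it.\<close>

definition \<kappa>0 :: real where "\<kappa>0 = 4 * Vitali_const TYPE('n) + 1"
definition \<epsilon>0 :: real where "\<epsilon>0 = 1 / (2 ^ (CARD('n) + 3) * (Vitali_const TYPE('n) + 1))"
definition C1 :: real where "C1 = N * (2 / \<epsilon>0) powr (1 / r)"
definition C2 :: real where "C2 = N * (4 * \<kappa>0 * 2 ^ CARD('n)) powr (1 / r)"
definition C0 :: real where "C0 = C1 + C2 + Ctail \<kappa>0 + 1"

lemma const_pos: "\<kappa>0 \<ge> 1" "\<epsilon>0 > 0" "C1 > 0" "C2 > 0" "Ctail \<kappa>0 \<ge> 0" "C0 > 0"
proof -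
  show 1: "\<kappa>0 \<ge> 1" "\<epsilon>0 > 0" using Vitali_const_pos[where 'n='n] by (simp_all add: \<kappa>0_def \<epsilon>0_def)
  then show 2: "C1 > 0" "C2 > 0" using N by (simp_all add: C1_def C2_def)
  have "(2::real) powr (- \<delta>) < 1" using \<delta> powr_less_mono[of "- \<delta>" 0 2] by simp
  then show "Ctail \<kappa>0 \<ge> 0"
    using cK dil_ratio_ge[where 'n='n] 1 unfolding Ctail_def by (intro mult_nonneg_nonneg) auto
  with 2 show "C0 > 0" by (simp add: C0_def)
qed

text \<open>One step of the recursion. The bound off the children is almost everywhere because for a
  zero average only almost everywhere vanishing is available; the bound on the children holds at
  every point.\<close>

definition stopping_family ::
  "real \<Rightarrow> (real^'n \<Rightarrow> complex) \<Rightarrow> nat \<times> (int^'n) \<Rightarrow> (nat \<times> (int^'n)) set \<Rightarrow> bool" where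
  "stopping_family L f q ch \<longleftrightarrow> disjoint_family_on (dcube L) ch \<and> (\<forall>P\<in>ch. dcube L P \<subseteq> dcube L q) \<and>
     emeasure lebesgue (\<Union>P\<in>ch. dcube L P) \<le> ennreal (vol L q / 2) \<and>
     (AE x in lebesgue. x \<in> dcube L q - (\<Union>P\<in>ch. dcube L P) \<longrightarrow> M (restr (dil L q) f) x \<le> ennreal (C0 * lavg L f q)) \<and>
     (\<forall>P\<in>ch. \<forall>x\<in>dcube L P. M (restr (dil L q) f) x \<le> ennreal (C0 * lavg L f q) + M (restr (dil L P) f) x)"

text \<open>The children are the maximal dyadic cubes on which either the average of
  \<open>|f|\<close> to the power \<open>r\<close> has grown too much or the exceptional set is too
  dense. Both events are rare by \<open>Vitali_dil\<close>. Maximality gives good averages on all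
  proper ancestors, and a good point in each child from which the bound on the far part spreads by
  kernel regularity.\<close>

lemma stopping_family_if_lavg_pos:
  fixes q :: "nat \<times> (int^'n)"
  assumes L: "L > 0" and f: "f \<in> D"
    and fin: "\<And>P. (\<integral>\<^sup>+y\<in>dil L P. ennreal (cmod (f y) powr r) \<partial>lebesgue) < \<infinity>"
    and a: "lavg L f q > 0"
  shows "\<exists>ch. stopping_family L f q ch"
proof -
  define a where "a = lavg L f q"
  have a: "a > 0" using assms by (simp add: a_def)
  note [measurable] = D_measurable[OF f]
  define V where "V = Vitali_const TYPE('n)"
  have V: "V > 0" using Vitali_const_pos[where 'n='n] by (simp add: V_def)
  define k0 where "k0 = fst q"
  have q_idx: "q = (k0, index L k0 x)" if "x \<in> dcube L q" for x
    using that mem_dcube_iff[OF L, of x k0 "snd q"] by (simp add: k0_def prod_eq_iff)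
  define F where "F y = ennreal (cmod (f y) powr r)" for y
  have [measurable]: "F \<in> borel_measurable lebesgue" unfolding F_def by measurable
  have Fq: "(\<integral>\<^sup>+y\<in>dil L q. F y \<partial>lebesgue) = ennreal (a powr r * vol L q)"
    using lavg[OF L fin, of q] by (simp add: F_def a_def)
  define g0 where "g0 = restr (dil L q) f"
  have g0: "g0 \<in> D" unfolding g0_def by (rule D_restr[OF f]) measurable
  have g0X: "(\<integral>\<^sup>+y. ennreal (cmod (g0 y) powr r) \<partial>lebesgue) = ennreal (a powr r * vol L q)"
    unfolding g0_def nn_integral_restr using Fq by (simp add: F_def)
  have vq: "vol L q > 0" by (rule vol_pos[OF L])
  note cpos = const_pos
  note wt0 = weak_type[OF g0 g0X]
  have nnX: "0 \<le> a powr r * vol L q" using vq by simp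
  have [measurable]: "M g0 \<in> borel_measurable lebesgue" by (rule wt0(1)[OF nnX])
  define E where "E = {x. M g0 x > ennreal (C1 * a)}"
  have E [measurable]: "E \<in> sets lebesgue"
  proof -
    have "{x \<in> space lebesgue. M g0 x > ennreal (C1 * a)} \<in> sets lebesgue" by measurable
    then show ?thesis by (simp add: E_def)
  qed
  have Em: "emeasure lebesgue E \<le> ennreal (\<epsilon>0 / 2 * vol L q)"
  proof -
    have "emeasure lebesgue E \<le> ennreal ((N / (C1 * a)) powr r * (a powr r * vol L q))"
      unfolding E_def using cpos a by (intro wt0(2)[OF nnX]) simp
    also have "(N / (C1 * a)) powr r * (a powr r * vol L q) = \<epsilon>0 / 2 * vol L q"
    proof -
      have "N / (C1 * a) = 1 / ((2 / \<epsilon>0) powr (1 / r) * a)" using N by (simp add: C1_def)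
      moreover have "(1 / ((2 / \<epsilon>0) powr (1 / r) * a)) powr r = 1 / ((2 / \<epsilon>0) * a powr r)"
        using cpos a r by (simp add: powr_divide powr_mult powr_powr)
      ultimately show ?thesis using a by simp
    qed
    finally show ?thesis .
  qed
  (* Stopping on an open superset U of E rather than on E itself: every point of U lies in a small
     dyadic cube contained in U, so no Lebesgue differentiation is needed. *)
  obtain U where U: "open U" "E \<subseteq> U" "emeasure lebesgue U \<le> ennreal (\<epsilon>0 * vol L q)"
  proof -
    have "\<epsilon>0 / 2 * vol L q > 0" using cpos vq by simp
    from sets_lebesgue_outer_open[OF E this] obtain U where U: "open U" "E \<subseteq> U" "U - E \<in> lmeasurable"
      "emeasure lebesgue (U - E) < ennreal (\<epsilon>0 / 2 * vol L q)" .
    have "emeasure lebesgue U = emeasure lebesgue (E \<union> (U - E))" using U by (simp add: Un_absorb1)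
    also have "\<dots> \<le> emeasure lebesgue E + emeasure lebesgue (U - E)"
      using U by (intro emeasure_subadditive) auto
    also have "\<dots> \<le> ennreal (\<epsilon>0 / 2 * vol L q) + ennreal (\<epsilon>0 / 2 * vol L q)"
      using Em U by (intro add_mono) auto
    also have "\<dots> = ennreal (\<epsilon>0 * vol L q)"
      using cpos vq by (simp add: ennreal_plus[symmetric] del: ennreal_plus)
    finally show ?thesis using that U by blast
  qed
  have [measurable]: "U \<in> sets lebesgue" using U(1) by simp
  \<comment> \<open>\<open>s1\<close> keeps averages bounded along ancestors. The density in
    \<open>s2\<close> is half of 2 to the power \<open>- CARD('n)\<close>, so that a child of a cube
    which fails \<open>s2\<close> is at most half filled by \<open>U\<close>.\<close>
  define s1 where "s1 P \<longleftrightarrow> (\<integral>\<^sup>+y\<in>dil L P. F y \<partial>lebesgue) > ennreal (\<kappa>0 * a powr r * vol L P)" for P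
  define s2 where "s2 P \<longleftrightarrow> emeasure lebesgue (dcube L P \<inter> U) > ennreal (vol L P / 2 ^ (CARD('n) + 1))" for P
  \<comment> \<open>Only generations strictly below that of \<open>q\<close> are tested;
    \<open>q\<close> itself is treated by the choice of \<open>\<kappa>0\<close> and
    \<open>\<epsilon>0\<close>.\<close>
  define tm where "tm x k \<longleftrightarrow> k > k0 \<and> (s1 (k, index L k x) \<or> s2 (k, index L k x))" for x k
  define ch where "ch = {(k, index L k x) |x k. x \<in> dcube L q \<and> tm x k \<and> (\<forall>j<k. \<not> tm x j)}"
  have sub: "dcube L (k, index L k x) \<subseteq> dcube L q" "dil L (k, index L k x) \<subseteq> dil L q"
    if "x \<in> dcube L q" "k0 \<le> k" for x k
    using dcube_mono[OF L that(2), of x] dil_anc_subset[OF L that(2), of x] q_idx[OF that(1)] by auto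
  have ch_disj: "disjoint_family_on (dcube L) ch"
    unfolding disjoint_family_on_def
  proof (intro ballI impI, rule ccontr)
    fix P P' assume P: "P \<in> ch" "P' \<in> ch" "P \<noteq> P'" and ne: "dcube L P \<inter> dcube L P' \<noteq> {}"
    obtain x k where x: "P = (k, index L k x)" "tm x k" "\<forall>j<k. \<not> tm x j" using P(1) by (auto simp: ch_def)
    obtain x' k' where x': "P' = (k', index L k' x')" "tm x' k'" "\<forall>j<k'. \<not> tm x' j" using P(2) by (auto simp: ch_def)
    obtain z where z: "z \<in> dcube L P" "z \<in> dcube L P'" using ne by blast
    have zi: "index L k x = index L k z" "index L k' x' = index L k' z"
      using z by (auto simp: x(1) x'(1) mem_dcube_iff[OF L])
    \<comment> \<open>Whether a generation stops depends only on the cube of that generation, so a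
      common point sees the stopping history of both cubes.\<close>
    have t: "tm z j \<longleftrightarrow> tm x j" if "j \<le> k" for j
      using index_coarser[OF L that zi(1)] by (simp add: tm_def)
    have t': "tm z j \<longleftrightarrow> tm x' j" if "j \<le> k'" for j
      using index_coarser[OF L that zi(2)] by (simp add: tm_def)
    have "\<not> k < k'" using t[of k] t'[of k] x(2) x'(3) by auto
    moreover have "\<not> k' < k" using t[of k'] t'[of k'] x'(2) x(3) by auto
    ultimately have "k = k'" by simp
    then show False using P(3) zi by (simp add: x(1) x'(1))
  qed
  have ch_sub: "dcube L P \<subseteq> dcube L q" "dil L P \<subseteq> dil L q" if P: "P \<in> ch" for P
  proof -
    obtain x k where "P = (k, index L k x)" "x \<in> dcube L q" "k0 \<le> k"
      using P by (auto simp: ch_def tm_def less_imp_le)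
    with sub show "dcube L P \<subseteq> dcube L q" "dil L P \<subseteq> dil L q" by simp_all
  qed
  \<comment> \<open>Restricting to dilates inside \<open>dil L q\<close> lets the covering estimate
    be fed with the mass of \<open>f\<close> on \<open>dil L q\<close> alone.\<close>
  define G1 where "G1 = {P. s1 P \<and> dil L P \<subseteq> dil L q}"
  define G2 where "G2 = {P. s2 P}"
  have ch_cover: "(\<Union>P\<in>ch. dcube L P) \<subseteq> (\<Union>P\<in>G1. dcube L P) \<union> (\<Union>P\<in>G2. dcube L P)"
  proof -
    have "P \<in> G1 \<or> P \<in> G2" if P: "P \<in> ch" for P
      using P ch_sub(2)[OF P] by (auto simp: ch_def tm_def G1_def G2_def)
    then show ?thesis by blast
  qed
  have cancel: "ennreal v \<le> ennreal (1 / c) * X" if "ennreal (c * v) \<le> X" "c > 0" "v \<ge> 0" for c v X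
  proof -
    have "ennreal v = ennreal (1 / c) * ennreal (c * v)"
      using that by (subst ennreal_mult[symmetric]) auto
    also have "\<dots> \<le> ennreal (1 / c) * X" using that by (intro mult_left_mono) auto
    finally show ?thesis .
  qed
  have G1m: "emeasure lebesgue (\<Union>P\<in>G1. dcube L P) \<le> ennreal (vol L q / 4)"
  proof -
    let ?c = "\<kappa>0 * a powr r"
    have c: "?c > 0" using cpos a by simp
    have "emeasure lebesgue (\<Union>P\<in>G1. dcube L P) \<le> ennreal V * (\<integral>\<^sup>+y. ennreal (1 / ?c) * (F y * indicator (dil L q) y) \<partial>lebesgue)"
      unfolding V_def
    proof (rule Vitali_dil[OF L])
      fix P assume P: "P \<in> G1"
      have "ennreal (?c * vol L P) \<le> (\<integral>\<^sup>+y\<in>dil L P. F y \<partial>lebesgue)"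
        using P by (simp add: G1_def s1_def less_imp_le)
      then have "ennreal (vol L P) \<le> ennreal (1 / ?c) * (\<integral>\<^sup>+y\<in>dil L P. F y \<partial>lebesgue)"
        using c vol_pos[OF L, of P] by (intro cancel) auto
      also have "\<dots> = (\<integral>\<^sup>+y. ennreal (1 / ?c) * (F y * indicator (dil L P) y) \<partial>lebesgue)"
        by (rule nn_integral_cmult[symmetric]) measurable
      also have "\<dots> = (\<integral>\<^sup>+y\<in>dil L P. ennreal (1 / ?c) * (F y * indicator (dil L q) y) \<partial>lebesgue)"
        using P by (intro nn_integral_cong) (auto simp: G1_def indicator_def)
      finally show "ennreal (vol L P) \<le> \<dots>" .
    qed measurable
    also have "(\<integral>\<^sup>+y. ennreal (1 / ?c) * (F y * indicator (dil L q) y) \<partial>lebesgue) = ennreal (1 / ?c) * ennreal (a powr r * vol L q)"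
      unfolding Fq[symmetric] by (rule nn_integral_cmult) measurable
    also have "ennreal V * \<dots> = ennreal (V / \<kappa>0 * vol L q)"
      using V c a vq cpos by (simp add: ennreal_mult[symmetric])
    also have "\<dots> \<le> ennreal (vol L q / 4)"
    proof (rule ennreal_leI)
      have "V / \<kappa>0 \<le> 1 / 4" using V by (simp add: \<kappa>0_def V_def[symmetric] field_simps)
      from mult_right_mono[OF this, of "vol L q"] show "V / \<kappa>0 * vol L q \<le> vol L q / 4" using vq by simp
    qed
    finally show ?thesis .
  qed
  have G2m: "emeasure lebesgue (\<Union>P\<in>G2. dcube L P) \<le> ennreal (vol L q / 4)"
  proof -
    let ?c = "1 / 2 ^ (CARD('n) + 1) :: real"
    have "emeasure lebesgue (\<Union>P\<in>G2. dcube L P) \<le> ennreal V * (\<integral>\<^sup>+y. ennreal (1 / ?c) * indicator U y \<partial>lebesgue)"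
      unfolding V_def
    proof (rule Vitali_dil[OF L])
      fix P assume P: "P \<in> G2"
      have "ennreal (?c * vol L P) \<le> emeasure lebesgue (dcube L P \<inter> U)"
        using P by (simp add: G2_def s2_def less_imp_le)
      also have "\<dots> \<le> emeasure lebesgue (dil L P \<inter> U)"
        using dcube_subset_dil[OF L, of P] by (intro emeasure_mono) auto
      finally have "ennreal (vol L P) \<le> ennreal (1 / ?c) * emeasure lebesgue (dil L P \<inter> U)"
        using vol_pos[OF L, of P] by (intro cancel) auto
      also have "\<dots> = (\<integral>\<^sup>+y. ennreal (1 / ?c) * indicator (dil L P \<inter> U) y \<partial>lebesgue)"
        by (rule nn_integral_cmult_indicator[symmetric]) measurable
      also have "\<dots> = (\<integral>\<^sup>+y\<in>dil L P. ennreal (1 / ?c) * indicator U y \<partial>lebesgue)"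
        by (intro nn_integral_cong) (auto simp: indicator_def)
      finally show "ennreal (vol L P) \<le> \<dots>" .
    qed measurable
    also have "(\<integral>\<^sup>+y. ennreal (1 / ?c) * indicator U y \<partial>lebesgue) = ennreal (1 / ?c) * emeasure lebesgue U"
      by (rule nn_integral_cmult_indicator) measurable
    also have "ennreal V * \<dots> \<le> ennreal V * (ennreal (1 / ?c) * ennreal (\<epsilon>0 * vol L q))"
      using U by (intro mult_left_mono) auto
    also have "\<dots> = ennreal (V * (1 / ?c * (\<epsilon>0 * vol L q)))"
      using V vq cpos by (simp add: ennreal_mult)
    also have "\<dots> \<le> ennreal (vol L q / 4)"
    proof (rule ennreal_leI)
      have "(2::real) ^ (CARD('n) + 3) = 2 ^ (CARD('n) + 1) * 4" by (simp add: power_add)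
      then have "1 / ?c * \<epsilon>0 = 1 / (4 * (V + 1))"
        by (simp add: \<epsilon>0_def V_def[symmetric]) (use V in \<open>simp add: frac_eq_eq\<close>)
      then have "V * (1 / ?c * \<epsilon>0) = V / (4 * (V + 1))" by (simp only: times_divide_eq_right mult_1_right)
      also have "\<dots> \<le> 1 / 4" using V by (simp add: field_simps)
      finally have "V * (1 / ?c * \<epsilon>0) \<le> 1 / 4" .
      from mult_right_mono[OF this, of "vol L q"] show "V * (1 / ?c * (\<epsilon>0 * vol L q)) \<le> vol L q / 4"
        using vq by (simp add: mult_ac)
    qed
    finally show ?thesis .
  qed
  have ch_m: "emeasure lebesgue (\<Union>P\<in>ch. dcube L P) \<le> ennreal (vol L q / 2)"
  proof -
    have m: "(\<Union>P\<in>G. dcube L P) \<in> sets lebesgue" for G :: "(nat \<times> (int^'n)) set"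
      by (intro sets.countable_UN') auto
    have "emeasure lebesgue (\<Union>P\<in>ch. dcube L P) \<le> emeasure lebesgue ((\<Union>P\<in>G1. dcube L P) \<union> (\<Union>P\<in>G2. dcube L P))"
      using ch_cover m by (intro emeasure_mono) auto
    also have "\<dots> \<le> emeasure lebesgue (\<Union>P\<in>G1. dcube L P) + emeasure lebesgue (\<Union>P\<in>G2. dcube L P)"
      using m by (intro emeasure_subadditive)
    also have "\<dots> \<le> ennreal (vol L q / 4) + ennreal (vol L q / 4)"
      by (intro add_mono G1m G2m)
    also have "\<dots> = ennreal (vol L q / 2)"
      using vq by (simp add: ennreal_plus[symmetric] del: ennreal_plus)
    finally show ?thesis .
  qed
  have off: "M g0 x \<le> ennreal (C1 * a)" if x: "x \<in> dcube L q" "x \<notin> (\<Union>P\<in>ch. dcube L P)" for x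
  proof -
    have no: "\<not> tm x k" for k
    proof
      assume k: "tm x k"
      define j where "j = (LEAST j. tm x j)"
      have "tm x j" "\<forall>i<j. \<not> tm x i" unfolding j_def using k by (auto intro: LeastI dest: not_less_Least)
      then have "(j, index L j x) \<in> ch" using x(1) by (auto simp: ch_def)
      then show False using x(2) index_mem[OF L, of x j] by blast
    qed
    have "x \<notin> U"
    proof
      assume "x \<in> U"
      then obtain d where d: "d > 0" "ball x d \<subseteq> U" using U(1) by (auto simp: open_contains_ball)
      obtain k1 :: nat where k1: "real CARD('n) * (2 * L) / d < 2 ^ k1"
        using real_arch_pow[of 2 "real CARD('n) * (2 * L) / d"] by auto
      define k where "k = Suc (k0 + k1)"
      have "real CARD('n) * (2 * L) / d < 2 ^ k"
      proof -
        have "(2::real) ^ k1 \<le> 2 ^ k" unfolding k_def by (intro power_increasing) auto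
        with k1 show ?thesis by linarith
      qed
      then have kd: "real CARD('n) * side L k < d" using d by (simp add: side_def field_simps)
      have "dcube L (k, index L k x) \<subseteq> U"
      proof
        fix y assume y: "y \<in> dcube L (k, index L k x)"
        have "norm (x - y) < d" using norm_diff_dcube[OF L index_mem[OF L] y] kd by simp
        then show "y \<in> U" using d(2) by (auto simp: dist_norm)
      qed
      then have "emeasure lebesgue (dcube L (k, index L k x) \<inter> U) = ennreal (vol L (k, index L k x))"
        by (simp add: Int_absorb2 emeasure_dcube[OF L] del: emeasure_completion)
      moreover have "vol L (k, index L k x) / 2 ^ (CARD('n) + 1) < vol L (k, index L k x)"
      proof -
        have "(1::real) < 2 ^ (CARD('n) + 1)" by (intro one_less_power) auto
        then show ?thesis using vol_pos[OF L, of "(k, index L k x)"] by (simp add: field_simps)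
      qed
      ultimately have "s2 (k, index L k x)"
        using vol_pos[OF L, of "(k, index L k x)"] unfolding s2_def by (simp add: ennreal_lessI)
      then have "tm x k" by (simp add: tm_def k_def)
      with no show False by blast
    qed
    then have "x \<notin> E" using U(2) by blast
    then show ?thesis by (simp add: E_def not_less)
  qed
  have on: "M g0 x \<le> ennreal (C0 * a) + M (restr (dil L P) f) x" if P: "P \<in> ch" and x: "x \<in> dcube L P" for P x
  proof -
    obtain z k where z: "P = (k, index L k z)" "z \<in> dcube L q" "tm z k" "\<And>j. j < k \<Longrightarrow> \<not> tm z j"
      using P by (auto simp: ch_def)
    have k: "k0 < k" using z by (simp add: tm_def)
    have avg: "(\<integral>\<^sup>+y\<in>dil L (j, index L j z). F y \<partial>lebesgue) \<le> ennreal (\<kappa>0 * a powr r * vol L (j, index L j z))"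
      if j: "k0 \<le> j" "j < k" for j
    \<comment> \<open>Generation \<open>k0\<close> is never tested, but there the integral is
      exactly \<open>a powr r * vol L q\<close>, and \<open>\<kappa>0\<close> is at least 1.\<close>
    proof (cases "j = k0")
      case True
      have "a powr r * vol L q \<le> \<kappa>0 * a powr r * vol L q"
        using cpos vq a mult_right_mono[OF cpos(1), of "a powr r * vol L q"] by simp
      then show ?thesis using Fq q_idx[OF z(2)] True by (simp add: ennreal_leI)
    next
      case False
      then have "\<not> s1 (j, index L j z)" using z(4)[OF j(2)] j by (auto simp: tm_def)
      then show ?thesis by (simp add: s1_def not_less)
    qed
    obtain k' where k': "k = Suc k'" "k0 \<le> k'" using k by (cases k) auto
    define R where "R = (k', index L k' z)"
    have kk: "k' \<le> k" using k' by simp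
    have vR: "vol L R = 2 ^ CARD('n) * vol L P"
      using vol_anc[OF L kk, of "index L k' z" "index L k z"] by (simp add: R_def z(1) k'(1))
    have vP: "vol L P > 0" by (rule vol_pos[OF L])
    (* P is maximal, so its parent R does not stop. *)
    have PU: "emeasure lebesgue (dcube L P \<inter> U) \<le> ennreal (vol L P / 2)"
    proof -
      have "emeasure lebesgue (dcube L P \<inter> U) \<le> emeasure lebesgue (dcube L R \<inter> U)"
        using dcube_mono[OF L kk, of z] by (intro emeasure_mono) (auto simp: R_def z(1))
      also have "\<dots> \<le> ennreal (vol L R / 2 ^ (CARD('n) + 1))"
      \<comment> \<open>If the parent is \<open>q\<close>, the density bound comes from the measure
        of the whole of \<open>U\<close>; otherwise from the failure of \<open>s2\<close>.\<close>
      proof (cases "k' = k0")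
        case True
        then have Rq: "R = q" using q_idx[OF z(2)] by (simp add: R_def)
        have "emeasure lebesgue (dcube L R \<inter> U) \<le> emeasure lebesgue U" by (intro emeasure_mono) auto
        also have "\<dots> \<le> ennreal (\<epsilon>0 * vol L q)" by (rule U(3))
        also have "\<dots> \<le> ennreal (vol L q / 2 ^ (CARD('n) + 1))"
        proof (rule ennreal_leI)
          have "\<epsilon>0 \<le> 1 / 2 ^ (CARD('n) + 1)"
          proof -
            have "(2::real) ^ (CARD('n) + 1) * 1 \<le> 2 ^ (CARD('n) + 3) * (V + 1)"
              using V by (intro mult_mono power_increasing) auto
            then show ?thesis unfolding \<epsilon>0_def V_def[symmetric] using V by (intro divide_left_mono) auto
          qed
          from mult_right_mono[OF this, of "vol L q"] show "\<epsilon>0 * vol L q \<le> vol L q / 2 ^ (CARD('n) + 1)"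
            using vq by simp
        qed
        finally show ?thesis by (simp add: Rq)
      next
        case False
        then have "\<not> s2 R" using z(4)[of k'] k' by (auto simp: tm_def R_def)
        then show ?thesis by (simp add: s2_def not_less)
      qed
      also have "vol L R / 2 ^ (CARD('n) + 1) = vol L P / 2" by (simp add: vR power_add)
      finally show ?thesis .
    qed
    let ?gP = "restr (dil L P) f"
    have gP: "?gP \<in> D" by (rule D_restr[OF f]) measurable
    define X where "X = enn2real (\<integral>\<^sup>+y\<in>dil L P. F y \<partial>lebesgue)"
    have X: "(\<integral>\<^sup>+y\<in>dil L P. F y \<partial>lebesgue) = ennreal X" "X \<ge> 0"
      using fin[of P] by (auto simp: X_def F_def)
    \<comment> \<open>\<open>P\<close> may itself have a large average, so its mass is bounded by
      that of its parent, at the price of the volume ratio; this ratio enters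
      \<open>C2\<close>.\<close>
    have XP: "X \<le> \<kappa>0 * a powr r * (2 ^ CARD('n) * vol L P)"
    proof -
      have "ennreal X \<le> (\<integral>\<^sup>+y\<in>dil L R. F y \<partial>lebesgue)"
        unfolding X(1)[symmetric] using dil_anc_subset[OF L kk, of z]
        by (intro nn_integral_mono) (auto simp: R_def z(1) indicator_def)
      also have "\<dots> \<le> ennreal (\<kappa>0 * a powr r * vol L R)" using avg[of k'] k' by (simp add: R_def)
      finally show ?thesis using cpos a vP by (subst (asm) ennreal_le_iff) (auto simp: vR)
    qed
    have gX: "(\<integral>\<^sup>+y. ennreal (cmod (?gP y) powr r) \<partial>lebesgue) = ennreal X"
      unfolding nn_integral_restr using X by (simp add: F_def)
    have [measurable]: "M ?gP \<in> borel_measurable lebesgue" by (rule weak_type(1)[OF gP gX X(2)])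
    define X2 where "X2 = {x. M ?gP x > ennreal (C2 * a)}"
    have [measurable]: "X2 \<in> sets lebesgue"
    proof -
      have "{x \<in> space lebesgue. M ?gP x > ennreal (C2 * a)} \<in> sets lebesgue" by measurable
      then show ?thesis by (simp add: X2_def)
    qed
    have X2m: "emeasure lebesgue X2 \<le> ennreal (vol L P / 4)"
    proof -
      have "emeasure lebesgue X2 \<le> ennreal ((N / (C2 * a)) powr r * X)"
        unfolding X2_def using cpos a by (intro weak_type(2)[OF gP gX X(2)]) simp
      also have "\<dots> \<le> ennreal ((N / (C2 * a)) powr r * (\<kappa>0 * a powr r * (2 ^ CARD('n) * vol L P)))"
        using XP by (intro ennreal_leI mult_left_mono) auto
      also have "(N / (C2 * a)) powr r * (\<kappa>0 * a powr r * (2 ^ CARD('n) * vol L P)) = vol L P / 4"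
      proof -
        let ?w = "4 * \<kappa>0 * 2 ^ CARD('n)"
        have w: "?w > 0" using cpos by simp
        have "N / (C2 * a) = 1 / (?w powr (1 / r) * a)" using N by (simp add: C2_def)
        moreover have "(1 / (?w powr (1 / r) * a)) powr r = 1 / (?w * a powr r)"
        proof -
          have "(?w powr (1 / r)) powr r = ?w" using w r by (simp add: powr_powr)
          then show ?thesis using a by (subst powr_divide) (auto simp: powr_mult)
        qed
        ultimately have "(N / (C2 * a)) powr r = 1 / (?w * a powr r)" by simp
        then show ?thesis using a cpos by simp
      qed
      finally show ?thesis .
    qed
    (* The two exceptional sets fill at most 3/4 of P, and a single good point x' suffices:
       kernel smoothness transports the bound from x' to all of P. *)
    obtain x' where x': "x' \<in> dcube L P" "x' \<notin> U" "x' \<notin> X2"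
    proof (rule ccontr)
      assume "\<not> thesis"
      then have "dcube L P \<subseteq> (dcube L P \<inter> U) \<union> X2" using that by blast
      then have "emeasure lebesgue (dcube L P) \<le> emeasure lebesgue ((dcube L P \<inter> U) \<union> X2)"
        by (intro emeasure_mono) auto
      also have "\<dots> \<le> emeasure lebesgue (dcube L P \<inter> U) + emeasure lebesgue X2"
        by (intro emeasure_subadditive) auto
      also have "\<dots> \<le> ennreal (vol L P / 2) + ennreal (vol L P / 4)"
        by (intro add_mono PU X2m)
      also have "\<dots> = ennreal (3 / 4 * vol L P)"
        using vP by (simp add: ennreal_plus[symmetric] del: ennreal_plus)
      finally have "vol L P \<le> 3 / 4 * vol L P"
        unfolding emeasure_dcube[OF L] using vP by (subst (asm) ennreal_le_iff) auto
      then show False using vP by simp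
    qed
    have x'0: "M g0 x' \<le> ennreal (C1 * a)" 
    proof -
      have "x' \<notin> E" using x'(2) U(2) by blast
      then show ?thesis by (simp add: E_def not_less)
    qed
    have x'P: "M ?gP x' \<le> ennreal (C2 * a)" using x'(3) by (simp add: X2_def not_less)
    let ?h = "restr (dil L q - dil L P) f"
    have h: "?h \<in> D" by (rule D_restr[OF f]) measurable
    have qP: "dil L P \<subseteq> dil L q" by (rule ch_sub(2)[OF P])
    \<comment> \<open>At the good point the far part is estimated as a difference of two
      restrictions, each of them small there.\<close>
    have "M ?h x' \<le> M g0 x' + M ?gP x'"
      unfolding g0_def by (rule M_restr_split(2)[OF f _ _ qP]) measurable
    also have "\<dots> \<le> ennreal (C1 * a) + ennreal (C2 * a)" by (intro add_mono x'0 x'P)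
    finally have hx': "M ?h x' \<le> ennreal ((C1 + C2) * a)"
      using cpos a by (simp add: ennreal_plus[symmetric] distrib_right del: ennreal_plus)
    have "M ?h x \<le> M ?h x' + (\<integral>\<^sup>+y. ennreal (cmod (K x y - K x' y) * cmod (?h y)) \<partial>lebesgue)"
      by (rule M_smooth[OF h L x x'(1)]) (simp add: restr_def)
    also have "\<dots> \<le> ennreal ((C1 + C2) * a) + ennreal (Ctail \<kappa>0 * a)"
    proof (rule add_mono[OF hx'])
      have "x \<in> dcube L (k, index L k z)" "x' \<in> dcube L (k, index L k z)" using x x'(1) z(1) by auto
      from tail_bound[OF L less_imp_le[OF k] a _ D_measurable[OF f] this, of \<kappa>0]
      show "(\<integral>\<^sup>+y. ennreal (cmod (K x y - K x' y) * cmod (?h y)) \<partial>lebesgue) \<le> ennreal (Ctail \<kappa>0 * a)"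
        using avg cpos unfolding q_idx[OF z(2)] z(1) F_def by simp
    qed
    also have "\<dots> = ennreal ((C1 + C2 + Ctail \<kappa>0) * a)"
      using cpos a by (subst ennreal_plus[symmetric]) (auto simp: distrib_right)
    also have "\<dots> \<le> ennreal (C0 * a)"
      using a by (intro ennreal_leI mult_right_mono) (auto simp: C0_def)
    finally have hx: "M ?h x \<le> ennreal (C0 * a)" .
    have "M g0 x \<le> M ?gP x + M ?h x"
      unfolding g0_def by (rule M_restr_split(1)[OF f _ _ qP]) measurable
    also have "\<dots> \<le> M ?gP x + ennreal (C0 * a)" by (intro add_left_mono hx)
    finally show ?thesis by (simp add: add.commute)
  qed
  have "C1 * a \<le> C0 * a" using cpos a by (intro mult_right_mono) (auto simp: C0_def)
  then have off': "M g0 x \<le> ennreal (C0 * a)" if "x \<in> dcube L q - (\<Union>P\<in>ch. dcube L P)" for x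
    using off[of x] that by (auto intro: order_trans ennreal_leI)
  show ?thesis
    unfolding stopping_family_def
    by (intro exI[of _ ch] conjI ballI AE_I2 ch_disj ch_m)
      (use ch_sub off' on in \<open>auto simp: a_def g0_def\<close>)
qed

text \<open>Functions are not identified modulo null sets, so \<open>M g\<close> need not vanish
  identically for \<open>g\<close> almost everywhere zero. The weak-type bound with norm 0 makes
  each level set \<open>M g > 1 / (m + 1)\<close> null.\<close>

lemma M_null:
  assumes g: "g \<in> D" and "(\<integral>\<^sup>+y. ennreal (cmod (g y) powr r) \<partial>lebesgue) = 0"
  shows "AE x in lebesgue. M g x = 0"
proof -
  have X: "(\<integral>\<^sup>+y. ennreal (cmod (g y) powr r) \<partial>lebesgue) = ennreal 0" using assms by simp
  have [measurable]: "M g \<in> borel_measurable lebesgue" by (rule weak_type(1)[OF g X order_refl])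
  have "AE x in lebesgue. \<forall>m. \<not> M g x > ennreal (1 / real (Suc m))"
  proof (intro AE_all_countable[THEN iffD2] allI)
    fix m
    have "emeasure lebesgue {x. M g x > ennreal (1 / real (Suc m))} \<le> ennreal ((N / (1 / real (Suc m))) powr r * 0)"
      by (rule weak_type(2)[OF g X order_refl]) simp
    moreover have "{x \<in> space lebesgue. M g x > ennreal (1 / real (Suc m))} \<in> sets lebesgue" by measurable
    ultimately have "{x. M g x > ennreal (1 / real (Suc m))} \<in> null_sets lebesgue"
      by (intro null_setsI) (auto simp del: emeasure_completion)
    then show "AE x in lebesgue. \<not> M g x > ennreal (1 / real (Suc m))"
      by (rule AE_I') auto
  qed
  then show ?thesis
  proof eventually_elim
    case (elim x)
    show ?case
    proof (rule ccontr)
      assume "M g x \<noteq> 0"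
      then have "0 < M g x" by (simp add: zero_less_iff_neq_zero)
      then obtain y where y: "0 < y" "y < M g x" using dense by blast
      then obtain t where t: "0 < t" "ennreal t < M g x" by (cases y) auto
      obtain m where "1 / real (Suc m) < t" using t(1) nat_approx_posE by blast
      then have "ennreal (1 / real (Suc m)) < M g x" using t by (meson ennreal_leI less_imp_le order.strict_trans1)
      with elim show False by blast
    qed
  qed
qed

lemma stopping_family_exists:
  fixes q :: "nat \<times> (int^'n)"
  assumes L: "L > 0" and f: "f \<in> D"
    and fin: "\<And>P. (\<integral>\<^sup>+y\<in>dil L P. ennreal (cmod (f y) powr r) \<partial>lebesgue) < \<infinity>"
  shows "\<exists>ch. stopping_family L f q ch"
proof (cases "lavg L f q > 0")
  case True
  then show ?thesis by (rule stopping_family_if_lavg_pos[OF assms])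
next
  case False
  then have 0: "lavg L f q = 0" using lavg_nonneg[of L f q] by simp
  let ?g = "restr (dil L q) f"
  have g: "?g \<in> D" by (rule D_restr[OF f]) measurable
  have "(\<integral>\<^sup>+y. ennreal (cmod (?g y) powr r) \<partial>lebesgue) = 0"
    unfolding nn_integral_restr using lavg[OF L fin, of q] r by (simp add: 0)
  then have "AE x in lebesgue. M ?g x = 0" by (rule M_null[OF g])
  then show ?thesis
    by (intro exI[of _ "{}"]) (auto simp: stopping_family_def disjoint_family_on_def 0)
qed

text \<open>Iterating the stopping families from \<open>(0, 0)\<close>, the total measure at least
  halves at each generation, so almost every point leaves the family after finitely many steps. This
  is why a finite \<open>G\<close>, depending on the point, suffices. Removing the children from
  \<open>q\<close> leaves \<open>E q\<close> with at least half of its volume.\<close>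

lemma sparse_domination:
  assumes L: "L > 0" and f: "f \<in> D"
    and fin: "\<And>P. (\<integral>\<^sup>+y\<in>dil L P. ennreal (cmod (f y) powr r) \<partial>lebesgue) < \<infinity>"
  obtains fam :: "(nat \<times> (int^'n)) set" and E :: "nat \<times> (int^'n) \<Rightarrow> (real^'n) set"
  where "disjoint_family_on E fam"
    "\<And>q. q \<in> fam \<Longrightarrow> E q \<in> sets lebesgue \<and> E q \<subseteq> dcube L q \<and> ennreal (vol L q) \<le> 2 * emeasure lebesgue (E q)"
    "AE x in lebesgue. x \<in> dcube L (0, 0) \<longrightarrow> (\<exists>G. finite G \<and> G \<subseteq> fam \<and>
       M (restr (dil L (0, 0)) f) x \<le> ennreal (C0 * (\<Sum>q\<in>G. lavg L f q * indicator (dcube L q) x)))"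
proof -
  have "\<forall>q::nat \<times> (int^'n). \<exists>ch. stopping_family L f q ch"
    using stopping_family_exists[OF L f fin] by (rule allI)
  then obtain ch :: "nat \<times> (int^'n) \<Rightarrow> (nat \<times> (int^'n)) set" where ch: "\<forall>q. stopping_family L f q (ch q)"
    by (rule choice[THEN exE])
  note ch = ch[unfolded stopping_family_def]
  define W where "W q = (\<Union>P\<in>ch q. dcube L P)" for q
  have ch_disj: "P = P'" if "P \<in> ch q" "P' \<in> ch q" "x \<in> dcube L P" "x \<in> dcube L P'" for q P P' x
    using ch that unfolding disjoint_family_on_def by blast
  have ch_sub: "dcube L P \<subseteq> dcube L q" if "P \<in> ch q" for P q using ch that by blast
  have Wsub: "W q \<subseteq> dcube L q" for q unfolding W_def using ch_sub by blast
  have W_meas: "emeasure lebesgue (W q) \<le> ennreal (vol L q / 2)" for q using ch unfolding W_def by blast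
  have W_sets [measurable]: "W q \<in> sets lebesgue" for q
    unfolding W_def by (intro sets.countable_UN') auto
  have ch_AE: "AE x in lebesgue. x \<in> dcube L q - W q \<longrightarrow> M (restr (dil L q) f) x \<le> ennreal (C0 * lavg L f q)" for q
    using ch unfolding W_def by blast
  have ch_step: "M (restr (dil L q) f) x \<le> ennreal (C0 * lavg L f q) + M (restr (dil L P) f) x"
    if "P \<in> ch q" "x \<in> dcube L P" for q P x using ch that by blast
  define Fl where "Fl = rec_nat {(0, 0)} (\<lambda>_ F. \<Union>q\<in>F. ch q)"
  have Fl0: "Fl 0 = {(0, 0)}" and FlS: "Fl (Suc j) = (\<Union>q\<in>Fl j. ch q)" for j
    by (simp_all add: Fl_def)
  define E where "E q = dcube L q - W q" for q
  have Emeas: "ennreal (vol L q) \<le> 2 * emeasure lebesgue (E q)" for q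
  proof -
    have v: "vol L q > 0" by (rule vol_pos[OF L])
    have "ennreal (vol L q) = emeasure lebesgue (E q \<union> W q)"
      unfolding emeasure_dcube[OF L, symmetric] E_def using Wsub[of q] by (simp add: Un_absorb2 del: emeasure_completion)
    also have "\<dots> \<le> emeasure lebesgue (E q) + emeasure lebesgue (W q)"
      by (intro emeasure_subadditive) (auto simp: E_def)
    also have "\<dots> \<le> emeasure lebesgue (E q) + ennreal (vol L q / 2)"
      by (intro add_left_mono W_meas)
    finally have le: "ennreal (vol L q) \<le> emeasure lebesgue (E q) + ennreal (vol L q / 2)" .
    show ?thesis
    proof (cases "emeasure lebesgue (E q)")
      case (real e)
      have "vol L q \<le> e + vol L q / 2"
        using le real v by (simp add: ennreal_plus[symmetric] del: ennreal_plus emeasure_completion)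
      then have "ennreal (vol L q) \<le> ennreal (2 * e)" by (intro ennreal_leI) simp
      then show ?thesis using real by (simp add: ennreal_mult del: emeasure_completion)
    next
      case top
      then show ?thesis by (simp add: ennreal_mult_top del: emeasure_completion)
    qed
  qed
  have E_ne: "\<not> dcube L q \<subseteq> W q" for q
  proof
    assume "dcube L q \<subseteq> W q"
    then have "E q = {}" by (auto simp: E_def)
    then show False using Emeas[of q] vol_pos[OF L, of q] by simp
  qed
  have Fl_disj: "P = P'" if "P \<in> Fl j" "P' \<in> Fl j" "x \<in> dcube L P" "x \<in> dcube L P'" for j P P' x
    using that
  proof (induction j arbitrary: P P')
    case (Suc j)
    obtain q q' where q: "q \<in> Fl j" "P \<in> ch q" "q' \<in> Fl j" "P' \<in> ch q'" using Suc.prems by (auto simp: FlS)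
    have "q = q'" using Suc.IH[OF q(1,3)] ch_sub[OF q(2)] ch_sub[OF q(4)] Suc.prems by blast
    then show ?case using ch_disj q Suc.prems by blast
  qed (simp add: Fl0)
  \<comment> \<open>A cube of a later generation is swallowed by the union of children of some
    earlier cube, hence it misses the set \<open>E\<close> of that cube.\<close>
  have anc: "\<exists>q\<in>Fl i. dcube L P \<subseteq> W q" if "i < j" "P \<in> Fl j" for i j P
    using that
  proof (induction j arbitrary: P)
    case (Suc j)
    obtain q where q: "q \<in> Fl j" "P \<in> ch q" using Suc.prems by (auto simp: FlS)
    then have PW: "dcube L P \<subseteq> W q" by (auto simp: W_def)
    show ?case
    proof (cases "i = j")
      case True
      then show ?thesis using q PW by blast
    next
      case False
      then have "i < j" using Suc.prems by simp
      from Suc.IH[OF this q(1)] obtain q' where "q' \<in> Fl i" "dcube L q \<subseteq> W q'" by blast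
      then show ?thesis using ch_sub[OF q(2)] by blast
    qed
  qed simp
  have lev: False if "i < j" "q \<in> Fl i" "q' \<in> Fl j" "x \<in> E q" "x \<in> dcube L q'" for i j q q' x
  proof -
    obtain q'' where q'': "q'' \<in> Fl i" "dcube L q' \<subseteq> W q''" using anc \<open>i < j\<close> \<open>q' \<in> Fl j\<close> by blast
    then have x: "x \<in> W q''" "x \<in> dcube L q''" using that Wsub by blast+
    then have "q'' = q" using Fl_disj[OF q''(1) that(2)] that by (auto simp: E_def)
    then show False using x that by (simp add: E_def)
  qed
  \<comment> \<open>No cube occurs in two generations. The sum over \<open>G\<close> runs over a
    set, so a repeated cube would be counted only once in the iteration below.\<close>
  have Fl_uniq: False if "i < j" "q \<in> Fl i" "q \<in> Fl j" for i j q
  proof -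
    obtain x where "x \<in> E q" using E_ne[of q] by (auto simp: E_def)
    then show False using lev[OF that] by (auto simp: E_def)
  qed
  define fam where "fam = (\<Union>j. Fl j)"
  have Edisj: "disjoint_family_on E fam"
    unfolding disjoint_family_on_def
  proof (intro ballI impI, rule ccontr)
    fix q q' assume q: "q \<in> fam" "q' \<in> fam" "q \<noteq> q'" "E q \<inter> E q' \<noteq> {}"
    obtain i j where ij: "q \<in> Fl i" "q' \<in> Fl j" using q by (auto simp: fam_def)
    obtain x where x: "x \<in> E q" "x \<in> E q'" using q by blast
    then have x': "x \<in> dcube L q" "x \<in> dcube L q'" by (auto simp: E_def)
    consider "i = j" | "i < j" | "j < i" by linarith
    then show False
    proof cases
      case 1 then show False using Fl_disj ij x' q(3) by blast
    next
      case 2 then show False using lev[OF 2 ij x(1) x'(2)] by simp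
    next
      case 3 then show False using lev[OF 3 ij(2,1) x(2) x'(1)] by simp
    qed
  qed
  \<comment> \<open>The points still covered after \<open>j\<close> steps; their intersection is
    null by \<open>U_meas\<close>.\<close>
  define U where "U j = (\<Union>q\<in>Fl j. dcube L q)" for j
  have U_sets [measurable]: "U j \<in> sets lebesgue" for j
    unfolding U_def by (intro sets.countable_UN') auto
  have U_meas: "emeasure lebesgue (U j) \<le> ennreal (vol L ((0, 0) :: nat \<times> (int^'n)) * (1 / 2) ^ j)" for j
  proof (induction j)
    case 0
    show ?case by (simp add: U_def Fl0 emeasure_dcube[OF L] del: emeasure_completion)
  next
    case (Suc j)
    have "emeasure lebesgue (U (Suc j)) = emeasure lebesgue (\<Union>q\<in>Fl j. W q)"
      by (simp add: U_def FlS W_def)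
    also have "\<dots> \<le> (\<integral>\<^sup>+q. emeasure lebesgue (W q) \<partial>count_space (Fl j))"
      by (intro emeasure_UN_le_count_space) auto
    also have "\<dots> \<le> (\<integral>\<^sup>+q. ennreal (1 / 2) * emeasure lebesgue (dcube L q) \<partial>count_space (Fl j))"
    proof (rule nn_integral_mono)
      fix q :: "nat \<times> (int^'n)"
      have "ennreal (vol L q / 2) = ennreal (1 / 2) * ennreal (vol L q)"
        using vol_pos[OF L, of q] by (subst ennreal_mult[symmetric]) auto
      then show "emeasure lebesgue (W q) \<le> ennreal (1 / 2) * emeasure lebesgue (dcube L q)"
        using W_meas[of q] unfolding emeasure_dcube[OF L] by simp
    qed
    also have "\<dots> = ennreal (1 / 2) * (\<integral>\<^sup>+q. emeasure lebesgue (dcube L q) \<partial>count_space (Fl j))"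
      by (rule nn_integral_cmult) simp
    also have "(\<integral>\<^sup>+q. emeasure lebesgue (dcube L q) \<partial>count_space (Fl j)) = emeasure lebesgue (U j)"
      unfolding U_def
      by (rule emeasure_UN_countable[symmetric]) (use Fl_disj in \<open>auto simp: disjoint_family_on_def\<close>)
    also have "ennreal (1 / 2) * emeasure lebesgue (U j) \<le> ennreal (1 / 2) * ennreal (vol L ((0, 0) :: nat \<times> (int^'n)) * (1 / 2) ^ j)"
      by (intro mult_left_mono Suc) simp
    also have "\<dots> = ennreal (vol L ((0, 0) :: nat \<times> (int^'n)) * (1 / 2) ^ Suc j)"
      using vol_pos[OF L, of "(0, 0) :: nat \<times> (int^'n)"] by (subst ennreal_mult[symmetric]) auto
    finally show ?case .
  qed
  have null: "(\<Inter>j. U j) \<in> null_sets lebesgue"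
  proof (rule null_setsI)
    show "(\<Inter>j. U j) \<in> sets lebesgue" by (intro sets.countable_INT') auto
    have "(\<lambda>j. ennreal (vol L ((0, 0) :: nat \<times> (int^'n)) * (1 / 2) ^ j)) \<longlonglongrightarrow> ennreal (vol L ((0, 0) :: nat \<times> (int^'n)) * 0)"
      by (intro tendsto_ennrealI tendsto_mult tendsto_const LIMSEQ_power_zero) simp
    moreover have "emeasure lebesgue (\<Inter>j. U j) \<le> ennreal (vol L ((0, 0) :: nat \<times> (int^'n)) * (1 / 2) ^ j)" for j
      by (rule order_trans[OF emeasure_mono U_meas]) auto
    ultimately have "emeasure lebesgue (\<Inter>j. U j) \<le> ennreal (vol L ((0, 0) :: nat \<times> (int^'n)) * 0)"
      by (intro LIMSEQ_le_const[of _ _ "emeasure lebesgue (\<Inter>j. U j)"]) (auto simp del: emeasure_completion)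
    then show "emeasure lebesgue (\<Inter>j. U j) = 0" by (simp del: emeasure_completion)
  qed
  \<comment> \<open>There are countably many cubes, so the exceptional null sets of all stopping
    families can be merged.\<close>
  have "AE x in lebesgue. \<forall>q. x \<in> dcube L q - W q \<longrightarrow> M (restr (dil L q) f) x \<le> ennreal (C0 * lavg L f q)"
  proof -
    have "AE x in lebesgue. \<forall>q\<in>(UNIV :: (nat \<times> (int^'n)) set). x \<in> dcube L q - W q \<longrightarrow> M (restr (dil L q) f) x \<le> ennreal (C0 * lavg L f q)"
      by (intro AE_ball_countable[THEN iffD2] ballI ch_AE) simp
    then show ?thesis by simp
  qed
  moreover have "AE x in lebesgue. x \<notin> (\<Inter>j. U j)" by (rule AE_not_in[OF null])
  ultimately have dom: "AE x in lebesgue. x \<in> dcube L (0, 0) \<longrightarrow> (\<exists>G. finite G \<and> G \<subseteq> fam \<and>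
       M (restr (dil L (0, 0)) f) x \<le> ennreal (C0 * (\<Sum>q\<in>G. lavg L f q * indicator (dcube L q) x)))"
  proof eventually_elim
    case (elim x)
    show ?case
    proof
      assume x0: "x \<in> dcube L (0, 0)"
      let ?S = "\<lambda>G. ennreal (C0 * (\<Sum>q\<in>G. lavg L f q * indicator (dcube L q) x))"
      let ?m = "M (restr (dil L (0, 0)) f) x"
      let ?goal = "\<exists>G. finite G \<and> G \<subseteq> fam \<and> ?m \<le> ?S G"
      have insert: "?S (insert q G) = ?S G + ennreal (C0 * lavg L f q)"
        if "finite G" "q \<notin> G" "x \<in> dcube L q" for q G
      proof -
        have eq: "(\<Sum>p\<in>insert q G. lavg L f p * indicator (dcube L p) x) = lavg L f q + (\<Sum>p\<in>G. lavg L f p * indicator (dcube L p) x)"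
          using that by (subst sum.insert) simp_all
        have "0 \<le> (\<Sum>q\<in>G. lavg L f q * indicator (dcube L q) x)"
          by (intro sum_nonneg mult_nonneg_nonneg lavg_nonneg) auto
        moreover have "ennreal (c * (b + s)) = ennreal (c * s) + ennreal (c * b)"
          if "c \<ge> 0" "b \<ge> 0" "s \<ge> 0" for b c s :: real
          using that by (subst ennreal_plus[symmetric]) (auto simp: distrib_left add.commute)
        ultimately show ?thesis
          unfolding eq using const_pos(6) lavg_nonneg by simp
      qed
      \<comment> \<open>Invariant of the iteration: either the bound is already complete, or the
        cube of generation \<open>j\<close> around \<open>x\<close> carries the remainder and all
        collected cubes are from earlier generations.\<close>
      have "?goal \<or> (\<exists>q\<in>Fl j. x \<in> dcube L q \<and> (\<exists>G. finite G \<and> G \<subseteq> (\<Union>i<j. Fl i) \<and> ?m \<le> ?S G + M (restr (dil L q) f) x))" for j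
      proof (induction j)
        case 0
        show ?case using x0 by (intro disjI2) (auto simp: Fl0 intro!: exI[of _ "{}"])
      next
        case (Suc j)
        show ?case
        proof (cases ?goal)
          case False
          with Suc obtain q G where q: "q \<in> Fl j" "x \<in> dcube L q" and G: "finite G" "G \<subseteq> (\<Union>i<j. Fl i)"
            "?m \<le> ?S G + M (restr (dil L q) f) x" by blast
          have qG: "q \<notin> G" using G(2) q(1) Fl_uniq by blast
          have ins: "finite (insert q G)" "insert q G \<subseteq> (\<Union>i<Suc j. Fl i)"
            using G q unfolding lessThan_Suc by blast+
          show ?thesis
          proof (cases "x \<in> W q")
            case True
            then obtain P where P: "P \<in> ch q" "x \<in> dcube L P" by (auto simp: W_def)
            have "?m \<le> ?S G + (ennreal (C0 * lavg L f q) + M (restr (dil L P) f) x)"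
              using G(3) add_left_mono[OF ch_step[OF P], of "?S G"] by (rule order_trans)
            then have "?m \<le> ?S (insert q G) + M (restr (dil L P) f) x"
              unfolding insert[OF G(1) qG q(2)] by (simp add: add.assoc)
            moreover have "P \<in> Fl (Suc j)" using P q by (auto simp: FlS)
            ultimately show ?thesis using P(2) ins by blast
          next
            case F: False
            then have "M (restr (dil L q) f) x \<le> ennreal (C0 * lavg L f q)" using elim(1) q(2) by blast
            then have "?m \<le> ?S G + ennreal (C0 * lavg L f q)"
              using G(3) add_left_mono[of _ _ "?S G"] order_trans by blast
            then have "?m \<le> ?S (insert q G)" unfolding insert[OF G(1) qG q(2)] .
            moreover have "insert q G \<subseteq> fam" using ins(2) by (auto simp: fam_def)
            ultimately show ?thesis using ins(1) by blast
          qed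
        qed blast
      qed
      moreover obtain j where "x \<notin> U j" using elim(2) by blast
      then have "\<not> (\<exists>q\<in>Fl j. x \<in> dcube L q)" by (auto simp: U_def)
      ultimately show ?goal by blast
    qed
  qed
  show ?thesis
    by (rule that[OF Edisj _ dom]) (use Emeas in \<open>auto simp: E_def simp del: emeasure_completion\<close>)
qed

section \<open>From sparse domination to the weighted estimate\<close>

text \<open>\<open>orlicz_bump\<close> needs a finite family with positive averages and positive
  Luxemburg norms. The family is exhausted through its enumeration, and cubes with zero average or
  zero norm are dropped: the former add nothing to the sum, and on the latter the weight vanishes
  almost everywhere.\<close>

lemma local_weighted_bound:
  assumes A: "young_function A" "doubling A" and p: "1 < p" "1 / p + 1 / p' = 1" and rp: "r < p"
    and I: "\<exists>c>0. (\<integral>\<^sup>+t\<in>{c..}. ennreal ((t / A t) powr (p' - 1) / t) \<partial>lborel) < \<infinity>"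
  obtains C where "C > 0" "\<And>L f w. L > 0 \<Longrightarrow> f \<in> D \<Longrightarrow>
    (\<And>P. (\<integral>\<^sup>+y\<in>dil L P. ennreal (cmod (f y) powr r) \<partial>lebesgue) < \<infinity>) \<Longrightarrow> weight w \<Longrightarrow>
    (\<And>Q. Q \<in> cubes \<Longrightarrow> luxemburg_norm A Q w < top) \<Longrightarrow>
    (\<integral>\<^sup>+x\<in>dcube L (0, 0). epowr (M (restr (dil L (0, 0)) f) x) p * ennreal (w x) \<partial>lebesgue)
      \<le> ennreal C * (\<integral>\<^sup>+x. ennreal (cmod (f x) powr p) * orlicz_maximal A w x \<partial>lebesgue)"
proof (rule orlicz_bump[where 'n = 'n, OF A p _ rp I])
  show "0 < r" using r by simp
next
  fix B :: real
  assume B: "B > 0" "\<And>L (G :: (nat \<times> (int^'n)) set) E a s g w W.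
    L > 0 \<Longrightarrow> finite G \<Longrightarrow> (\<And>q. q \<in> G \<Longrightarrow> E q \<in> sets lebesgue \<and> E q \<subseteq> dcube L q
       \<and> ennreal (vol L q) \<le> 2 * emeasure lebesgue (E q)) \<Longrightarrow> disjoint_family_on E G \<Longrightarrow>
    g \<in> borel_measurable lebesgue \<Longrightarrow> w \<in> borel_measurable lebesgue \<Longrightarrow> W \<in> borel_measurable lebesgue \<Longrightarrow>
    (\<And>x. g x \<ge> 0 \<and> w x \<ge> 0 \<and> W x \<ge> 0) \<Longrightarrow>
    (\<And>q. q \<in> G \<Longrightarrow> a q > 0 \<and> ennreal (a q powr r * vol L q) = (\<integral>\<^sup>+x\<in>dil L q. ennreal (g x powr r) \<partial>lebesgue)) \<Longrightarrow>
    (\<And>q. q \<in> G \<Longrightarrow> s q > 0 \<and> (\<integral>\<^sup>+x\<in>dil L q. ennreal (A (w x / s q)) \<partial>lebesgue) \<le> emeasure lebesgue (dil L q)) \<Longrightarrow>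
    (\<And>q x. q \<in> G \<Longrightarrow> x \<in> dil L q \<Longrightarrow> s q \<le> 2 * W x) \<Longrightarrow>
    (\<integral>\<^sup>+x. ennreal ((\<Sum>q\<in>G. a q * indicator (dcube L q) x) powr p * w x) \<partial>lebesgue) < \<infinity> \<Longrightarrow>
    (\<integral>\<^sup>+x. ennreal ((\<Sum>q\<in>G. a q * indicator (dcube L q) x) powr p * w x) \<partial>lebesgue)
      \<le> ennreal B * (\<integral>\<^sup>+x. ennreal (g x powr p * W x) \<partial>lebesgue)"
  note C0pos = const_pos(6)
  define C where "C = C0 powr p * B"
  have Cpos: "C > 0" using B(1) C0pos by (simp add: C_def)
  show thesis
  proof (rule that[OF Cpos])
    fix L :: real and f :: "real^'n \<Rightarrow> complex" and w :: "real^'n \<Rightarrow> real"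
    assume L: "L > 0" and f: "f \<in> D"
      and fin: "\<And>P. (\<integral>\<^sup>+y\<in>dil L P. ennreal (cmod (f y) powr r) \<partial>lebesgue) < \<infinity>"
      and wt: "weight w" and lux: "\<And>Q. Q \<in> cubes \<Longrightarrow> luxemburg_norm A Q w < top"
    have w0: "\<And>x. w x \<ge> 0" using wt by (simp add: weight_def)
    have wm [measurable]: "w \<in> borel_measurable lebesgue" by (rule weight_measurable[OF wt])
    have fm [measurable]: "f \<in> borel_measurable lebesgue" by (rule D_measurable[OF f])
    obtain fam :: "(nat \<times> (int^'n)) set" and E where
      Edisj: "disjoint_family_on E fam" and
      E: "\<And>q. q \<in> fam \<Longrightarrow> E q \<in> sets lebesgue \<and> E q \<subseteq> dcube L q \<and> ennreal (vol L q) \<le> 2 * emeasure lebesgue (E q)" and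
      dom: "AE x in lebesgue. x \<in> dcube L (0, 0) \<longrightarrow> (\<exists>G. finite G \<and> G \<subseteq> fam \<and>
         M (restr (dil L (0, 0)) f) x \<le> ennreal (C0 * (\<Sum>q\<in>G. lavg L f q * indicator (dcube L q) x)))"
      by (rule sparse_domination[OF L f fin]) blast
    define \<sigma> where "\<sigma> q = enn2real (luxemburg_norm A (dil L q) w)" for q :: "nat \<times> (int^'n)"
    have \<sigma>: "ennreal (\<sigma> q) = luxemburg_norm A (dil L q) w" "\<sigma> q \<ge> 0" for q
      using lux[OF dil_in_cubes[OF L, of q]] by (simp_all add: \<sigma>_def)
    define G where "G N = {q \<in> fam. to_nat q < N \<and> lavg L f q > 0 \<and> \<sigma> q > 0}" for N
    have Gfin: "finite (G N)" for N
    proof (rule finite_subset)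
      show "G N \<subseteq> to_nat -` {..<N}" by (auto simp: G_def)
      show "finite ((to_nat :: nat \<times> (int^'n) \<Rightarrow> nat) -` {..<N})"
        by (intro finite_vimageI) auto
    qed
    define S where "S N x = (\<Sum>q\<in>G N. lavg L f q * indicator (dcube L q) x)" for N x
    have S0: "S N x \<ge> 0" for N x
      unfolding S_def by (intro sum_nonneg mult_nonneg_nonneg lavg_nonneg) auto
    have Sm [measurable]: "S N \<in> borel_measurable lebesgue" for N unfolding S_def by measurable
    have Smono: "S N x \<le> S N' x" if "N \<le> N'" for N N' x
      unfolding S_def using that Gfin
      by (intro sum_mono2) (auto simp: G_def lavg_nonneg intro!: mult_nonneg_nonneg)
    let ?X = "\<integral>\<^sup>+x. ennreal (cmod (f x) powr p) * orlicz_maximal A w x \<partial>lebesgue"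
    have bump: "(\<integral>\<^sup>+x. ennreal (S N x powr p * w x) \<partial>lebesgue) \<le> ennreal B * ?X" for N
    proof (cases "G N = {}")
      case True
      then show ?thesis using p by (simp add: S_def)
    next
      case False
      \<comment> \<open>A measurable minorant of the maximal function, which still dominates the
        norm of each selected cube on its dilate.\<close>
      define W where "W x = Max ((\<lambda>q. \<sigma> q * indicator (dil L q) x) ` G N)" for x
      have Wm [measurable]: "W \<in> borel_measurable lebesgue"
        unfolding W_def using Gfin[of N] by (intro borel_measurable_Max) auto
      have Wge: "\<sigma> q * indicator (dil L q) x \<le> W x" if "q \<in> G N" for q x
        unfolding W_def using Gfin[of N] that by (intro Max_ge) auto
      have W0: "W x \<ge> 0" for x
      proof -
        obtain q where "q \<in> G N" using False by blast
        have "0 \<le> \<sigma> q * indicator (dil L q) x" using \<sigma>(2)[of q] by simp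
        then show ?thesis using Wge[OF \<open>q \<in> G N\<close>, of x] by (rule order_trans)
      qed
      have Worl: "ennreal (W x) \<le> orlicz_maximal A w x" for x
      proof -
        have "W x \<in> (\<lambda>q. \<sigma> q * indicator (dil L q) x) ` G N"
          unfolding W_def using Gfin[of N] False by (intro Max_in) auto
        then obtain q where q: "W x = \<sigma> q * indicator (dil L q) x" by blast
        show ?thesis
        proof (cases "x \<in> dil L q")
          case True
          then have "ennreal (W x) = luxemburg_norm A (dil L q) w" using q \<sigma> by simp
          also have "\<dots> \<le> orlicz_maximal A w x"
            unfolding orlicz_maximal_def using True dil_in_cubes[OF L, of q] by (intro SUP_upper) auto
          finally show ?thesis .
        qed (simp add: q)
      qed
      \<comment> \<open>As \<open>\<sigma> q\<close> is positive, \<open>2 * \<sigma> q\<close> lies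
        strictly above the infimum. This is the source of the 2 in
        \<open>s q \<le> 2 * W x\<close>.\<close>
      have "\<forall>q\<in>G N. \<exists>s. s > 0 \<and> s < 2 * \<sigma> q \<and> (\<integral>\<^sup>+y\<in>dil L q. ennreal (A (w y / s)) \<partial>lebesgue) \<le> emeasure lebesgue (dil L q)"
      proof
        fix q assume q: "q \<in> G N"
        then have "\<sigma> q > 0" by (simp add: G_def)
        then have "luxemburg_norm A (dil L q) w < ennreal (2 * \<sigma> q)"
          unfolding \<sigma>(1)[symmetric] by (simp add: ennreal_less_iff)
        from luxemburg_lessD[where w=w, OF dil_in_cubes[OF L] w0 this]
        show "\<exists>s. s > 0 \<and> s < 2 * \<sigma> q \<and> (\<integral>\<^sup>+y\<in>dil L q. ennreal (A (w y / s)) \<partial>lebesgue) \<le> emeasure lebesgue (dil L q)"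
          by blast
      qed
      then obtain s where s: "\<forall>q\<in>G N. s q > 0 \<and> s q < 2 * \<sigma> q \<and>
          (\<integral>\<^sup>+y\<in>dil L q. ennreal (A (w y / s q)) \<partial>lebesgue) \<le> emeasure lebesgue (dil L q)"
        by (rule bchoice[THEN exE])
      have "(\<integral>\<^sup>+x. ennreal ((\<Sum>q\<in>G N. lavg L f q * indicator (dcube L q) x) powr p * w x) \<partial>lebesgue)
        \<le> ennreal B * (\<integral>\<^sup>+x. ennreal (cmod (f x) powr p * W x) \<partial>lebesgue)"
      proof (rule B(2)[where s = s and E = E, OF L Gfin])
        show "disjoint_family_on E (G N)"
          by (rule disjoint_family_on_mono[OF _ Edisj]) (auto simp: G_def)
        \<comment> \<open>The finiteness behind the absorption: a finite sum is bounded and lives on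
          finitely many compact dilates, on which the weight is integrable.\<close>
        show "(\<integral>\<^sup>+x. ennreal ((\<Sum>q\<in>G N. lavg L f q * indicator (dcube L q) x) powr p * w x) \<partial>lebesgue) < \<infinity>"
        proof -
          define b where "b = (\<Sum>q\<in>G N. lavg L f q) powr p"
          have "(\<integral>\<^sup>+x. ennreal (S N x powr p * w x) \<partial>lebesgue)
            \<le> (\<integral>\<^sup>+x. (\<Sum>q\<in>G N. ennreal b * (ennreal (w x) * indicator (dil L q) x)) \<partial>lebesgue)"
          proof (rule nn_integral_mono)
            fix x
            show "ennreal (S N x powr p * w x) \<le> (\<Sum>q\<in>G N. ennreal b * (ennreal (w x) * indicator (dil L q) x))"
            proof (cases "\<exists>q\<in>G N. x \<in> dcube L q")
              case True
              then obtain q where q: "q \<in> G N" "x \<in> dcube L q" by blast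
              then have xd: "x \<in> dil L q" using dcube_subset_dil[OF L] by blast
              have "S N x \<le> (\<Sum>q\<in>G N. lavg L f q)"
                unfolding S_def using lavg_nonneg by (intro sum_mono) (auto simp: indicator_def)
              then have "S N x powr p * w x \<le> b * w x"
                unfolding b_def using S0 w0 p by (intro mult_right_mono powr_mono2) auto
              then have "ennreal (S N x powr p * w x) \<le> ennreal b * ennreal (w x)"
                using w0 by (simp add: ennreal_leI b_def flip: ennreal_mult)
              also have "\<dots> = ennreal b * (ennreal (w x) * indicator (dil L q) x)" using xd by simp
              also have "\<dots> \<le> (\<Sum>q\<in>G N. ennreal b * (ennreal (w x) * indicator (dil L q) x))"
                using q Gfin[of N] by (intro member_le_sum) auto
              finally show ?thesis .
            next
              case False
              then have "S N x = 0" unfolding S_def by (intro sum.neutral) auto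
              then show ?thesis using p by simp
            qed
          qed
          also have "\<dots> = (\<Sum>q\<in>G N. ennreal b * (\<integral>\<^sup>+x\<in>dil L q. ennreal (w x) \<partial>lebesgue))"
            by (subst nn_integral_sum) (auto simp: nn_integral_cmult)
          also have "\<dots> < \<infinity>"
            using weight_nn_integral_finite[OF wt compact_dil] by (auto simp: ennreal_mult_less_top less_top Gfin)
          finally show ?thesis by (simp add: S_def)
        qed
        show "(\<lambda>x. cmod (f x)) \<in> borel_measurable lebesgue" "w \<in> borel_measurable lebesgue" "W \<in> borel_measurable lebesgue"
          by measurable
        show "0 \<le> cmod (f x) \<and> 0 \<le> w x \<and> 0 \<le> W x" for x using W0 w0 by simp
        fix q assume q: "q \<in> G N"
        then have qf: "q \<in> fam" "lavg L f q > 0" by (simp_all add: G_def)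
        show "E q \<in> sets lebesgue \<and> E q \<subseteq> dcube L q \<and> ennreal (vol L q) \<le> 2 * emeasure lebesgue (E q)"
          by (rule E[OF qf(1)])
        show "0 < lavg L f q \<and> ennreal (lavg L f q powr r * vol L q) = (\<integral>\<^sup>+x\<in>dil L q. ennreal (cmod (f x) powr r) \<partial>lebesgue)"
          using qf(2) lavg[OF L fin] by blast
        show "0 < s q \<and> (\<integral>\<^sup>+x\<in>dil L q. ennreal (A (w x / s q)) \<partial>lebesgue) \<le> emeasure lebesgue (dil L q)"
          using s q by blast
        show "s q \<le> 2 * W x" if "x \<in> dil L q" for x
          using Wge[OF q, of x] that bspec[OF s q] by simp
      qed
      also have "\<dots> \<le> ennreal B * ?X"
        using Worl W0 by (intro mult_left_mono nn_integral_mono) (auto simp: ennreal_mult mult_left_mono)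
      finally show ?thesis by (simp add: S_def)
    qed
    have zero: "AE x in lebesgue. \<forall>q. \<sigma> q = 0 \<longrightarrow> x \<in> dil L q \<longrightarrow> w x = 0"
    proof -
      have "AE x in lebesgue. \<forall>q\<in>(UNIV :: (nat \<times> (int^'n)) set). \<sigma> q = 0 \<longrightarrow> x \<in> dil L q \<longrightarrow> w x = 0"
      proof (intro AE_ball_countable[THEN iffD2] ballI)
        fix q :: "nat \<times> (int^'n)"
        show "AE x in lebesgue. \<sigma> q = 0 \<longrightarrow> x \<in> dil L q \<longrightarrow> w x = 0"
        proof (cases "\<sigma> q = 0")
          case True
          then have "luxemburg_norm A (dil L q) w = 0" using \<sigma>(1)[of q] by simp
          from luxemburg_zero[where w=w, OF A dil_in_cubes[OF L] w0 wm this] show ?thesis by simp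
        qed simp
      qed simp
      then show ?thesis by simp
    qed
    let ?m = "M (restr (dil L (0, 0)) f)"
    have "(\<integral>\<^sup>+x\<in>dcube L (0, 0). epowr (?m x) p * ennreal (w x) \<partial>lebesgue)
      \<le> (\<integral>\<^sup>+x. (SUP N. ennreal (C0 powr p) * ennreal (S N x powr p * w x)) \<partial>lebesgue)"
    proof (rule nn_integral_mono_AE)
      from dom zero show "AE x in lebesgue. epowr (?m x) p * ennreal (w x) * indicator (dcube L (0, 0)) x
        \<le> (SUP N. ennreal (C0 powr p) * ennreal (S N x powr p * w x))"
      proof eventually_elim
        case (elim x)
        show ?case
        proof (cases "x \<in> dcube L (0, 0) \<and> w x \<noteq> 0")
          case True
          with elim(1) obtain H where H: "finite H" "H \<subseteq> fam"
            "?m x \<le> ennreal (C0 * (\<Sum>q\<in>H. lavg L f q * indicator (dcube L q) x))" by blast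
          obtain N where N: "\<forall>q\<in>H. to_nat q < N"
            using H(1) finite_nat_set_iff_bounded[of "to_nat ` H"] by auto
          \<comment> \<open>A term outside \<open>G N\<close> could survive only on a cube with zero
            norm, but \<open>w x \<noteq> 0\<close> excludes \<open>x\<close> from such
            cubes.\<close>
          have "(\<Sum>q\<in>H. lavg L f q * indicator (dcube L q) x) = (\<Sum>q\<in>H \<inter> G N. lavg L f q * indicator (dcube L q) x)"
          proof (rule sum.mono_neutral_right[OF H(1)])
            show "\<forall>q\<in>H - H \<inter> G N. lavg L f q * indicator (dcube L q) x = 0"
            proof
              fix q assume q: "q \<in> H - H \<inter> G N"
              show "lavg L f q * indicator (dcube L q) x = 0"
              proof (rule ccontr)
                assume ne: "lavg L f q * indicator (dcube L q) x \<noteq> 0"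
                then have "lavg L f q > 0" "x \<in> dcube L q"
                  using lavg_nonneg[of L f q] by (auto simp: indicator_def split: if_splits)
                then have "\<sigma> q \<noteq> 0" using elim(2) True dcube_subset_dil[OF L, of q] by blast
                then have "\<sigma> q > 0" using \<sigma>(2)[of q] by simp
                then have "q \<in> G N" using q N H(2) \<open>lavg L f q > 0\<close> by (auto simp: G_def)
                then show False using q by blast
              qed
            qed
          qed simp
          also have "\<dots> \<le> S N x"
            unfolding S_def using Gfin lavg_nonneg by (intro sum_mono2) (auto intro!: mult_nonneg_nonneg)
          finally have "?m x \<le> ennreal (C0 * S N x)"
            using C0pos by (intro order_trans[OF H(3)] ennreal_leI mult_left_mono) auto
          then have "epowr (?m x) p \<le> epowr (ennreal (C0 * S N x)) p" using p by (intro epowr_mono) auto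
          also have "\<dots> = ennreal (C0 powr p * S N x powr p)"
            using C0pos S0 by (simp add: powr_mult)
          finally have "epowr (?m x) p * ennreal (w x) \<le> ennreal (C0 powr p * S N x powr p) * ennreal (w x)"
            by (rule mult_right_mono) simp
          also have "\<dots> = ennreal (C0 powr p) * ennreal (S N x powr p * w x)"
            using w0 by (simp add: ennreal_mult mult.assoc)
          also have "\<dots> \<le> (SUP N. ennreal (C0 powr p) * ennreal (S N x powr p * w x))"
            by (rule SUP_upper) simp
          finally show ?thesis using True by simp
        qed auto
      qed
    qed
    also have "\<dots> = (SUP N. \<integral>\<^sup>+x. ennreal (C0 powr p) * ennreal (S N x powr p * w x) \<partial>lebesgue)"
    proof (rule nn_integral_monotone_convergence_SUP)
      show "incseq (\<lambda>N x. ennreal (C0 powr p) * ennreal (S N x powr p * w x))"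
        using S0 w0 p Smono by (auto simp: incseq_def le_fun_def intro!: mult_left_mono ennreal_leI mult_right_mono powr_mono2)
    qed measurable
    also have "\<dots> \<le> ennreal C * ?X"
    proof (rule SUP_least)
      fix N
      have "(\<integral>\<^sup>+x. ennreal (C0 powr p) * ennreal (S N x powr p * w x) \<partial>lebesgue)
        = ennreal (C0 powr p) * (\<integral>\<^sup>+x. ennreal (S N x powr p * w x) \<partial>lebesgue)"
        by (rule nn_integral_cmult) measurable
      also have "\<dots> \<le> ennreal (C0 powr p) * (ennreal B * ?X)"
        by (intro mult_left_mono bump) simp
      also have "\<dots> = ennreal C * ?X" using B(1) by (simp add: C_def ennreal_mult mult.assoc)
      finally show "(\<integral>\<^sup>+x. ennreal (C0 powr p) * ennreal (S N x powr p * w x) \<partial>lebesgue) \<le> ennreal C * ?X" .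
    qed
    finally show "(\<integral>\<^sup>+x\<in>dcube L (0, 0). epowr (?m x) p * ennreal (w x) \<partial>lebesgue) \<le> ennreal C * ?X" .
  qed
qed

text \<open>Far from \<open>x\<close> the kernel representation applies to the tail of
  \<open>f\<close>, and its absolute integral bounds all modulations at once. This tail tends to 0
  by dominated convergence, so half of \<open>M f x\<close> must be carried by the truncations from
  some point on.\<close>

lemma M_truncation:
  assumes f: "f \<in> D"
  shows "eventually (\<lambda>m. M f x \<le> 2 * M (restr (dil (real (Suc m)) (0, 0)) f) x) sequentially"
proof -
  note [measurable] = D_measurable[OF f]
  define Dm where "Dm m = dil (real (Suc m)) ((0, 0) :: nat \<times> (int^'n))" for m
  have Dm_sets [measurable]: "Dm m \<in> sets lebesgue" for m by (simp add: Dm_def)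
  have Dm_mono: "Dm i \<subseteq> Dm j" if "i \<le> j" for i j
    unfolding Dm_def dil_0 using that margin_ge[where 'n='n] by (intro bigcube_mono mult_left_mono) auto
  define g where "g m = restr (UNIV - Dm m) f" for m
  have g: "g m \<in> D" for m
    unfolding g_def by (rule D_restr[OF f], rule sets.Diff) (simp_all add: Dm_sets)
  obtain m0 :: nat where m0: "norm x < real m0" using reals_Archimedean2 by blast
  have xm: "x \<in> dcube (real (Suc m)) (0, 0)" if "m \<ge> m0" for m
  proof -
    have "\<bar>x $ i\<bar> < real (Suc m)" for i using component_le_norm_cart[of x i] m0 that by linarith
    then show ?thesis by (auto simp: index_dcube0 abs_less_iff intro: less_imp_le) (smt (verit))
  qed
  have off: "x \<notin> closure {y. b y * g m y \<noteq> 0}" if "m \<ge> m0" for m b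
  proof -
    have "{y. b y * g m y \<noteq> 0} \<subseteq> - Dm m" by (auto simp: g_def restr_def)
    then have "closure {y. b y * g m y \<noteq> 0} \<subseteq> - interior (Dm m)"
      using closure_mono[of "{y. b y * g m y \<noteq> 0}" "- Dm m"] by (simp add: closure_complement)
    then show ?thesis using dcube_interior_dil[OF _ xm[OF that]] by (auto simp: Dm_def)
  qed
  define t where "t m = (\<integral>\<^sup>+y. ennreal (cmod (K x y * g m y)) \<partial>lebesgue)" for m
  have Mg: "M (g m) x \<le> t m" if m: "m \<ge> m0" for m
    unfolding M_eq
  proof (rule SUP_least)
    fix \<alpha> assume \<alpha>: "\<alpha> \<in> Ind"
    have k: "integrable lebesgue (\<lambda>y. K x y * (e \<alpha> y * g m y))"
      "T (\<lambda>y. e \<alpha> y * g m y) x = (\<integral>y. K x y * (e \<alpha> y * g m y) \<partial>lebesgue)"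
      using T_kernel[OF D_e[OF g \<alpha>] off[OF m]] by blast+
    have "ennreal (cmod (T (\<lambda>y. e \<alpha> y * g m y) x)) \<le> (\<integral>\<^sup>+y. ennreal (cmod (K x y * (e \<alpha> y * g m y))) \<partial>lebesgue)"
      unfolding k(2) by (rule integral_norm_bound_ennreal[OF k(1)])
    also have "\<dots> = t m" unfolding t_def by (intro nn_integral_cong) (simp add: norm_mult)
    finally show "ennreal (cmod (T (\<lambda>y. e \<alpha> y * g m y) x)) \<le> t m" .
  qed
  have split: "M f x \<le> M (restr (Dm m) f) x + M (g m) x" for m
  proof -
    have "(UNIV :: (real^'n) set) \<in> sets lebesgue" by simp
    from M_restr_split(1)[OF f this Dm_sets subset_UNIV, of x m]
    have "M (restr UNIV f) x \<le> M (restr (Dm m) f) x + M (g m) x" by (simp only: g_def)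
    moreover have "restr UNIV f = f" by (simp add: restr_def)
    ultimately show ?thesis by simp
  qed
  \<comment> \<open>The representation includes integrability, and this one tail dominates all later
    ones.\<close>
  have int0: "integrable lebesgue (\<lambda>y. K x y * g m0 y)"
    using T_kernel[OF g] off[of m0 "\<lambda>_. 1"] by simp
  define h where "h y = ennreal (cmod (K x y * g m0 y))" for y
  have [measurable]: "h \<in> borel_measurable lebesgue"
    unfolding h_def using int0 by measurable
  have hfin: "(\<integral>\<^sup>+y. h y \<partial>lebesgue) < \<infinity>" using int0 unfolding h_def by (simp add: integrable_iff_bounded)
  have "(\<lambda>m. \<integral>\<^sup>+y. h y * indicator (UNIV - Dm m) y \<partial>lebesgue) \<longlonglongrightarrow> (\<integral>\<^sup>+y. 0 \<partial>(lebesgue :: (real^'n) measure))"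
  proof (rule nn_integral_dominated_convergence[where w = h])
    show "AE y in lebesgue. (\<lambda>m. h y * indicator (UNIV - Dm m) y) \<longlonglongrightarrow> 0"
    proof (rule AE_I2)
      fix y :: "real^'n"
      have "eventually (\<lambda>m. {y} \<subseteq> Dm m) sequentially" unfolding Dm_def by (rule eventually_subset_dil_0) simp
      then have "eventually (\<lambda>m. h y * indicator (UNIV - Dm m) y = 0) sequentially"
        by eventually_elim simp
      then show "(\<lambda>m. h y * indicator (UNIV - Dm m) y) \<longlonglongrightarrow> 0" by (rule tendsto_eventually)
    qed
  qed (use hfin in \<open>auto simp: indicator_def\<close>)
  moreover have "t m = (\<integral>\<^sup>+y. h y * indicator (UNIV - Dm m) y \<partial>lebesgue)" if "m \<ge> m0" for m
    unfolding t_def h_def using Dm_mono[OF that] by (intro nn_integral_cong) (auto simp: g_def restr_def indicator_def)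
  then have "eventually (\<lambda>m. (\<integral>\<^sup>+y. h y * indicator (UNIV - Dm m) y \<partial>lebesgue) = t m) sequentially"
    unfolding eventually_sequentially by metis
  ultimately have t0: "t \<longlonglongrightarrow> 0"
    using tendsto_cong[of "\<lambda>m. \<integral>\<^sup>+y. h y * indicator (UNIV - Dm m) y \<partial>lebesgue" t] by simp
  have le: "eventually (\<lambda>m. M f x \<le> M (restr (Dm m) f) x + t m) sequentially"
    unfolding eventually_sequentially
    using split Mg by (meson add_left_mono order_trans)
  \<comment> \<open>The factor 2 absorbs the error \<open>t m\<close>: if \<open>M f x\<close> is
    finite and positive, \<open>t m\<close> drops below half of it; if \<open>M f x\<close> is
    infinite, a finite \<open>t m\<close> forces the truncation to be infinite.\<close>
  show ?thesis
  proof (cases "M f x")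
    case (real c)
    show ?thesis
    proof (cases "c = 0")
      case False
      then have "(0::ennreal) < ennreal (c / 2)" using real by simp
      from order_tendstoD(2)[OF t0 this] le show ?thesis
      proof eventually_elim
        case (elim m)
        have "ennreal c \<le> M (restr (Dm m) f) x + ennreal (c / 2)"
          using elim real by (auto intro: order_trans add_left_mono less_imp_le)
        then show ?case
        proof (cases "M (restr (Dm m) f) x")
          case (real v)
          then have "c \<le> v + c / 2"
            using \<open>ennreal c \<le> M (restr (Dm m) f) x + ennreal (c / 2)\<close> \<open>M f x = ennreal c\<close> \<open>0 \<le> c\<close>
            by (simp add: ennreal_plus[symmetric] del: ennreal_plus)
          then have "ennreal c \<le> ennreal (2 * v)" by (intro ennreal_leI) simp
          then show ?thesis using real \<open>M f x = ennreal c\<close> by (simp add: ennreal_mult Dm_def)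
        qed (simp add: Dm_def ennreal_mult_top)
      qed
    qed (use real in simp)
  next
    case top
    have "(0::ennreal) < 1" by simp
    from order_tendstoD(2)[OF t0 this] le show ?thesis
    proof eventually_elim
      case (elim m)
      have "t m \<noteq> top" using elim(1) by (auto simp: top_unique)
      then have "M (restr (Dm m) f) x = top" using elim(2) top by (auto simp: top_unique)
      then show ?case by (simp add: Dm_def ennreal_mult_top)
    qed
  qed
qed

text \<open>Once the trivial cases are set aside, finiteness of the right-hand side supplies the two
  hypotheses of the local bound: finite Luxemburg norms and local integrability of
  \<open>|f|\<close> to the power \<open>r\<close>. Fatou's lemma then lets the starting cube
  grow.\<close>

lemma weighted_bound:
  assumes A: "young_function A" "doubling A" and p: "1 < p" "1 / p + 1 / p' = 1" and rp: "r < p"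
    and I: "\<exists>c>0. (\<integral>\<^sup>+t\<in>{c..}. ennreal ((t / A t) powr (p' - 1) / t) \<partial>lborel) < \<infinity>"
  shows "\<exists>C>0. \<forall>w f. weight w \<and> f \<in> D \<longrightarrow>
    (\<integral>\<^sup>+x. epowr (M f x) p * ennreal (w x) \<partial>lebesgue)
      \<le> ennreal C * (\<integral>\<^sup>+x. ennreal (cmod (f x) powr p) * orlicz_maximal A w x \<partial>lebesgue)"
proof (rule local_weighted_bound[OF A p rp I])
  fix B :: real
  assume B: "B > 0" "\<And>L f w. L > 0 \<Longrightarrow> f \<in> D \<Longrightarrow>
    (\<And>P. (\<integral>\<^sup>+y\<in>dil L P. ennreal (cmod (f y) powr r) \<partial>lebesgue) < \<infinity>) \<Longrightarrow> weight w \<Longrightarrow>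
    (\<And>Q. Q \<in> cubes \<Longrightarrow> luxemburg_norm A Q w < top) \<Longrightarrow>
    (\<integral>\<^sup>+x\<in>dcube L (0, 0). epowr (M (restr (dil L (0, 0)) f) x) p * ennreal (w x) \<partial>lebesgue)
      \<le> ennreal B * (\<integral>\<^sup>+x. ennreal (cmod (f x) powr p) * orlicz_maximal A w x \<partial>lebesgue)"
  define C where "C = 2 powr p * B"
  have C: "C > 0" using B(1) by (simp add: C_def)
  have "(\<integral>\<^sup>+x. epowr (M f x) p * ennreal (w x) \<partial>lebesgue)
      \<le> ennreal C * (\<integral>\<^sup>+x. ennreal (cmod (f x) powr p) * orlicz_maximal A w x \<partial>lebesgue)"
    if wt: "weight w" and f: "f \<in> D" for w f
  proof -
    let ?X = "\<integral>\<^sup>+x. ennreal (cmod (f x) powr p) * orlicz_maximal A w x \<partial>lebesgue"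
    let ?Y = "\<integral>\<^sup>+x. epowr (M f x) p * ennreal (w x) \<partial>lebesgue"
    have w0: "\<And>x. w x \<ge> 0" using wt by (simp add: weight_def)
    have wm [measurable]: "w \<in> borel_measurable lebesgue" by (rule weight_measurable[OF wt])
    have fm [measurable]: "f \<in> borel_measurable lebesgue" by (rule D_measurable[OF f])
    consider "?X = top" | "AE x in lebesgue. w x = 0" | "AE x in lebesgue. f x = 0" |
      "?X < top" "\<not> (AE x in lebesgue. w x = 0)" "\<not> (AE x in lebesgue. f x = 0)"
      using less_top[of ?X] by blast
    then show ?thesis
    proof cases
      case 1
      then show ?thesis using C by (simp add: ennreal_mult_top)
    next
      case 2
      then have "?Y = (\<integral>\<^sup>+x. 0 \<partial>(lebesgue :: (real^'n) measure))"
        by (intro nn_integral_cong_AE) (auto elim: eventually_mono)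
      then show ?thesis by simp
    next
      case 3
      then have "(\<integral>\<^sup>+y. ennreal (cmod (f y) powr r) \<partial>lebesgue) = (\<integral>\<^sup>+x. 0 \<partial>(lebesgue :: (real^'n) measure))"
        using r by (intro nn_integral_cong_AE) (auto elim: eventually_mono)
      then have "AE x in lebesgue. M f x = 0" using M_null[OF f] by simp
      then have "?Y = (\<integral>\<^sup>+x. 0 \<partial>(lebesgue :: (real^'n) measure))"
        by (intro nn_integral_cong_AE) (auto elim: eventually_mono)
      then show ?thesis by simp
    next
      case 4
      \<comment> \<open>An infinite norm on one cube makes the maximal function infinite everywhere,
        and a finite right-hand side would force \<open>f\<close> to vanish almost
        everywhere.\<close>
      have lux: "luxemburg_norm A Q w < top" if Q: "Q \<in> cubes" for Q
      proof (rule ccontr)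
        assume "\<not> luxemburg_norm A Q w < top"
        have "orlicz_maximal A w x = top" for x
        proof -
          have "bounded (insert x Q)" using cubesD(2)[OF Q] by (simp add: compact_imp_bounded)
          then obtain R where R: "R > 0" "\<And>R'. R' \<ge> R \<Longrightarrow> insert x Q \<subseteq> bigcube R'"
            by (rule bounded_subset_bigcube) blast
          have Q': "bigcube R \<in> cubes" "insert x Q \<subseteq> bigcube R" using R bigcube_cubes by auto
          have "\<not> luxemburg_norm A (bigcube R) w < top"
            using luxemburg_finite_mono[where w=w, OF A(1) Q Q'(1) _ w0 wm] Q' \<open>\<not> luxemburg_norm A Q w < top\<close> by blast
          then have "top = luxemburg_norm A (bigcube R) w" by (metis less_top)
          also have "\<dots> \<le> orlicz_maximal A w x"
            unfolding orlicz_maximal_def using Q' by (intro SUP_upper) auto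
          finally show ?thesis by (simp add: top_unique)
        qed
        then have "?X = (\<integral>\<^sup>+x. ennreal (cmod (f x) powr p) \<partial>lebesgue) * top"
          by (simp add: nn_integral_multc)
        with 4(1) have "(\<integral>\<^sup>+x. ennreal (cmod (f x) powr p) \<partial>lebesgue) = 0"
          by (simp add: ennreal_mult_top split: if_splits)
        then have "AE x in lebesgue. ennreal (cmod (f x) powr p) = 0"
          by (subst (asm) nn_integral_0_iff_AE) auto
        then have "AE x in lebesgue. f x = 0" by (auto elim: eventually_mono)
        with 4(3) show False by blast
      qed
      \<comment> \<open>A nonzero weight has positive norm on a large cube containing
        \<open>Q\<close>. That norm is a lower bound for the maximal function on all of
        \<open>Q\<close>.\<close>
      have finp: "(\<integral>\<^sup>+y\<in>Q. ennreal (cmod (f y) powr p) \<partial>lebesgue) < \<infinity>" if Q: "Q \<in> cubes" for Q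
      proof -
        have [measurable]: "Q \<in> sets lebesgue" by (rule cubesD[OF Q])
        have "\<exists>m. \<not> (AE x in lebesgue. x \<in> bigcube (real m) \<longrightarrow> w x = 0)"
        proof (rule ccontr)
          assume "\<not> (\<exists>m. \<not> (AE x in lebesgue. x \<in> bigcube (real m) \<longrightarrow> w x = 0))"
          then have "\<forall>m. AE x in lebesgue. x \<in> bigcube (real m) \<longrightarrow> w x = 0" by blast
          then have "AE x in lebesgue. \<forall>m::nat. x \<in> bigcube (real m) \<longrightarrow> w x = 0"
            by (rule AE_all_countable[THEN iffD2])
          then have "AE x in lebesgue. w x = 0"
          proof eventually_elim
            case (elim x)
            obtain R where R: "\<And>R'. R' \<ge> R \<Longrightarrow> {x} \<subseteq> bigcube R'" by (rule bounded_subset_bigcube[of "{x}"]) auto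
            obtain m :: nat where "R \<le> real m" using real_arch_simple by blast
            then show ?case using R elim by blast
          qed
          with 4(2) show False by blast
        qed
        then obtain m :: nat where m: "\<not> (AE x in lebesgue. x \<in> bigcube (real m) \<longrightarrow> w x = 0)" by blast
        have "bounded (bigcube (real m) \<union> Q)" using cubesD(2)[OF Q] by (simp add: compact_imp_bounded bigcube_def)
        then obtain R where R: "R > 0" "\<And>R'. R' \<ge> R \<Longrightarrow> bigcube (real m) \<union> Q \<subseteq> bigcube R'"
          by (rule bounded_subset_bigcube) blast
        have Q': "bigcube R \<in> cubes" "bigcube (real m) \<union> Q \<subseteq> bigcube R" using R bigcube_cubes by auto
        have "luxemburg_norm A (bigcube R) w \<noteq> 0"
        proof
          assume "luxemburg_norm A (bigcube R) w = 0"
          from luxemburg_zero[where w=w, OF A Q'(1) w0 wm this]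
          have "AE x in lebesgue. x \<in> bigcube (real m) \<longrightarrow> w x = 0"
            using Q'(2) by (auto elim: eventually_mono)
          with m show False by blast
        qed
        then obtain l where l: "luxemburg_norm A (bigcube R) w = ennreal l" "l > 0"
          using lux[OF Q'(1)] by (cases "luxemburg_norm A (bigcube R) w") auto
        have "ennreal l * (\<integral>\<^sup>+y\<in>Q. ennreal (cmod (f y) powr p) \<partial>lebesgue)
          = (\<integral>\<^sup>+y. ennreal l * (ennreal (cmod (f y) powr p) * indicator Q y) \<partial>lebesgue)"
          by (rule nn_integral_cmult[symmetric]) measurable
        also have "\<dots> \<le> ?X"
        proof (rule nn_integral_mono)
          fix y
          show "ennreal l * (ennreal (cmod (f y) powr p) * indicator Q y) \<le> ennreal (cmod (f y) powr p) * orlicz_maximal A w y"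
          proof (cases "y \<in> Q")
            case True
            have "ennreal l \<le> orlicz_maximal A w y"
              unfolding l(1)[symmetric] orlicz_maximal_def using Q' True by (intro SUP_upper) auto
            then have "ennreal (cmod (f y) powr p) * ennreal l \<le> ennreal (cmod (f y) powr p) * orlicz_maximal A w y"
              by (rule mult_left_mono) simp
            then show ?thesis using True by (simp add: mult.commute)
          qed simp
        qed
        also have "\<dots> < top" by (rule 4(1))
        finally show ?thesis using l(2) by (auto simp: ennreal_mult_less_top less_top)
      qed
      have fin: "(\<integral>\<^sup>+y\<in>Q. ennreal (cmod (f y) powr r) \<partial>lebesgue) < \<infinity>" if Q: "Q \<in> cubes" for Q
      proof -
        have [measurable]: "Q \<in> sets lebesgue" by (rule cubesD[OF Q])
        have "(\<integral>\<^sup>+y\<in>Q. ennreal (cmod (f y) powr r) \<partial>lebesgue)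
          \<le> (\<integral>\<^sup>+y. indicator Q y + ennreal (cmod (f y) powr p) * indicator Q y \<partial>lebesgue)"
        proof (rule nn_integral_mono)
          fix y
          have "cmod (f y) powr r \<le> 1 + cmod (f y) powr p"
          proof (cases "cmod (f y) \<le> 1")
            case True
            then have "cmod (f y) powr r \<le> 1 powr r" using r by (intro powr_mono2) auto
            then show ?thesis by (simp add: add_increasing2)
          next
            case False
            then have "cmod (f y) powr r \<le> cmod (f y) powr p" using rp by (intro powr_mono) auto
            then show ?thesis by simp
          qed
          then have "ennreal (cmod (f y) powr r) \<le> 1 + ennreal (cmod (f y) powr p)"
            by (simp add: ennreal_leI flip: ennreal_1 ennreal_plus)
          then show "ennreal (cmod (f y) powr r) * indicator Q y \<le> indicator Q y + ennreal (cmod (f y) powr p) * indicator Q y"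
            by (auto simp: indicator_def)
        qed
        also have "\<dots> = emeasure lebesgue Q + (\<integral>\<^sup>+y\<in>Q. ennreal (cmod (f y) powr p) \<partial>lebesgue)"
          by (subst nn_integral_add) (auto simp del: emeasure_completion)
        also have "\<dots> < \<infinity>" using finp[OF Q] cubesD(4)[OF Q] by (simp del: emeasure_completion)
        finally show ?thesis .
      qed
      define L where "L m = real (Suc m)" for m
      have L: "L m > 0" for m by (simp add: L_def)
      define g where "g m = restr (dil (L m) (0, 0)) f" for m
      have g: "g m \<in> D" for m unfolding g_def by (rule D_restr[OF f]) measurable
      have gm [measurable]: "M (g m) \<in> borel_measurable lebesgue" for m
      proof -
        have "(\<integral>\<^sup>+y. ennreal (cmod (g m y) powr r) \<partial>lebesgue) < \<infinity>"
          unfolding g_def nn_integral_restr by (rule fin[OF dil_in_cubes[OF L]])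
        then obtain X where "(\<integral>\<^sup>+y. ennreal (cmod (g m y) powr r) \<partial>lebesgue) = ennreal X" "X \<ge> 0"
          by (cases "\<integral>\<^sup>+y. ennreal (cmod (g m y) powr r) \<partial>lebesgue") auto
        then show ?thesis by (rule weak_type(1)[OF g])
      qed
      define u where "u m x = ennreal (2 powr p) * (epowr (M (g m) x) p * ennreal (w x) * indicator (dcube (L m) (0, 0)) x)" for m x
      have um [measurable]: "u m \<in> borel_measurable lebesgue" for m
        unfolding u_def using measurable_compose[OF gm epowr_measurable] by measurable
      \<comment> \<open>\<open>M f\<close> itself is not known to be measurable here, whereas each
        \<open>u m\<close> is; so the comparison is pointwise and Fatou is applied to
        \<open>u\<close>.\<close>
      have "?Y \<le> (\<integral>\<^sup>+x. liminf (\<lambda>m. u m x) \<partial>lebesgue)"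
      proof (intro nn_integral_mono Liminf_bounded)
        fix x :: "real^'n"
        obtain m0 :: nat where m0: "norm x < real m0" using reals_Archimedean2 by blast
        have "eventually (\<lambda>m. m \<ge> m0) sequentially" by (rule eventually_ge_at_top)
        with M_truncation[OF f, of x]
        show "eventually (\<lambda>m. epowr (M f x) p * ennreal (w x) \<le> u m x) sequentially"
        proof eventually_elim
          case (elim m)
          have "\<bar>x $ i\<bar> < L m" for i using component_le_norm_cart[of x i] m0 elim(2) by (simp add: L_def)
          then have xm: "x \<in> dcube (L m) (0, 0)"
            unfolding index_dcube0[OF L] by (simp add: abs_less_iff) (meson less_imp_le minus_less_iff)
          have "epowr (M f x) p \<le> epowr (ennreal 2 * M (g m) x) p"
            using elim(1) p by (intro epowr_mono) (auto simp: g_def L_def)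
          also have "\<dots> = ennreal (2 powr p) * epowr (M (g m) x) p" using p by (intro epowr_cmult) auto
          finally have "epowr (M f x) p * ennreal (w x) \<le> ennreal (2 powr p) * epowr (M (g m) x) p * ennreal (w x)"
            by (rule mult_right_mono) simp
          then show ?case using xm by (simp add: u_def mult.assoc)
        qed
      qed
      also have "\<dots> \<le> liminf (\<lambda>m. \<integral>\<^sup>+x. u m x \<partial>lebesgue)"
        by (rule nn_integral_liminf) measurable
      also have "\<dots> \<le> ennreal C * ?X"
      proof (rule order_trans[OF Liminf_le_Limsup Limsup_bounded])
        show "eventually (\<lambda>m. (\<integral>\<^sup>+x. u m x \<partial>lebesgue) \<le> ennreal C * ?X) sequentially"
        proof (intro always_eventually allI)
          fix m
          have [measurable]: "(\<lambda>x. epowr (M (g m) x) p) \<in> borel_measurable lebesgue"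
            by (rule measurable_compose[OF gm epowr_measurable])
          have "(\<integral>\<^sup>+x. u m x \<partial>lebesgue) = ennreal (2 powr p) * (\<integral>\<^sup>+x\<in>dcube (L m) (0, 0). epowr (M (g m) x) p * ennreal (w x) \<partial>lebesgue)"
            unfolding u_def by (rule nn_integral_cmult) measurable
          also have "\<dots> \<le> ennreal (2 powr p) * (ennreal B * ?X)"
            unfolding g_def using fin[OF dil_in_cubes[OF L]]
            by (intro mult_left_mono B(2)[OF L f _ wt lux]) auto
          also have "\<dots> = ennreal C * ?X" using B(1) by (simp add: C_def ennreal_mult mult.assoc)
          finally show "(\<integral>\<^sup>+x. u m x \<partial>lebesgue) \<le> ennreal C * ?X" .
        qed
      qed simp
      finally show ?thesis .
    qed
  qed
  then show ?thesis using C by blast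
qed

end

theorem theorem1p3:
  fixes D :: "(real^'n \<Rightarrow> complex) set"
    and T :: "(real^'n \<Rightarrow> complex) \<Rightarrow> real^'n \<Rightarrow> complex"
    and I :: "'i set"
    and \<phi> :: "'i \<Rightarrow> real^'n \<Rightarrow> real"
    and \<psi> :: "real \<Rightarrow> real"
    and A :: "real \<Rightarrow> real"
    and r\<^sub>0 p p' :: real
  assumes "CZ_operator D T"
    and "\<And>\<alpha>. \<alpha> \<in> I \<Longrightarrow> \<phi> \<alpha> \<in> borel_measurable lebesgue"
    and "r\<^sub>0 > 1"
    and "\<exists>c>0. \<forall>r. 1 < r \<and> r \<le> r\<^sub>0 \<longrightarrow> weak_type_on D (max_modulated T I \<phi>) r (c * \<psi> r)"
    and "1 < p" and "1 / p + 1 / p' = 1"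
    and "young_function A" and "doubling A"
    and "\<exists>c>0. (\<integral>\<^sup>+t\<in>{c..}. ennreal ((t / A t) powr (p' - 1) / t) \<partial>lborel) < \<infinity>"
  shows "\<exists>C>0. \<forall>w f. weight w \<and> f \<in> D \<longrightarrow>
           (\<integral>\<^sup>+x. epowr (max_modulated T I \<phi> f x) p * ennreal (w x) \<partial>lebesgue)
             \<le> ennreal C *
               (\<integral>\<^sup>+x. ennreal (cmod (f x) powr p) * orlicz_maximal A w x \<partial>lebesgue)"
proof -
  obtain K where K: "CZ_kernel K" and rep: "\<forall>f\<in>D. \<forall>x. x \<notin> closure {y. f y \<noteq> 0} \<longrightarrow>
      integrable lebesgue (\<lambda>y. K x y * f y) \<and> T f x = (\<integral>y. K x y * f y \<partial>lebesgue)"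
    using assms(1) unfolding CZ_operator_def by blast
  obtain c \<delta> where \<delta>: "0 < \<delta>" and smooth: "\<forall>x x' y. norm (x - x') < norm (x - y) / 2 \<longrightarrow>
      cmod (K x y - K x' y) + cmod (K y x - K y x')
        \<le> c * (norm (x - x') powr \<delta> / norm (x - y) powr (real CARD('n) + \<delta>))"
    using K unfolding CZ_kernel_def by blast
  obtain c' where c': "\<forall>r. 1 < r \<and> r \<le> r\<^sub>0 \<longrightarrow> weak_type_on D (max_modulated T I \<phi>) r (c' * \<psi> r)"
    using assms(4) by blast
  \<comment> \<open>Any exponent strictly between 1 and \<open>p\<close> and at most
    \<open>r\<^sub>0\<close> would do; the midpoint of 1 and \<open>p\<close> secures the strict
    inequalities.\<close>
  define r where "r = min r\<^sub>0 ((1 + p) / 2)"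
  have r_props: "1 < r" "r \<le> r\<^sub>0" "r < p" using assms(3,5) by (auto simp: r_def min_def)
  \<comment> \<open>No sign is prescribed for \<open>\<psi> r\<close>, nor for the kernel constant
    \<open>c\<close>; both are replaced by larger constants of the required sign.\<close>
  define N where "N = max 1 (c' * \<psi> r)"
  interpret modulated_operator D T K "max c 0" \<delta> r N I \<phi>
  proof
    show "operator_domain D" "\<And>f g x. f \<in> D \<Longrightarrow> g \<in> D \<Longrightarrow> T (\<lambda>y. f y + g y) x = T f x + T g x"
      "\<And>f c x. f \<in> D \<Longrightarrow> T (\<lambda>y. c * f y) x = c * T f x"
      using assms(1) unfolding CZ_operator_def by blast+
    show "\<And>f x. f \<in> D \<Longrightarrow> x \<notin> closure {y. f y \<noteq> 0} \<Longrightarrow>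
      integrable lebesgue (\<lambda>y. K x y * f y) \<and> T f x = (\<integral>y. K x y * f y \<partial>lebesgue)"
      using rep by blast
    show "cmod (K x y - K x' y) \<le> max c 0 * (norm (x - x') powr \<delta> / norm (x - y) powr (real CARD('n) + \<delta>))"
      if h: "norm (x - x') < norm (x - y) / 2" for x x' y
    proof -
      have "cmod (K x y - K x' y) \<le> cmod (K x y - K x' y) + cmod (K y x - K y x')" by simp
      also have "\<dots> \<le> c * (norm (x - x') powr \<delta> / norm (x - y) powr (real CARD('n) + \<delta>))"
        using smooth h by blast
      also have "\<dots> \<le> max c 0 * (norm (x - x') powr \<delta> / norm (x - y) powr (real CARD('n) + \<delta>))"
        by (intro mult_right_mono) auto
      finally show ?thesis .
    qed
    show "weak_type_on D (max_modulated T I \<phi>) r N"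
      unfolding weak_type_on_def
    proof (intro ballI conjI)
      fix f assume f: "f \<in> D \<inter> Lp_space r"
      have wt: "weak_type_on D (max_modulated T I \<phi>) r (c' * \<psi> r)" using c' r_props by blast
      then show "max_modulated T I \<phi> f \<in> borel_measurable lebesgue" using f unfolding weak_type_on_def by blast
      have "weak_Lp_norm r (max_modulated T I \<phi> f) \<le> ennreal (c' * \<psi> r) * Lp_norm r f"
        using wt f unfolding weak_type_on_def by blast
      also have "\<dots> \<le> ennreal N * Lp_norm r f"
        by (intro mult_right_mono ennreal_leI) (auto simp: N_def)
      finally show "weak_Lp_norm r (max_modulated T I \<phi> f) \<le> ennreal N * Lp_norm r f" .
    qed
  qed (use assms(2) \<delta> r_props in \<open>auto simp: N_def\<close>)
  show ?thesis by (rule weighted_bound[OF assms(7,8,5,6) r_props(3) assms(9)])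
qed

end
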